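(* Let $r\in\mathbb N$. There exists a constant $C>0$ such that for all $f\in\mathbf H$ and all $\sigma>0$, $$\mathcal E_{\Delta}(\sigma,f)\le C\big(\Omega^{r}(\sigma^{-1},f)+\min(\sigma^{-r},1)\|f\|_{\mathbf H}\big).$$
   Context: Let $G=\mathbb R_+\times\mathbb R$ be the "$ax+b$" group with multiplication $(a_1,b_1)(a_2,b_2)=(a_1a_2,\,a_1b_2+b_1)$. Let $T$ be a strongly continuous unitary representation of $G$ in a Hilbert space $\mathbf H$. Put $T_1(t)=T(e^{t},0)$, $T_2(t)=T(1,t)$, with (skew-adjoint) generators $\mathbb A_1,\mathbb A_2$. Let $\Delta$ be the self-adjoint non-negative closure of $-\mathbb A_1^2-\mathbb A_2^2$ defined on the Gårding space (the linear span of vectors $\int_G\varphi(g)T(g)f\,d\mu_l(g)$, $\varphi\in C_0^\infty(G)$, $f\in\mathbf H$, $d\mu_l=a^{-2}da\,db$). For $\omega>0$, the Paley–Wiener space $\mathbf{PW}_\omega(\Delta^{1/2})$ is the range of the spectral projection $\mathbf 1_{[0,\omega]}(\Delta^{1/2})$. The best approximation is $\mathcal E_\Delta(\sigma,f)=\inf_{g\in\mathbf{PW}_\sigma(\Delta^{1/2})}\|f-g\|_{\mathbf H}$. The mixed modulus of continuity is $\Omega^{r}(s,f)=\sum_{(j_1,\dots,j_r)\in\{1,2\}^r}\sup_{0\le t_{1},\dots,t_{r}\le s}\|(T_{j_1}(t_{1})-I)\cdots(T_{j_r}(t_{r})-I)f\|_{\mathbf H}$. *)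

theory Defs
  imports "HOL-Analysis.Analysis"
begin

text \<open>G = {(a,b). a > 0} with (a1,b1)(a2,b2) = (a1 a2, a1 b2 + b1).
  The Hilbert space is a real Hilbert space (real_inner + complete_space); a complex
  Hilbert space is a real Hilbert space with the real part of its inner product, and a
  unitary representation is then an orthogonal one.  T a b is meaningful for a > 0.\<close>

definition axb_group :: "(real \<times> real) set" where
  "axb_group = {p. fst p > 0}"

definition unitary_axb_rep ::
  "(real \<Rightarrow> real \<Rightarrow> 'a::{real_inner,complete_space} \<Rightarrow> 'a) \<Rightarrow> bool" where
  "unitary_axb_rep T \<longleftrightarrow>
     (\<forall>a b. a > 0 \<longrightarrow> bounded_linear (T a b) \<and> surj (T a b) \<and>
              (\<forall>f. norm (T a b f) = norm f)) \<and>
     (\<forall>f. T 1 0 f = f) \<and>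
     (\<forall>a1 b1 a2 b2 f. a1 > 0 \<longrightarrow> a2 > 0 \<longrightarrow>
              T a1 b1 (T a2 b2 f) = T (a1 * a2) (a1 * b2 + b1) f) \<and>
     (\<forall>f. continuous_on axb_group (\<lambda>p. T (fst p) (snd p) f))"

definition T1 :: "(real \<Rightarrow> real \<Rightarrow> 'a \<Rightarrow> 'a) \<Rightarrow> real \<Rightarrow> 'a \<Rightarrow> 'a" where
  "T1 T t = T (exp t) 0"

definition T2 :: "(real \<Rightarrow> real \<Rightarrow> 'a \<Rightarrow> 'a) \<Rightarrow> real \<Rightarrow> 'a \<Rightarrow> 'a" where
  "T2 T t = T 1 t"

definition generator :: "(real \<Rightarrow> 'a::real_normed_vector \<Rightarrow> 'a) \<Rightarrow> 'a \<Rightarrow> 'a" where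
  "generator U f = Lim (at 0) (\<lambda>t. (1 / t) *\<^sub>R (U t f - f))"

fun iter_deriv :: "(real \<times> real) list \<Rightarrow> (real \<times> real \<Rightarrow> real) \<Rightarrow> real \<times> real \<Rightarrow> real" where
  "iter_deriv [] \<phi> = \<phi>"
| "iter_deriv (v # vs) \<phi> = (\<lambda>p. frechet_derivative (iter_deriv vs \<phi>) (at p) v)"

definition smooth2 :: "(real \<times> real \<Rightarrow> real) \<Rightarrow> bool" where
  "smooth2 \<phi> \<longleftrightarrow> (\<forall>vs p. iter_deriv vs \<phi> differentiable (at p))"

definition tsupp :: "(real \<times> real \<Rightarrow> real) \<Rightarrow> (real \<times> real) set" where
  "tsupp \<phi> = closure {p. \<phi> p \<noteq> 0}"

text \<open>C_0^infinity(G), functions extended by zero outside G.\<close>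
definition test_functions :: "(real \<times> real \<Rightarrow> real) set" where
  "test_functions = {\<phi>. smooth2 \<phi> \<and> compact (tsupp \<phi>) \<and> tsupp \<phi> \<subseteq> axb_group}"

text \<open>The vector int_G phi(g) T(g) f d mu_l(g), d mu_l = a^{-2} da db (Henstock-Kurzweil
  integral over R^2; the integrand is continuous with compact support).\<close>
definition garding_vec ::
  "(real \<Rightarrow> real \<Rightarrow> 'a::{real_inner,complete_space} \<Rightarrow> 'a) \<Rightarrow> (real \<times> real \<Rightarrow> real) \<Rightarrow> 'a \<Rightarrow> 'a" where
  "garding_vec T \<phi> f =
     integral UNIV (\<lambda>p. (indicator axb_group p * \<phi> p / (fst p)\<^sup>2) *\<^sub>R T (fst p) (snd p) f)"

definition garding_space :: "(real \<Rightarrow> real \<Rightarrow> 'a::{real_inner,complete_space} \<Rightarrow> 'a) \<Rightarrow> 'a set" where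
  "garding_space T = span {garding_vec T \<phi> f | \<phi> f. \<phi> \<in> test_functions}"

definition laplacian_graph ::
  "(real \<Rightarrow> real \<Rightarrow> 'a::{real_inner,complete_space} \<Rightarrow> 'a) \<Rightarrow> ('a \<times> 'a) set" where
  "laplacian_graph T = closure
     {(f, - generator (T1 T) (generator (T1 T) f) - generator (T2 T) (generator (T2 T) f)) | f.
        f \<in> garding_space T}"

definition proj_valued_measure :: "(real set \<Rightarrow> 'a::{real_inner,complete_space} \<Rightarrow> 'a) \<Rightarrow> bool" where
  "proj_valued_measure E \<longleftrightarrow>
     (\<forall>S \<in> sets borel. bounded_linear (E S) \<and> (\<forall>x y. inner (E S x) y = inner x (E S y))
                       \<and> (\<forall>x. E S (E S x) = E S x)) \<and>
     (\<forall>x. E UNIV x = x) \<and>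
     (\<forall>S \<in> sets borel. \<forall>R \<in> sets borel. \<forall>x. E (S \<inter> R) x = E S (E R x)) \<and>
     (\<forall>S :: nat \<Rightarrow> real set. range S \<subseteq> sets borel \<longrightarrow> disjoint_family S \<longrightarrow>
        (\<forall>x. (\<lambda>n. \<Sum>k<n. E (S k) x) \<longlonglongrightarrow> E (\<Union>k. S k) x))"

text \<open>The scalar spectral measure mu_x(S) = <E(S)x,x> = |E(S)x|^2.\<close>
definition spec_measure :: "(real set \<Rightarrow> 'a::real_inner \<Rightarrow> 'a) \<Rightarrow> 'a \<Rightarrow> real measure" where
  "spec_measure E x = measure_of UNIV (sets borel) (\<lambda>S. ennreal ((norm (E S x))\<^sup>2))"

text \<open>E is the spectral resolution of the self-adjoint operator with graph A, i.e.
  A = int lambda dE(lambda): (x,y) in A iff for every n and z,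
  <E([-n,n]) y, z> = int_{[-n,n]} lambda d<E(lambda)x,z>, the complex/signed measure
  <E(.)x,z> being written by polarization.\<close>
definition spectral_resolution_of ::
  "(real set \<Rightarrow> 'a::{real_inner,complete_space} \<Rightarrow> 'a) \<Rightarrow> ('a \<times> 'a) set \<Rightarrow> bool" where
  "spectral_resolution_of E A \<longleftrightarrow> proj_valued_measure E \<and>
     A = {(x, y). \<forall>(n::nat) z.
            inner (E {- real n..real n} y) z =
              ((\<integral>l. indicator {- real n..real n} l * l \<partial>spec_measure E (x + z))
             - (\<integral>l. indicator {- real n..real n} l * l \<partial>spec_measure E (x - z))) / 4}"

text \<open>Paley-Wiener space PW_omega(Delta^{1/2}) = range of 1_{[0,omega]}(Delta^{1/2})
  = range of E({lambda. sqrt lambda in [0,omega]}) for the spectral resolution E of Delta.\<close>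
definition paley_wiener :: "(real set \<Rightarrow> 'a \<Rightarrow> 'a) \<Rightarrow> real \<Rightarrow> 'a set" where
  "paley_wiener E \<omega> = range (E {l. sqrt l \<in> {0..\<omega>}})"

definition best_approx :: "(real set \<Rightarrow> 'a::real_normed_vector \<Rightarrow> 'a) \<Rightarrow> real \<Rightarrow> 'a \<Rightarrow> real" where
  "best_approx E \<sigma> f = (INF g \<in> paley_wiener E \<sigma>. norm (f - g))"

fun mixed_diff :: "(real \<Rightarrow> real \<Rightarrow> 'a::real_normed_vector \<Rightarrow> 'a) \<Rightarrow> nat list \<Rightarrow> real list \<Rightarrow> 'a \<Rightarrow> 'a" where
  "mixed_diff T (j # js) (t # ts) f =
     (let g = mixed_diff T js ts f in (if j = 1 then T1 T t g else T2 T t g) - g)"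
| "mixed_diff T _ _ f = f"

definition mixed_modulus :: "(real \<Rightarrow> real \<Rightarrow> 'a::real_normed_vector \<Rightarrow> 'a) \<Rightarrow> nat \<Rightarrow> real \<Rightarrow> 'a \<Rightarrow> real" where
  "mixed_modulus T r s f =
     (\<Sum>js \<in> {js. length js = r \<and> set js \<subseteq> {1, 2}}.
        (SUP ts \<in> {ts. length ts = r \<and> (\<forall>t \<in> set ts. 0 \<le> t \<and> t \<le> s)}.
           norm (mixed_diff T js ts f)))"

end

theory Submission
  imports Defs
begin

text \<open>With \<open>s = 1 / \<sigma>\<close> it suffices to bound \<open>E S f\<close>, \<open>S = (\<sigma>\<^sup>2, N]\<close>, for \<open>f\<close> in the Garding space
  and even order \<open>n = 2 k\<close>. Let \<open>M\<close> and \<open>N\<close> be the averages of \<open>T1\<close> and \<open>T2\<close> over \<open>[0, s]\<close>. Since \<open>I - M\<close>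
  and \<open>I - N\<close> are averages of differences, \<open>f\<close> is a combination of the vectors \<open>M\<^sup>a N\<^sup>b f\<close> with
  \<open>a, b \<ge> n\<close> up to an error bounded by the modulus of order \<open>n\<close>. On such a vector the spectral calculus gives
  \<open>\<parallel>E S h\<parallel> \<le> s\<^sup>n \<parallel>\<Delta>\<^sup>k h\<parallel>\<close>, and \<open>\<Delta>\<^sup>k\<close> is a combination of ordered words \<open>A1\<^sup>p A2\<^sup>q\<close>, \<open>p + q \<le> n\<close>. Each
  generator meets an average of its own group and becomes a difference divided by \<open>s\<close>; passing \<open>A2\<close> through
  \<open>T1 t\<close> only costs the weight \<open>exp (- t)\<close>. The resulting differences of lower order \<open>m\<close>, multiplied by
  \<open>s\<^sup>n\<^sup>-\<^sup>m\<close>, are absorbed by a Marchaud inequality that follows from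
  \<open>\<parallel>(U t - I) g\<parallel> \<le> (2 / k) \<parallel>g\<parallel> + k \<parallel>(U t - I)\<^sup>2 g\<parallel>\<close>. That the Garding space is dense needs no approximate identity:
  the ranges of the projections \<open>E [-n, n]\<close> lie in the domain of the closure of \<open>\<Delta>\<close>.\<close>

text \<open>The two subgroups do not commute, and this fixes the arrangement M^a N^b f with the
  averages of \<open>T1\<close> outside: A2 passes \<open>T1 t\<close> with a scalar factor, whereas
  moving A1 through \<open>T2 v\<close> would add v A2 to it. Once the generators are spent,
  differences of \<open>T1\<close> stand to the left of the remaining averages of \<open>T2\<close>,
  and the modulus has no place for these averages. Moving such a difference past \<open>T2 v\<close>
  creates differences of \<open>T2\<close> with step v (exp s - 1), where v is at most a multiple of
  s; this step is O(s^2), hence at most s once s lies below a threshold s0 that depends on the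
  order. Above the threshold the norm of f itself is the bound, which accounts for the summand 1 /
  s0^r of the final constant. The order is even because only integer powers of the Laplacian occur,
  and 2 r is enough since a modulus of order 2 r is dominated by the one of order r. The averages
  are handled as limits: Riemann sums of translates lie in the Garding space, and the estimates for
  them pass to the limit.\<close>

section \<open>Integrals in complete normed spaces\<close>

text \<open>The library proves its integration theorems for the class \<open>banach\<close>, and a type variable of sort
  \<open>{real_inner, complete_space}\<close> is not recognised as an instance of that class, although every
  concrete instance is a Banach space. The copy of the type below carries the instance.\<close>

typedef (overloaded) 'a bcopy = "UNIV :: 'a::{real_normed_vector,complete_space} set"
  morphisms of_bcopy to_bcopy ..

lemma of_to_bcopy [simp]: "of_bcopy (to_bcopy x) = x"
  by (simp add: to_bcopy_inverse)

lemmas to_of_bcopy [simp] = of_bcopy_inverse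

instantiation bcopy :: ("{real_normed_vector,complete_space}") real_normed_vector
begin

definition "0 = to_bcopy 0"
definition "x + y = to_bcopy (of_bcopy x + of_bcopy y)"
definition "x - y = to_bcopy (of_bcopy x - of_bcopy y)"
definition "- x = to_bcopy (- of_bcopy x)"
definition "c *\<^sub>R x = to_bcopy (c *\<^sub>R of_bcopy x)"
definition "norm x = norm (of_bcopy x)"
definition "sgn x = to_bcopy (sgn (of_bcopy x))"
definition "dist x y = dist (of_bcopy x) (of_bcopy y)"
definition "uniformity = (INF e\<in>{0 <..}. principal {(x :: 'a bcopy, y). dist x y < e})"
definition "open U = (\<forall>x\<in>U. eventually (\<lambda>(x', y). x' = x \<longrightarrow> y \<in> U) (uniformity :: ('a bcopy \<times> 'a bcopy) filter))"

lemmas bcopy_defs = zero_bcopy_def plus_bcopy_def minus_bcopy_def uminus_bcopy_def scaleR_bcopy_def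
  norm_bcopy_def sgn_bcopy_def dist_bcopy_def

instance
proof
  show "x + y + z = x + (y + z)" "x + y = y + x" "0 + x = x" "- x + x = 0" "x - y = x + - y"
    "c *\<^sub>R (x + y) = c *\<^sub>R x + c *\<^sub>R y" "(c + d) *\<^sub>R x = c *\<^sub>R x + d *\<^sub>R x" "c *\<^sub>R d *\<^sub>R x = (c * d) *\<^sub>R x"
    "1 *\<^sub>R x = x" "norm (x + y) \<le> norm x + norm y" "norm (c *\<^sub>R x) = \<bar>c\<bar> * norm x"
    "dist x y = norm (x - y)" for x y z :: "'a bcopy" and c d
    by (simp_all add: bcopy_defs algebra_simps norm_triangle_ineq dist_norm)
  show "sgn x = inverse (norm x) *\<^sub>R x" for x :: "'a bcopy"
    by (simp add: bcopy_defs sgn_div_norm)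
  show "norm x = 0 \<longleftrightarrow> x = 0" for x :: "'a bcopy"
    by (simp add: bcopy_defs) (metis of_bcopy_inverse of_to_bcopy)
qed (simp_all add: uniformity_bcopy_def open_bcopy_def)

end

instance bcopy :: ("{real_normed_vector,complete_space}") banach
proof
  fix X :: "nat \<Rightarrow> 'a bcopy" assume "Cauchy X"
  then have "Cauchy (\<lambda>n. of_bcopy (X n))" by (simp add: Cauchy_def dist_bcopy_def)
  then obtain l where "(\<lambda>n. of_bcopy (X n)) \<longlonglongrightarrow> l" using Cauchy_convergent_iff convergent_def by blast
  then have "X \<longlonglongrightarrow> to_bcopy l" by (simp add: lim_sequentially dist_bcopy_def)
  then show "convergent X" by (auto simp: convergent_def)
qed

lemma bounded_linear_to_bcopy: "bounded_linear to_bcopy"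
  by (rule bounded_linear_intro[where K = 1]) (simp_all add: bcopy_defs)

lemma bounded_linear_of_bcopy: "bounded_linear of_bcopy"
  by (rule bounded_linear_intro[where K = 1]) (simp_all add: bcopy_defs)

text \<open>\<open>to_bcopy\<close> and \<open>of_bcopy\<close> are bounded linear and inverse to
  each other, so integrals pass in both directions.\<close>

lemma has_integral_bcopy_iff:
  "((\<lambda>x. to_bcopy (f x)) has_integral to_bcopy i) S \<longleftrightarrow> (f has_integral i) S"
  using has_integral_linear[OF _ bounded_linear_to_bcopy, of f i S]
    has_integral_linear[OF _ bounded_linear_of_bcopy, of "\<lambda>x. to_bcopy (f x)" "to_bcopy i" S]
  by (auto simp: o_def)

lemma continuous_on_to_bcopy: "continuous_on S f \<Longrightarrow> continuous_on S (\<lambda>x. to_bcopy (f x))"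
  by (rule bounded_linear.continuous_on[OF bounded_linear_to_bcopy])

lemma has_integral_integral_continuous:
  fixes f :: "'n::euclidean_space \<Rightarrow> 'a::{real_normed_vector,complete_space}"
  assumes "continuous_on (cbox a b) f"
  shows "(f has_integral integral (cbox a b) f) (cbox a b)"
proof -
  obtain i where "((\<lambda>x. to_bcopy (f x)) has_integral i) (cbox a b)"
    using integrable_continuous[OF continuous_on_to_bcopy[OF assms]] by (auto simp: integrable_on_def)
  then have "(f has_integral of_bcopy i) (cbox a b)"
    using has_integral_bcopy_iff[of f "of_bcopy i" "cbox a b"] by simp
  then show ?thesis by (metis integral_unique)
qed

lemma has_integral_superset_complete:
  fixes f :: "'n::euclidean_space \<Rightarrow> 'a::{real_normed_vector,complete_space}"
  assumes "(f has_integral i) S" "\<And>x. x \<notin> S \<Longrightarrow> f x = 0" "S \<subseteq> T"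
  shows "(f has_integral i) T"
  using has_integral_on_superset[of "\<lambda>x. to_bcopy (f x)" "to_bcopy i" S T] assms
  by (simp add: has_integral_bcopy_iff zero_bcopy_def)

lemma has_integral_combine_complete:
  fixes f :: "real \<Rightarrow> 'a::{real_normed_vector,complete_space}"
  assumes "a \<le> c" "c \<le> b" "(f has_integral i) {a..c}" "(f has_integral j) {c..b}"
  shows "(f has_integral (i + j)) {a..b}"
  using has_integral_combine[of a c b "\<lambda>x. to_bcopy (f x)" "to_bcopy i" "to_bcopy j"] assms
  by (simp add: has_integral_bcopy_iff plus_bcopy_def)

lemma ftc_complete:
  fixes f :: "real \<Rightarrow> 'a::{real_normed_vector,complete_space}"
  assumes "a \<le> b" "\<And>x. x \<in> {a..b} \<Longrightarrow> (f has_vector_derivative f' x) (at x within {a..b})"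
  shows "(f' has_integral (f b - f a)) {a..b}"
proof -
  have "((\<lambda>x. to_bcopy (f' x)) has_integral (to_bcopy (f b) - to_bcopy (f a))) {a..b}"
    by (intro fundamental_theorem_of_calculus assms bounded_linear.has_vector_derivative[OF bounded_linear_to_bcopy])
  moreover have "to_bcopy (f b) - to_bcopy (f a) = to_bcopy (f b - f a)"
    by (simp add: minus_bcopy_def)
  ultimately show ?thesis by (simp add: has_integral_bcopy_iff)
qed

text \<open>Each subinterval contributes at most \<open>e / N\<close> to the error, so on
  \<open>[0, k / N]\<close> it is at most \<open>e * k / N\<close>; the induction also carries
  integrability on the initial segment. The purpose is to approximate averages over a one-parameter
  group by finite combinations of translates.\<close>

lemma riemann_sum_bound:
  fixes f :: "real \<Rightarrow> 'a::{real_normed_vector,complete_space}"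
  assumes cont: "continuous_on {0..1} f" and N: "N > 0" and e: "0 \<le> e"
    and osc: "\<And>x y. x \<in> {0..1} \<Longrightarrow> y \<in> {0..1} \<Longrightarrow> \<bar>x - y\<bar> \<le> 1 / real N \<Longrightarrow> norm (f x - f y) \<le> e"
  shows "norm (integral {0..1} f - (1 / real N) *\<^sub>R (\<Sum>i<N. f (real i / real N))) \<le> e"
proof -
  have "norm (integral {0..real k / real N} f - (1 / real N) *\<^sub>R (\<Sum>i<k. f (real i / real N))) \<le> e * (real k / real N)
    \<and> (f has_integral integral {0..real k / real N} f) {0..real k / real N}" if "k \<le> N" for k
    using that
  proof (induction k)
    case 0
    then show ?case by (simp add: has_integral_refl)
  next
    case (Suc k)
    define a b where "a = real k / real N" and "b = real (Suc k) / real N"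
    have ba: "b = a + 1 / real N" by (simp add: a_def b_def add_divide_distrib)
    have ab: "0 \<le> a" "a \<le> b" "b \<le> 1" using Suc.prems N by (auto simp: a_def b_def divide_right_mono)
    have "continuous_on {a..b} f" by (rule continuous_on_subset[OF cont]) (use ab in auto)
    then have I: "(f has_integral integral {a..b} f) {a..b}"
      using has_integral_integral_continuous[of a b f] by simp
    have IH: "norm (integral {0..a} f - (1 / real N) *\<^sub>R (\<Sum>i<k. f (real i / real N))) \<le> e * a"
      "(f has_integral integral {0..a} f) {0..a}"
      using Suc unfolding a_def by simp_all
    have J: "(f has_integral (integral {0..a} f + integral {a..b} f)) {0..b}"
      by (rule has_integral_combine_complete[OF ab(1,2) IH(2) I])
    have "((\<lambda>x. f x - f a) has_integral (integral {a..b} f - (b - a) *\<^sub>R f a)) {a..b}"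
      using has_integral_diff[OF I has_integral_const_real[of "f a" a b]] ab by simp
    then have "norm (integral {a..b} f - (b - a) *\<^sub>R f a) \<le> e * measure lborel {a..b}"
    proof (rule has_integral_bound_real[OF e finite.emptyI])
      fix x assume "x \<in> {a..b} - {}"
      then have x: "a \<le> x" "x \<le> b" by auto
      then have "x \<in> {0..1}" "a \<in> {0..1}" "\<bar>x - a\<bar> \<le> 1 / real N"
        using ab ba by (auto simp del: divide_le_eq_1 le_divide_eq_1)
      then show "norm (f x - f a) \<le> e" by (rule osc)
    qed
    then have K: "norm (integral {a..b} f - (1 / real N) *\<^sub>R f a) \<le> e * (b - a)"
      using ab ba by simp
    have "integral {0..b} f = integral {0..a} f + integral {a..b} f"
      using J by (rule integral_unique)
    then have "integral {0..b} f - (1 / real N) *\<^sub>R (\<Sum>i<Suc k. f (real i / real N))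
      = (integral {0..a} f - (1 / real N) *\<^sub>R (\<Sum>i<k. f (real i / real N)))
        + (integral {a..b} f - (1 / real N) *\<^sub>R f a)"
      by (simp add: scaleR_add_right a_def)
    then have "norm (integral {0..b} f - (1 / real N) *\<^sub>R (\<Sum>i<Suc k. f (real i / real N)))
        \<le> e * a + e * (b - a)"
      using norm_triangle_mono[OF IH(1) K] by (simp only:)
    also have "\<dots> = e * b" by (simp add: right_diff_distrib)
    finally show ?case using J integral_unique[OF J] unfolding b_def by simp
  qed
  from this[of N] show ?thesis using N by simp
qed

lemma riemann_sum_tendsto:
  fixes f :: "real \<Rightarrow> 'a::{real_normed_vector,complete_space}"
  assumes cont: "continuous_on {0..1} f"
  shows "(\<lambda>N. (1 / real N) *\<^sub>R (\<Sum>i<N. f (real i / real N))) \<longlonglongrightarrow> integral {0..1} f"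
proof (rule LIMSEQ_I)
  fix r :: real assume r: "0 < r"
  have "uniformly_continuous_on {0..1} f" by (rule compact_uniformly_continuous[OF cont]) simp
  then obtain d where d: "d > 0" "\<And>x y. x \<in> {0..1} \<Longrightarrow> y \<in> {0..1} \<Longrightarrow> dist y x < d \<Longrightarrow> dist (f y) (f x) < r / 2"
    unfolding uniformly_continuous_on_def using r by (meson half_gt_zero)
  obtain M where M: "1 / d < real M" using reals_Archimedean2 by blast
  have "norm ((1 / real N) *\<^sub>R (\<Sum>i<N. f (real i / real N)) - integral {0..1} f) < r" if "N \<ge> M" for N
  proof -
    have "1 / d < real N" using M that by linarith
    then have N: "N > 0" using d(1) by (intro gr0I) (auto simp: not_less)
    have N': "1 / real N < d" using \<open>1 / d < real N\<close> d(1) N by (simp add: field_simps)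
    have "norm (integral {0..1} f - (1 / real N) *\<^sub>R (\<Sum>i<N. f (real i / real N))) \<le> r / 2"
    proof (rule riemann_sum_bound[OF cont N])
      fix x y assume xy: "x \<in> {0..1::real}" "y \<in> {0..1}" "\<bar>x - y\<bar> \<le> 1 / real N"
      then have "dist x y < d" using N' by (simp add: dist_real_def)
      then show "norm (f x - f y) \<le> r / 2" using d(2)[OF xy(2,1)] by (simp add: dist_norm)
    qed (use r in simp)
    then show ?thesis using r by (simp add: norm_minus_commute)
  qed
  then show "\<exists>M. \<forall>N\<ge>M. norm ((1 / real N) *\<^sub>R (\<Sum>i<N. f (real i / real N)) - integral {0..1} f) < r" by blast
qed

section \<open>Spectral resolutions\<close>

locale pvm =
  fixes E :: "real set \<Rightarrow> 'a::{real_inner,complete_space} \<Rightarrow> 'a"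
  assumes pvm: "proj_valued_measure E"
begin

lemma bounded_linear_E: "S \<in> sets borel \<Longrightarrow> bounded_linear (E S)"
  and E_sym: "S \<in> sets borel \<Longrightarrow> inner (E S x) y = inner x (E S y)"
  and E_idem: "S \<in> sets borel \<Longrightarrow> E S (E S x) = E S x"
  and E_UNIV: "E UNIV x = x"
  and E_inter: "S \<in> sets borel \<Longrightarrow> R \<in> sets borel \<Longrightarrow> E (S \<inter> R) x = E S (E R x)"
  and E_sigma: "range F \<subseteq> sets borel \<Longrightarrow> disjoint_family F \<Longrightarrow>
        (\<lambda>n. \<Sum>k<n. E (F k) x) \<longlonglongrightarrow> E (\<Union>k. F k) x" for F :: "nat \<Rightarrow> real set"
  using pvm unfolding proj_valued_measure_def by blast+

text \<open>The sums of \<open>n\<close> copies of \<open>E {} x\<close> converge, so consecutive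
  ones have a difference tending to zero; this difference is constant.\<close>

lemma E_empty: "E {} x = 0"
proof -
  have "(\<lambda>n. \<Sum>k<n. E {} x) \<longlonglongrightarrow> E (\<Union>k::nat. {}) x"
    by (rule E_sigma) (auto simp: disjoint_family_on_def)
  then have *: "(\<lambda>n. \<Sum>k<n. E {} x) \<longlonglongrightarrow> E {} x" by simp
  then have "(\<lambda>n. \<Sum>k<Suc n. E {} x) \<longlonglongrightarrow> E {} x" by (rule LIMSEQ_Suc)
  from tendsto_diff[OF this *] have "(\<lambda>n. E {} x) \<longlonglongrightarrow> 0" by simp
  then show ?thesis by (simp add: LIMSEQ_const_iff)
qed

lemma E_union:
  assumes "A \<in> sets borel" "B \<in> sets borel" "A \<inter> B = {}"
  shows "E (A \<union> B) x = E A x + E B x"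
proof -
  let ?F = "\<lambda>k::nat. if k = 0 then A else if k = 1 then B else {}"
  have "(\<lambda>n. \<Sum>k<n. E (?F k) x) \<longlonglongrightarrow> E (\<Union>k. ?F k) x"
    by (rule E_sigma) (use assms in \<open>auto simp: disjoint_family_on_def\<close>)
  moreover have "(\<Union>k. ?F k) = A \<union> B" by (auto split: if_splits)
  ultimately have *: "(\<lambda>n. \<Sum>k<n. E (?F k) x) \<longlonglongrightarrow> E (A \<union> B) x" by simp
  have "(\<Sum>k<n. E (?F k) x) = E A x + E B x" if "n \<ge> 2" for n
  proof -
    have "(\<Sum>k<n. E (?F k) x) = (\<Sum>k\<in>{0,1}. E (?F k) x)"
      by (rule sum.mono_neutral_right) (use that in \<open>auto simp: E_empty\<close>)
    then show ?thesis by simp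
  qed
  then have "(\<lambda>n. \<Sum>k<n. E (?F k) x) \<longlonglongrightarrow> E A x + E B x"
    by (intro tendsto_eventually) (auto simp: eventually_sequentially)
  with * show ?thesis using LIMSEQ_unique by blast
qed

lemma E_finite_union:
  assumes "finite I" "\<And>i. i \<in> I \<Longrightarrow> F i \<in> sets borel" "disjoint_family_on F I"
  shows "E (\<Union>i\<in>I. F i) x = (\<Sum>i\<in>I. E (F i) x)"
  using assms
proof (induction I rule: finite_induct)
  case (insert i I)
  have "F i \<inter> (\<Union>j\<in>I. F j) = {}" using insert.hyps insert.prems by (auto simp: disjoint_family_on_def)
  moreover have "(\<Union>j\<in>I. F j) \<in> sets borel" using insert by (intro sets.finite_UN) auto
  ultimately show ?case using insert by (simp add: E_union disjoint_family_on_def)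
qed (simp add: E_empty)

lemma norm_E_sq: "S \<in> sets borel \<Longrightarrow> (norm (E S x))\<^sup>2 = inner (E S x) x"
  by (metis E_idem E_sym dot_square_norm)

lemma norm_E_le: assumes "S \<in> sets borel" shows "norm (E S x) \<le> norm x"
proof -
  have "norm (E S x) * norm (E S x) \<le> norm (E S x) * norm x"
    using norm_E_sq[OF assms, of x] norm_cauchy_schwarz[of "E S x" x] by (simp add: power2_eq_square)
  then show ?thesis by (cases "norm (E S x) = 0") (auto simp: mult_le_cancel_left)
qed

text \<open>The squared norm equals \<open>inner (E S x) x\<close>, which is linear in
  \<open>E S x\<close>, so strong countable additivity of \<open>E\<close> becomes additivity of
  numbers. This is what gives \<open>spec_measure\<close>, built with \<open>measure_of\<close>, its
  intended values.\<close>

lemma countably_additive_spec: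
  "countably_additive (sets borel) (\<lambda>S. ennreal ((norm (E S x))\<^sup>2))"
proof (rule countably_additiveI)
  fix F :: "nat \<Rightarrow> real set"
  assume F: "range F \<subseteq> sets borel" "disjoint_family F" "\<Union> (range F) \<in> sets borel"
  have "(\<lambda>n. inner (\<Sum>k<n. E (F k) x) x) \<longlonglongrightarrow> inner (E (\<Union>k. F k) x) x"
    by (intro tendsto_intros E_sigma F)
  then have "(\<lambda>k. (norm (E (F k) x))\<^sup>2) sums (norm (E (\<Union>k. F k) x))\<^sup>2"
    using F by (simp add: sums_def inner_sum_left norm_E_sq image_subset_iff)
  then show "(\<Sum>k. ennreal ((norm (E (F k) x))\<^sup>2)) = ennreal ((norm (E (\<Union> (range F)) x))\<^sup>2)"
    by (intro suminf_ennreal_eq) auto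
qed

lemma sets_spec [simp, measurable_cong]: "sets (spec_measure E x) = sets borel"
  and space_spec [simp]: "space (spec_measure E x) = UNIV"
  unfolding spec_measure_def
  using sets.sigma_sets_eq[of "borel :: real measure"] by auto

lemma emeasure_spec: "S \<in> sets borel \<Longrightarrow> emeasure (spec_measure E x) S = ennreal ((norm (E S x))\<^sup>2)"
  unfolding spec_measure_def
  using countably_additive_spec[of x] sets.sigma_algebra_axioms[of "borel :: real measure"]
  by (intro emeasure_measure_of_sigma) (auto simp: positive_def E_empty)

lemma measure_spec: "S \<in> sets borel \<Longrightarrow> measure (spec_measure E x) S = (norm (E S x))\<^sup>2"
  by (simp add: measure_def emeasure_spec)

lemma finite_spec: "finite_measure (spec_measure E x)"
  by (rule finite_measureI) (simp add: emeasure_spec)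

section \<open>Riemann-Stieltjes sums for the spectral integral\<close>

definition cell :: "nat \<Rightarrow> int \<Rightarrow> real set" where
  "cell m i = {real_of_int i / real m ..< (real_of_int i + 1) / real m}"

text \<open>Riemann-Stieltjes sum of the identity over \<open>S\<close>, taken at the left endpoints
  of the cells. The index range covers every cell that meets \<open>[-K, K]\<close>, including the
  one whose left endpoint is \<open>K\<close>.\<close>

definition spec_step :: "nat \<Rightarrow> real set \<Rightarrow> nat \<Rightarrow> 'a \<Rightarrow> 'a" where
  "spec_step K S m x = (\<Sum>i\<in>{- int (K * m)..int (K * m)}. (real_of_int i / real m) *\<^sub>R E (cell m i \<inter> S) x)"

text \<open>The polarized form \<open>\<integral>\<^sub>S \<lambda> d\<langle>E(\<cdot>)x,z\<rangle>\<close>.\<close>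
definition spec_form :: "real set \<Rightarrow> 'a \<Rightarrow> 'a \<Rightarrow> real" where
  "spec_form S x z = ((\<integral>l. indicator S l * l \<partial>spec_measure E (x + z))
             - (\<integral>l. indicator S l * l \<partial>spec_measure E (x - z))) / 4"

lemma cell_borel [measurable]: "cell m i \<in> sets borel"
  by (simp add: cell_def)

lemma mem_cell: "m > 0 \<Longrightarrow> l \<in> cell m i \<longleftrightarrow> i = \<lfloor>l * real m\<rfloor>"
  using floor_eq_iff[of "l * real m" i]
  by (auto simp: cell_def pos_divide_le_eq pos_less_divide_eq)

lemma disjoint_cells: "m > 0 \<Longrightarrow> disjoint_family_on (\<lambda>i. cell m i \<inter> S) I"
  by (auto simp: disjoint_family_on_def mem_cell)

lemma cells_cover:
  assumes "m > 0" "S \<subseteq> {- real K..real K}"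
  shows "(\<Union>i\<in>{- int (K * m)..int (K * m)}. cell m i \<inter> S) = S"
proof -
  have "\<lfloor>l * real m\<rfloor> \<in> {- int (K * m)..int (K * m)}" if "l \<in> S" for l
  proof -
    have l: "- real K \<le> l" "l \<le> real K" using assms that by auto
    have "- real K * real m \<le> l * real m" "l * real m \<le> real K * real m"
      using l by (simp_all only: mult_right_mono of_nat_0_le_iff)
    then have "of_int (- int (K * m)) \<le> l * real m" "l * real m \<le> of_int (int (K * m))" by simp_all
    then show ?thesis by (metis atLeastAtMost_iff floor_mono floor_of_int le_floor_iff)
  qed
  then show ?thesis using assms by (auto simp: mem_cell)
qed

text \<open>On \<open>S\<close> the step function differs from the identity by at most the cell
  width \<open>1 / m\<close>, and the total mass of the spectral measure of \<open>u\<close> is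
  \<open>(norm u)\<^sup>2\<close>.\<close>

lemma step_integral:
  assumes "m > 0" "S \<subseteq> {- real K..real K}" and [measurable]: "S \<in> sets borel"
  shows "\<bar>(\<integral>l. indicator S l * l \<partial>spec_measure E u)
          - (\<Sum>i\<in>{- int (K * m)..int (K * m)}. (real_of_int i / real m) * (norm (E (cell m i \<inter> S) u))\<^sup>2)\<bar>
         \<le> (norm u)\<^sup>2 / real m"
proof -
  interpret finite_measure "spec_measure E u" by (rule finite_spec)
  let ?I = "{- int (K * m)..int (K * m)}"
  let ?g = "\<lambda>l. \<Sum>i\<in>?I. (real_of_int i / real m) * indicator (cell m i \<inter> S) l"
  have gi: "integrable (spec_measure E u) ?g"
    by (intro Bochner_Integration.integrable_sum integrable_mult_right integrable_real_indicator)
       (auto simp: emeasure_spec)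
  have gI: "(\<integral>l. ?g l \<partial>spec_measure E u) = (\<Sum>i\<in>?I. (real_of_int i / real m) * (norm (E (cell m i \<inter> S) u))\<^sup>2)"
    by (subst Bochner_Integration.integral_sum)
       (auto simp: measure_spec emeasure_spec intro!: integrable_mult_right integrable_real_indicator)
  have fi: "integrable (spec_measure E u) (\<lambda>l. indicator S l * l)"
  proof (rule integrable_const_bound[where B = "real K"])
    show "AE l in spec_measure E u. norm (indicator S l * l) \<le> real K"
      using assms(2) by (intro AE_I2) (force simp: indicator_def abs_le_iff)
  qed measurable
  have pt: "\<bar>indicator S l * l - ?g l\<bar> \<le> 1 / real m" for l
  proof (cases "l \<in> S")
    case True
    then have "l \<in> (\<Union>i\<in>?I. cell m i \<inter> S)" using cells_cover[OF assms(1,2)] by simp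
    then have fl: "\<lfloor>l * real m\<rfloor> \<in> ?I" using assms(1) by (auto simp: mem_cell)
    have "?g l = (\<Sum>i\<in>?I. if i = \<lfloor>l * real m\<rfloor> then real_of_int i / real m else 0)"
      using assms(1) True by (intro sum.cong) (auto simp: indicator_def mem_cell)
    also have "\<dots> = real_of_int \<lfloor>l * real m\<rfloor> / real m" using fl by simp
    finally have "?g l = real_of_int \<lfloor>l * real m\<rfloor> / real m" .
    moreover have "0 \<le> l * real m - real_of_int \<lfloor>l * real m\<rfloor>" "l * real m - real_of_int \<lfloor>l * real m\<rfloor> \<le> 1"
      by linarith+
    then have "\<bar>l - real_of_int \<lfloor>l * real m\<rfloor> / real m\<bar> \<le> 1 / real m"
      using assms(1) by (auto simp: pos_divide_le_eq pos_le_divide_eq left_diff_distrib abs_le_iff)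
    ultimately show ?thesis using True by simp
  next
    case False
    then show ?thesis by simp
  qed
  have "\<bar>(\<integral>l. indicator S l * l \<partial>spec_measure E u) - (\<integral>l. ?g l \<partial>spec_measure E u)\<bar>
      = \<bar>\<integral>l. indicator S l * l - ?g l \<partial>spec_measure E u\<bar>"
    using fi gi by simp
  also have "\<dots> \<le> (\<integral>l. \<bar>indicator S l * l - ?g l\<bar> \<partial>spec_measure E u)" by (rule integral_abs_bound)
  also have "\<dots> \<le> (\<integral>l. 1 / real m \<partial>spec_measure E u)"
    by (intro integral_mono integrable_abs Bochner_Integration.integrable_diff fi gi integrable_const pt)
  also have "\<dots> = (norm u)\<^sup>2 / real m" by (simp add: measure_spec E_UNIV)
  finally show ?thesis unfolding gI .
qed

text \<open>Polarization turns the difference of the two quadratic sums into four times the bilinear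
  one; the parallelogram law combines the two errors.\<close>

lemma step_form:
  assumes "m > 0" "S \<subseteq> {- real K..real K}" "S \<in> sets borel"
  shows "\<bar>inner (spec_step K S m x) z - spec_form S x z\<bar> \<le> ((norm x)\<^sup>2 + (norm z)\<^sup>2) / (2 * real m)"
proof -
  let ?I = "{- int (K * m)..int (K * m)}"
  let ?s = "\<lambda>u. \<Sum>i\<in>?I. (real_of_int i / real m) * (norm (E (cell m i \<inter> S) u))\<^sup>2"
  have pol: "(norm (E R (x + z)))\<^sup>2 - (norm (E R (x - z)))\<^sup>2 = 4 * inner (E R x) z" if R: "R \<in> sets borel" for R
  proof -
    interpret bounded_linear "E R" by (rule bounded_linear_E[OF R])
    have "(norm (a + b))\<^sup>2 - (norm (a - b))\<^sup>2 = 4 * inner a b" for a b :: 'a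
      by (simp add: power2_norm_eq_inner inner_simps inner_commute)
    then show ?thesis using R by (simp add: add diff) (metis E_idem E_sym)
  qed
  have "?s (x + z) - ?s (x - z)
      = (\<Sum>i\<in>?I. (real_of_int i / real m) * ((norm (E (cell m i \<inter> S) (x + z)))\<^sup>2 - (norm (E (cell m i \<inter> S) (x - z)))\<^sup>2))"
    by (simp add: sum_subtractf right_diff_distrib)
  also have "\<dots> = 4 * inner (spec_step K S m x) z"
    using assms(3) by (simp add: pol spec_step_def inner_sum_left sum_distrib_left mult_ac)
  finally have "inner (spec_step K S m x) z = (?s (x + z) - ?s (x - z)) / 4" by simp
  then have "\<bar>inner (spec_step K S m x) z - spec_form S x z\<bar> \<le>
     ((norm (x + z))\<^sup>2 / real m + (norm (x - z))\<^sup>2 / real m) / 4"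
    using step_integral[OF assms, of "x + z"] step_integral[OF assms, of "x - z"]
    unfolding spec_form_def by argo
  also have "\<dots> = ((norm (x + z))\<^sup>2 + (norm (x - z))\<^sup>2) / (4 * real m)"
    by (simp add: add_divide_distrib)
  also have "\<dots> = ((norm x)\<^sup>2 + (norm z)\<^sup>2) / (2 * real m)"
    unfolding power2_norm_eq_inner using assms(1) by (simp add: inner_simps inner_commute field_simps)
  finally show ?thesis .
qed

lemma step_form_tendsto:
  assumes "S \<subseteq> {- real K..real K}" "S \<in> sets borel"
  shows "(\<lambda>m. inner (spec_step K S m x) z) \<longlonglongrightarrow> spec_form S x z"
proof (rule LIM_zero_cancel, rule Lim_null_comparison)
  show "\<forall>\<^sub>F m in sequentially. norm (inner (spec_step K S m x) z - spec_form S x z)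
        \<le> ((norm x)\<^sup>2 + (norm z)\<^sup>2) / 2 * (1 / real m)"
    using step_form[OF _ assms] by (auto simp: eventually_sequentially intro!: exI[of _ 1])
  show "(\<lambda>m. ((norm x)\<^sup>2 + (norm z)\<^sup>2) / 2 * (1 / real m)) \<longlonglongrightarrow> 0"
    by (intro tendsto_mult_right_zero lim_1_over_n)
qed

lemma spec_step_zero:
  assumes "S \<in> sets borel"
  shows "spec_step K S m 0 = 0"
proof -
  have "E (cell m i \<inter> S) 0 = 0" for i
    using assms by (intro linear_0 bounded_linear.linear bounded_linear_E) auto
  then show ?thesis by (simp add: spec_step_def)
qed

text \<open>Both sums approximate the same form, so their difference is small against every test
  vector.\<close>

lemma spec_step_Cauchy:
  assumes "S \<subseteq> {- real K..real K}" "S \<in> sets borel" "m > 0" "m' > 0"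
  shows "norm (spec_step K S m x - spec_step K S m' x) \<le> norm x * (1 / real m + 1 / real m')"
proof (cases "x = 0 \<or> spec_step K S m x = spec_step K S m' x")
  case True
  then show ?thesis using spec_step_zero[OF assms(2)] by auto
next
  case False
  define u where "u = spec_step K S m x - spec_step K S m' x"
  \<comment> \<open>The test vector points along the difference and has the norm of
    \<open>x\<close>: the error, quadratic in the norms, becomes \<open>(norm x)\<^sup>2 / m\<close>
    for each sum, and one factor \<open>norm x\<close> cancels.\<close>
  define z where "z = (norm x / norm u) *\<^sub>R u"
  have u0: "norm u > 0" using False by (simp add: u_def)
  have z: "norm z = norm x" using u0 by (simp add: z_def)
  have "inner u z = norm x * norm u" using u0 by (simp add: z_def dot_square_norm power2_eq_square)
  moreover have "\<bar>inner u z\<bar> \<le> (norm x)\<^sup>2 / real m + (norm x)\<^sup>2 / real m'"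
    using step_form[OF assms(3,1,2), of x z] step_form[OF assms(4,1,2), of x z]
    unfolding z u_def inner_diff_left by (simp add: field_simps) 
  ultimately have "norm x * norm u \<le> norm x * (norm x * (1 / real m + 1 / real m'))"
    by (simp add: power2_eq_square algebra_simps)
  then show ?thesis using False unfolding u_def by simp
qed

text \<open>The representing vector is the spectral integral over \<open>S\<close> applied to
  \<open>x\<close>, obtained by completeness as a limit of step sums. The index is shifted by one to
  avoid the mesh \<open>1 / 0\<close>.\<close>

lemma spec_operator_exists:
  assumes S: "S \<subseteq> {- real K..real K}" "S \<in> sets borel"
  shows "\<exists>y. \<forall>z. inner y z = spec_form S x z"
proof -
  have "Cauchy (\<lambda>m. spec_step K S (Suc m) x)"
  proof (rule metric_CauchyI)
    fix e :: real assume "e > 0"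
    define M where "M = nat \<lceil>2 * (norm x + 1) / e\<rceil>"
    have "dist (spec_step K S (Suc m) x) (spec_step K S (Suc n) x) < e" if "m \<ge> M" "n \<ge> M" for m n
    proof -
      have b: "norm x * (1 / real (Suc k)) < e / 2" if "k \<ge> M" for k
      proof -
        have "2 * (norm x + 1) / e \<le> real M" unfolding M_def by linarith
        also have "\<dots> < real (Suc k)" using that by simp
        finally have "2 * (norm x + 1) < e * real (Suc k)" using \<open>e > 0\<close> by (simp add: field_simps)
        then show ?thesis by (simp add: field_simps)
      qed
      have "norm (spec_step K S (Suc m) x - spec_step K S (Suc n) x)
            \<le> norm x * (1 / real (Suc m) + 1 / real (Suc n))"
        by (rule spec_step_Cauchy[OF S]) auto
      also have "\<dots> < e" using b[OF that(1)] b[OF that(2)] by (simp only: distrib_left)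
      finally show ?thesis by (simp add: dist_norm)
    qed
    then show "\<exists>M. \<forall>m\<ge>M. \<forall>n\<ge>M. dist (spec_step K S (Suc m) x) (spec_step K S (Suc n) x) < e" by blast
  qed
  then obtain y where y: "(\<lambda>m. spec_step K S (Suc m) x) \<longlonglongrightarrow> y"
    using Cauchy_convergent_iff convergent_def by blast
  have "inner y z = spec_form S x z" for z
    using tendsto_inner[OF y tendsto_const[of z]] LIMSEQ_Suc[OF step_form_tendsto[OF S, of x z]]
      LIMSEQ_unique by blast
  then show ?thesis by blast
qed

text \<open>Both quantities are sums over the same cells with the same nonnegative masses, so bounds
  for the spectral variable on \<open>S\<close> can be compared cell by cell.\<close>

lemma step_inner_range:
  assumes "m > 0" and S: "S \<subseteq> {- real n..real n}" "S \<in> sets borel"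
  shows "(norm (E S x))\<^sup>2 = (\<Sum>i\<in>{- int (n * m)..int (n * m)}. (norm (E (cell m i \<inter> S) x))\<^sup>2)"
    and "inner (spec_step n {- real n..real n} m x) (E S x)
       = (\<Sum>i\<in>{- int (n * m)..int (n * m)}. real_of_int i / real m * (norm (E (cell m i \<inter> S) x))\<^sup>2)"
proof -
  let ?B = "{- real n..real n}" and ?I = "{- int (n * m)..int (n * m)}"
  have meas: "cell m i \<inter> S \<in> sets borel" for i using S by auto
  have "(norm (E S x))\<^sup>2 = (\<Sum>i\<in>?I. inner (E (cell m i \<inter> S) x) x)"
    using norm_E_sq[OF S(2), of x] E_finite_union[of ?I "\<lambda>i. cell m i \<inter> S" x] meas
      disjoint_cells[OF assms(1)] cells_cover[OF assms(1) S(1)] by (simp add: inner_sum_left)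
  also have "\<dots> = (\<Sum>i\<in>?I. (norm (E (cell m i \<inter> S) x))\<^sup>2)"
    using meas by (simp add: norm_E_sq)
  finally show "(norm (E S x))\<^sup>2 = (\<Sum>i\<in>?I. (norm (E (cell m i \<inter> S) x))\<^sup>2)" .
  have "inner (E (cell m i \<inter> ?B) x) (E S x) = (norm (E (cell m i \<inter> S) x))\<^sup>2" for i
  proof -
    have "inner (E (cell m i \<inter> ?B) x) (E S x) = inner (E S (E (cell m i \<inter> ?B) x)) x"
      using S by (simp add: E_sym)
    also have "\<dots> = inner (E (S \<inter> (cell m i \<inter> ?B)) x) x"
      using S E_inter[of S "cell m i \<inter> ?B" x] by simp
    also have "S \<inter> (cell m i \<inter> ?B) = cell m i \<inter> S" using S by auto
    finally show ?thesis using norm_E_sq[OF meas] by simp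
  qed
  then show "inner (spec_step n ?B m x) (E S x)
      = (\<Sum>i\<in>?I. real_of_int i / real m * (norm (E (cell m i \<inter> S) x))\<^sup>2)"
    by (simp add: spec_step_def inner_sum_left)
qed

lemma spec_form_lower:
  assumes S: "S \<subseteq> {c..}" "S \<subseteq> {- real n..real n}" "S \<in> sets borel"
  shows "c * (norm (E S x))\<^sup>2 \<le> spec_form {- real n..real n} x (E S x)"
proof -
  let ?B = "{- real n..real n}"
  have step: "(c - 1 / real m) * (norm (E S x))\<^sup>2 \<le> inner (spec_step n ?B m x) (E S x)" if "m > 0" for m
  proof -
    have "(c - 1 / real m) * (norm (E (cell m i \<inter> S) x))\<^sup>2
          \<le> real_of_int i / real m * (norm (E (cell m i \<inter> S) x))\<^sup>2" for i
    proof (cases "cell m i \<inter> S = {}")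
      case False
      \<comment> \<open>A point of the cell lies less than \<open>1 / m\<close> above the left
        endpoint; this causes the loss of \<open>1 / m\<close>, which disappears in the
        limit.\<close>
      then obtain l where "l \<in> cell m i" "c \<le> l" using S by auto
      then have "c - 1 / real m \<le> real_of_int i / real m"
        by (simp add: cell_def add_divide_distrib)
      then show ?thesis by (rule mult_right_mono) simp
    qed (simp add: E_empty)
    then show ?thesis unfolding step_inner_range[OF that S(2,3)] sum_distrib_left by (rule sum_mono)
  qed
  have "(\<lambda>m. (c - 1 / real m) * (norm (E S x))\<^sup>2) \<longlonglongrightarrow> (c - 0) * (norm (E S x))\<^sup>2"
    by (intro tendsto_intros lim_1_over_n)
  moreover have "(\<lambda>m. inner (spec_step n ?B m x) (E S x)) \<longlonglongrightarrow> spec_form ?B x (E S x)"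
    by (rule step_form_tendsto) auto
  ultimately have "(c - 0) * (norm (E S x))\<^sup>2 \<le> spec_form ?B x (E S x)"
    by (rule LIMSEQ_le) (use step in \<open>auto intro!: exI[of _ 1]\<close>)
  then show ?thesis by simp
qed

text \<open>The coefficients are left endpoints, hence at most any point of their cell, and this
  direction has no loss before the limit.\<close>

lemma spec_form_upper:
  assumes S: "S \<subseteq> {..c}" "S \<subseteq> {- real n..real n}" "S \<in> sets borel"
  shows "spec_form {- real n..real n} x (E S x) \<le> c * (norm (E S x))\<^sup>2"
proof -
  let ?B = "{- real n..real n}"
  have step: "inner (spec_step n ?B m x) (E S x) \<le> c * (norm (E S x))\<^sup>2" if "m > 0" for m
  proof -
    have "real_of_int i / real m * (norm (E (cell m i \<inter> S) x))\<^sup>2 \<le> c * (norm (E (cell m i \<inter> S) x))\<^sup>2" for i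
    proof (cases "cell m i \<inter> S = {}")
      case False
      then obtain l where "l \<in> cell m i" "l \<le> c" using S by auto
      then have "real_of_int i / real m \<le> c" by (simp add: cell_def)
      then show ?thesis by (rule mult_right_mono) simp
    qed (simp add: E_empty)
    then show ?thesis unfolding step_inner_range[OF that S(2,3)] sum_distrib_left by (rule sum_mono)
  qed
  have "(\<lambda>m. inner (spec_step n ?B m x) (E S x)) \<longlonglongrightarrow> spec_form ?B x (E S x)"
    by (rule step_form_tendsto) auto
  then show ?thesis
    by (rule LIMSEQ_le_const2) (use step in \<open>auto intro!: exI[of _ 1]\<close>)
qed

lemma E_incseq:
  assumes B: "incseq B" "\<And>n. B n \<in> sets borel"
  shows "(\<lambda>n. E (B n) x) \<longlonglongrightarrow> E (\<Union>n. B n) x"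
proof -
  have D: "disjointed B k \<in> sets borel" for k
    using B sets.range_disjointed_sets[of B borel] by auto
  have eq: "(\<Sum>k<Suc n. E (disjointed B k) x) = E (B n) x" for n
  proof -
    have "(\<Sum>k<Suc n. E (disjointed B k) x) = E (\<Union>k<Suc n. disjointed B k) x"
      using D disjoint_family_disjointed[of B]
      by (intro E_finite_union[symmetric]) (auto simp: disjoint_family_on_def)
    also have "(\<Union>k<Suc n. disjointed B k) = (\<Union>k<Suc n. B k)"
      using finite_UN_disjointed_eq[of B "Suc n"] by (simp add: lessThan_atLeast0)
    also have "\<dots> = B n" using B(1) by (force simp: incseq_def less_Suc_eq_le)
    finally show ?thesis .
  qed
  have "(\<lambda>n. \<Sum>k<n. E (disjointed B k) x) \<longlonglongrightarrow> E (\<Union>k. disjointed B k) x"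
    using D by (intro E_sigma disjoint_family_disjointed) auto
  from LIMSEQ_Suc[OF this] show ?thesis unfolding eq UN_disjointed_eq .
qed

end

section \<open>Operators given by a spectral resolution\<close>

locale spectral_resolution =
  fixes E :: "real set \<Rightarrow> 'a::{real_inner,complete_space} \<Rightarrow> 'a" and A :: "('a \<times> 'a) set"
  assumes res: "spectral_resolution_of E A"
begin

sublocale pvm E
  using res by unfold_locales (simp add: spectral_resolution_of_def)

lemma graph_iff: "(x, y) \<in> A \<longleftrightarrow> (\<forall>n::nat. \<forall>z. inner (E {- real n..real n} y) z = spec_form {- real n..real n} x z)"
  using res unfolding spectral_resolution_of_def spec_form_def by auto

text \<open>Spectrally bounded vectors lie in the domain: the image is the vector that represents
  the form over \<open>[-k, k]\<close>. The graph condition speaks of every window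
  \<open>[-n, n]\<close>, so the two windows have to be compared.\<close>

lemma range_in_domain: "\<exists>y. (E {- real k..real k} x, y) \<in> A"
proof -
  let ?B = "\<lambda>n::nat. {- real n..real n}"
  let ?x = "E (?B k) x"
  obtain y where y: "\<And>z. inner y z = spec_form (?B k) ?x z"
    using spec_operator_exists[of "?B k" k ?x] by auto
  have "inner (E (?B n) y) z = spec_form (?B n) ?x z" for n z
  proof -
    \<comment> \<open>Step sums can be compared term by term only over a common index range, hence
      the larger of the two windows.\<close>
    define K where "K = max n k"
    have K: "?B n \<subseteq> ?B K" "?B k \<subseteq> ?B K" by (auto simp: K_def)
    have eq: "inner (spec_step K (?B k) m ?x) (E (?B n) z) = inner (spec_step K (?B n) m ?x) z" for m
    proof -
      have "inner (E (cell m i \<inter> ?B k) ?x) (E (?B n) z) = inner (E (cell m i \<inter> ?B n) ?x) z" for i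
      proof -
        have "inner (E (cell m i \<inter> ?B k) ?x) (E (?B n) z) = inner (E (?B n) (E (cell m i \<inter> ?B k) ?x)) z"
          by (simp add: E_sym)
        \<comment> \<open>On a vector in the range of \<open>E (?B k)\<close>, both sides project
          onto the intersection of the cell with both windows.\<close>
        also have "E (?B n) (E (cell m i \<inter> ?B k) ?x) = E (cell m i \<inter> ?B n) ?x"
          by (simp add: E_inter[symmetric] del: Int_atLeastAtMost) (metis (no_types, lifting) Int_assoc Int_commute Int_absorb)
        finally show ?thesis .
      qed
      then show ?thesis by (simp add: spec_step_def inner_sum_left)
    qed
    have "(\<lambda>m. inner (spec_step K (?B n) m ?x) z) \<longlonglongrightarrow> spec_form (?B n) ?x z"
      by (rule step_form_tendsto[OF K(1)]) simp
    moreover have "(\<lambda>m. inner (spec_step K (?B k) m ?x) (E (?B n) z)) \<longlonglongrightarrow> spec_form (?B k) ?x (E (?B n) z)"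
      by (rule step_form_tendsto[OF K(2)]) simp
    ultimately have "spec_form (?B k) ?x (E (?B n) z) = spec_form (?B n) ?x z"
      unfolding eq using LIMSEQ_unique by blast
    then show ?thesis using y[of "E (?B n) z"] by (simp add: E_sym)
  qed
  then show ?thesis unfolding graph_iff by blast
qed

lemma graph_inner:
  assumes "(x, y) \<in> A" "S \<subseteq> {- real n..real n}" "S \<in> sets borel"
  shows "spec_form {- real n..real n} x (E S x) = inner (E S y) (E S x)"
proof -
  have "{- real n..real n} \<inter> S = S" using assms(2) by auto
  then have "E {- real n..real n} (E S x) = E S x" using E_inter[of "{- real n..real n}" S x] assms(3) by simp
  then have "spec_form {- real n..real n} x (E S x) = inner y (E S x)"
    using assms(1) unfolding graph_iff by (metis E_sym borel_closed closed_atLeastAtMost)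
  then show ?thesis using assms(3) by (simp add: E_sym E_idem)
qed

text \<open>Localized form of the inequality A \<ge> c: the form at \<open>E S x\<close> is at least
  \<open>c\<close> times the square of its norm, and Cauchy-Schwarz removes one factor. As
  \<open>S\<close> is bounded, one window \<open>[-n, n]\<close> contains it.\<close>

lemma graph_lower_bound:
  assumes "(x, y) \<in> A" "S \<subseteq> {c..real n}" "S \<in> sets borel" "c \<ge> 0"
  shows "c * norm (E S x) \<le> norm (E S y)"
proof -
  have S: "S \<subseteq> {- real n..real n}" "S \<subseteq> {c..}" using assms by force+
  have "c * (norm (E S x))\<^sup>2 \<le> inner (E S y) (E S x)"
    using spec_form_lower[OF S(2,1) assms(3), of x] graph_inner[OF assms(1) S(1) assms(3)] by linarith
  also have "\<dots> \<le> norm (E S y) * norm (E S x)" by (rule norm_cauchy_schwarz)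
  finally have "(c * norm (E S x)) * norm (E S x) \<le> norm (E S y) * norm (E S x)"
    by (simp add: power2_eq_square mult_ac)
  then show ?thesis by (cases "norm (E S x) = 0") (auto simp: mult_le_cancel_right)
qed

lemma E_balls_tendsto: "(\<lambda>n. E {- real n..real n} x) \<longlonglongrightarrow> x"
proof -
  have "(\<lambda>n. E {- real n..real n} x) \<longlonglongrightarrow> E (\<Union>n. {- real n..real n}) x"
    by (rule E_incseq) (auto simp: incseq_def)
  moreover have "(\<Union>n. {- real n..real n}) = UNIV"
  proof -
    have "\<exists>n. - real n \<le> l \<and> l \<le> real n" for l
      using real_arch_simple[of "\<bar>l\<bar>"] by (auto simp: abs_le_iff intro: minus_le_iff[THEN iffD1])
    then show ?thesis by auto
  qed
  ultimately show ?thesis by (simp add: E_UNIV)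
qed

lemma domain_dense:
  assumes "\<And>x y. (x, y) \<in> A \<Longrightarrow> x \<in> closure G"
  shows "closure G = UNIV"
proof -
  have "x \<in> closure G" for x
  proof -
    have "E {- real n..real n} x \<in> closure G" for n using range_in_domain assms by blast
    then show ?thesis by (rule closed_sequentially[OF closed_closure _ E_balls_tendsto])
  qed
  then show ?thesis by blast
qed

text \<open>The negative half-line is exhausted by compact sets \<open>?B n\<close> that stay away
  from 0. A vector in the range of \<open>E (?B n)\<close> lies in the domain, and there the form is
  at most \<open>- 1 / (n + 1)\<close> times the square of the norm, against the assumed sign.
  Paley-Wiener spaces only see \<open>[0, \<sigma>\<^sup>2]\<close>, so the half-line must carry no
  mass.\<close>

lemma E_negative:
  assumes pos: "\<And>x y. (x, y) \<in> A \<Longrightarrow> inner x y \<ge> 0"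
  shows "E {..<0} x = 0"
proof -
  let ?B = "\<lambda>n::nat. {- real (Suc n)..- 1 / real (Suc n)}"
  have "E (?B n) x = 0" for n
  proof -
    define u where "u = E (?B n) x"
    have sub: "?B n \<subseteq> {- real (Suc n)..real (Suc n)}"
    proof -
      have "- 1 / real (Suc n) \<le> 0" "0 \<le> real (Suc n)" by simp_all
      then show ?thesis by (simp only: atLeastatMost_subset_iff) linarith
    qed
    then have "{- real (Suc n)..real (Suc n)} \<inter> ?B n = ?B n" by blast
    then have "E {- real (Suc n)..real (Suc n)} u = u"
      unfolding u_def by (metis E_inter borel_closed closed_atLeastAtMost)
    then obtain y where y: "(u, y) \<in> A" using range_in_domain[of "Suc n" u] by auto
    have u: "E (?B n) u = u" by (simp add: u_def E_idem)
    have "spec_form {- real (Suc n)..real (Suc n)} u (E (?B n) u) = inner (E (?B n) y) (E (?B n) u)"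
      by (rule graph_inner[OF y sub]) simp
    also have "\<dots> = inner u y"
      by (metis E_sym borel_closed closed_atLeastAtMost inner_commute u)
    finally have "0 \<le> spec_form {- real (Suc n)..real (Suc n)} u (E (?B n) u)"
      using pos[OF y] by simp
    also have "\<dots> \<le> - 1 / real (Suc n) * (norm (E (?B n) u))\<^sup>2"
      by (rule spec_form_upper[OF _ sub]) (simp_all add: subset_iff del: of_nat_Suc)
    finally have "(norm u)\<^sup>2 / real (Suc n) \<le> 0" unfolding u by simp
    then have "(norm u)\<^sup>2 \<le> 0" by (simp add: divide_le_0_iff del: of_nat_Suc)
    then show ?thesis by (simp add: u_def)
  qed
  moreover have "(\<lambda>n. E (?B n) x) \<longlonglongrightarrow> E (\<Union>n. ?B n) x"
  proof (rule E_incseq)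
    have "- real (Suc n) \<le> - real (Suc m) \<and> - 1 / real (Suc m) \<le> - 1 / real (Suc n)" if "m \<le> n" for m n
      using that by (simp add: field_simps)
    then show "incseq ?B" unfolding incseq_def atLeastatMost_subset_iff by blast
  qed simp
  moreover have "(\<Union>n. ?B n) = {..<0}"
  proof -
    have "\<exists>n. - real (Suc n) \<le> l \<and> l \<le> - 1 / real (Suc n)" if "l < 0" for l
    proof -
      obtain n where n: "- l + 1 / (- l) \<le> real n" using real_arch_simple by blast
      have "1 / (- l) > 0" using that by simp
      then have a: "- real (Suc n) \<le> l" "1 / (- l) \<le> real (Suc n)" using n that by linarith+
      then have "1 / real (Suc n) \<le> - l" using that by (simp add: field_simps)
      then show ?thesis using a by (intro exI[of _ n]) auto
    qed
    moreover have "- 1 / real (Suc n) < 0" for n by simp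
    ultimately show ?thesis unfolding set_eq_iff UN_iff atLeastAtMost_iff lessThan_iff by (meson UNIV_I le_less_trans)
  qed
  ultimately show ?thesis by (simp add: LIMSEQ_const_iff)
qed

text \<open>The approximant is the projection of \<open>f\<close> to the Paley-Wiener space. What
  remains is the part of \<open>f\<close> above \<open>\<sigma>\<^sup>2\<close>, reached through
  bounded windows because \<open>graph_lower_bound\<close> speaks of bounded sets.\<close>

lemma best_approx_le:
  assumes neg: "E {..<0} f = 0" and s: "\<sigma> > 0"
    and b: "\<And>N::nat. norm (E {\<sigma>\<^sup>2<..real N} f) \<le> b"
  shows "best_approx E \<sigma> f \<le> b"
proof -
  let ?P = "{l. sqrt l \<in> {0..\<sigma>}}"
  \<comment> \<open>\<open>sqrt\<close> is an odd function on the reals, so a negative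
    \<open>l\<close> has a negative root and drops out of the set.\<close>
  have P: "?P = {0..\<sigma>\<^sup>2}"
  proof -
    have "sqrt l \<le> \<sigma> \<longleftrightarrow> l \<le> \<sigma>\<^sup>2" for l
      using real_sqrt_le_iff[of l "\<sigma>\<^sup>2"] s by (simp only: real_sqrt_abs abs_of_pos)
    then show ?thesis
      by (simp only: set_eq_iff mem_Collect_eq atLeastAtMost_iff real_sqrt_ge_0_iff simp_thms)
  qed
  have Q: "{..<0} \<union> {0..\<sigma>\<^sup>2} = {..\<sigma>\<^sup>2}" by (rule ivl_disj_un) simp
  have "E ({..<0} \<union> {0..\<sigma>\<^sup>2}) f = E {..<0} f + E {0..\<sigma>\<^sup>2} f"
    by (rule E_union) auto
  moreover have "E ({..\<sigma>\<^sup>2} \<union> {\<sigma>\<^sup>2<..}) f = E {..\<sigma>\<^sup>2} f + E {\<sigma>\<^sup>2<..} f"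
    by (rule E_union) auto
  moreover have "{..\<sigma>\<^sup>2} \<union> {\<sigma>\<^sup>2<..} = UNIV" by (simp add: set_eq_iff le_less_linear)
  ultimately have split: "f - E ?P f = E {\<sigma>\<^sup>2<..} f"
    using neg unfolding P Q by (simp add: E_UNIV algebra_simps)
  have "(\<lambda>N. E {\<sigma>\<^sup>2<..real N} f) \<longlonglongrightarrow> E (\<Union>N. {\<sigma>\<^sup>2<..real N}) f"
    by (rule E_incseq) (auto simp: incseq_def)
  moreover have "(\<Union>N. {\<sigma>\<^sup>2<..real N}) = {\<sigma>\<^sup>2<..}"
    by (simp add: set_eq_iff real_arch_simple)
  ultimately have "(\<lambda>N. norm (E {\<sigma>\<^sup>2<..real N} f)) \<longlonglongrightarrow> norm (E {\<sigma>\<^sup>2<..} f)"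
    by (simp add: tendsto_norm)
  then have "norm (E {\<sigma>\<^sup>2<..} f) \<le> b" by (rule LIMSEQ_le_const2) (use b in auto)
  moreover have "best_approx E \<sigma> f \<le> norm (f - E ?P f)"
    unfolding best_approx_def paley_wiener_def
    by (rule cINF_lower) (auto intro!: bdd_belowI2[of _ 0])
  ultimately show ?thesis using split by simp
qed

end

section \<open>The Garding space\<close>

text \<open>Iterated derivatives of products and compositions have unwieldy closed forms; it is
  enough to find a class \<open>P\<close> that contains the function and is stable under one
  directional derivative.\<close>

lemma smooth2_coinduct:
  assumes "\<phi> \<in> P" "\<And>\<psi> p. \<psi> \<in> P \<Longrightarrow> \<psi> differentiable (at p)"
    and "\<And>\<psi> v. \<psi> \<in> P \<Longrightarrow> (\<lambda>p. frechet_derivative \<psi> (at p) v) \<in> P"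
  shows "smooth2 \<phi>"
proof -
  have "iter_deriv vs \<phi> \<in> P" for vs
    by (induction vs) (use assms in auto)
  then show ?thesis using assms(2) by (simp add: smooth2_def)
qed

lemma smooth2_differentiable: "smooth2 \<phi> \<Longrightarrow> \<phi> differentiable (at p)"
  unfolding smooth2_def by (metis iter_deriv.simps(1))

lemma smooth2_has_derivative: "smooth2 \<phi> \<Longrightarrow> (\<phi> has_derivative frechet_derivative \<phi> (at p)) (at p)"
  using smooth2_differentiable frechet_derivative_works by blast

lemma smooth2_continuous: "smooth2 \<phi> \<Longrightarrow> continuous_on S \<phi>"
  by (meson continuous_at_imp_continuous_on differentiable_imp_continuous_within smooth2_differentiable)

lemma smooth2_deriv:
  assumes "smooth2 \<phi>"
  shows "smooth2 (\<lambda>p. frechet_derivative \<phi> (at p) v)"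
proof -
  \<comment> \<open>The head of the list is the derivative taken last, so the first one is appended
    at the end.\<close>
  have "iter_deriv vs (\<lambda>p. frechet_derivative \<phi> (at p) v) = iter_deriv (vs @ [v]) \<phi>" for vs
    by (induction vs) auto
  then show ?thesis using assms by (simp add: smooth2_def)
qed

lemma frechet_derivativeI: "(f has_derivative f') (at x) \<Longrightarrow> frechet_derivative f (at x) = f'"
  by (metis frechet_derivative_at)

lemma smooth2_add:
  assumes "smooth2 \<phi>" "smooth2 \<psi>"
  shows "smooth2 (\<lambda>p. \<phi> p + \<psi> p)"
proof -
  define P where "P = {c. \<exists>a b. c = (\<lambda>p. a p + b p) \<and> smooth2 a \<and> smooth2 b}"
  have PI: "(\<lambda>p. a p + b p) \<in> P" if "smooth2 a" "smooth2 b" for a b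
    using that unfolding P_def mem_Collect_eq by (intro exI[of _ a] exI[of _ b] conjI refl)
  have PE: "\<exists>a b. c = (\<lambda>p. a p + b p) \<and> smooth2 a \<and> smooth2 b" if "c \<in> P" for c
    using that unfolding P_def mem_Collect_eq .
  show ?thesis
  proof (rule smooth2_coinduct[where P = P])
    show "(\<lambda>p. \<phi> p + \<psi> p) \<in> P" by (rule PI[OF assms])
  next
    fix c p assume "c \<in> P"
    then obtain a b where c: "c = (\<lambda>p. a p + b p)" and ab: "smooth2 a" "smooth2 b" using PE by metis
    show "c differentiable at p"
      unfolding c by (intro differentiable_add[OF ab[THEN smooth2_differentiable]])
  next
    fix c v assume "c \<in> P"
    then obtain a b where c: "c = (\<lambda>p. a p + b p)" and ab: "smooth2 a" "smooth2 b" using PE by metis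
    have "frechet_derivative c (at p) = (\<lambda>v. frechet_derivative a (at p) v + frechet_derivative b (at p) v)" for p
      unfolding c by (rule frechet_derivativeI, rule has_derivative_add; rule smooth2_has_derivative, rule ab)
    then show "(\<lambda>p. frechet_derivative c (at p) v) \<in> P"
      by (simp only:) (rule PI[OF ab[THEN smooth2_deriv]])
  qed
qed

text \<open>Left translation in the group is an affine map of the plane whose linear part is a
  multiple of the identity, so this covers translated test functions. Each derivative only
  multiplies the constant by \<open>m\<close>.\<close>

lemma smooth2_affine:
  assumes "smooth2 \<phi>"
  shows "smooth2 (\<lambda>p. c * \<phi> (m *\<^sub>R p + b))"
proof -
  define P where "P = {c. \<exists>k a. c = (\<lambda>p. k * a (m *\<^sub>R p + b)) \<and> smooth2 a}"
  have PI: "(\<lambda>p. k * a (m *\<^sub>R p + b)) \<in> P" if "smooth2 a" for a k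
    using that unfolding P_def mem_Collect_eq by (intro exI[of _ k] exI[of _ a] conjI refl)
  have PE: "\<exists>k a. c = (\<lambda>p. k * a (m *\<^sub>R p + b)) \<and> smooth2 a" if "c \<in> P" for c
    using that unfolding P_def mem_Collect_eq .
  have der: "((\<lambda>p. k * a (m *\<^sub>R p + b)) has_derivative
        (\<lambda>v. (k * m) * frechet_derivative a (at (m *\<^sub>R p + b)) v)) (at p)" if a: "smooth2 a" for k a p
  proof -
    have l: "linear (frechet_derivative a (at (m *\<^sub>R p + b)))"
      by (rule linear_frechet_derivative[OF smooth2_differentiable[OF a]])
    have aff: "((\<lambda>p. m *\<^sub>R p + b) has_derivative (\<lambda>v. m *\<^sub>R v)) (at p)"
      by (auto intro!: derivative_eq_intros)
    have "((\<lambda>p. a (m *\<^sub>R p + b)) has_derivative (\<lambda>v. frechet_derivative a (at (m *\<^sub>R p + b)) (m *\<^sub>R v))) (at p)"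
      by (rule has_derivative_compose[OF aff smooth2_has_derivative[OF a]])
    then have "((\<lambda>p. k * a (m *\<^sub>R p + b)) has_derivative
        (\<lambda>v. k * frechet_derivative a (at (m *\<^sub>R p + b)) (m *\<^sub>R v))) (at p)"
      by (rule has_derivative_mult_right)
    then show ?thesis by (simp add: linear_scale[OF l] mult.assoc)
  qed
  show ?thesis
  proof (rule smooth2_coinduct[where P = P])
    show "(\<lambda>p. c * \<phi> (m *\<^sub>R p + b)) \<in> P" by (rule PI[OF assms])
  next
    fix c p assume "c \<in> P"
    then obtain k a where c: "c = (\<lambda>p. k * a (m *\<^sub>R p + b))" and a: "smooth2 a" using PE by metis
    show "c differentiable at p" unfolding c by (rule differentiableI[OF der[OF a]])
  next
    fix c v assume "c \<in> P"
    then obtain k a where c: "c = (\<lambda>p. k * a (m *\<^sub>R p + b))" and a: "smooth2 a" using PE by metis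
    show "(\<lambda>p. frechet_derivative c (at p) v) \<in> P"
      unfolding c frechet_derivativeI[OF der[OF a]] by (rule PI[OF smooth2_deriv[OF a]])
  qed
qed

lemma smooth2_scale: "smooth2 \<phi> \<Longrightarrow> smooth2 (\<lambda>p. c * \<phi> p)"
  using smooth2_affine[of \<phi> c 1 0] by simp

text \<open>Differentiating \<open>l * a\<close> gives \<open>l * a' + l v * a\<close>, so the
  functions \<open>l * a + b\<close> form a stable class. Such coefficients occur in the field
  \<open>X1\<close>.\<close>

lemma smooth2_mult_linear:
  assumes "smooth2 \<phi>" and l: "bounded_linear l"
  shows "smooth2 (\<lambda>p. l p * \<phi> p)"
proof -
  define P where "P = {c. \<exists>a b. c = (\<lambda>p. l p * a p + b p) \<and> smooth2 a \<and> smooth2 b}"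
  have PI: "(\<lambda>p. l p * a p + b p) \<in> P" if "smooth2 a" "smooth2 b" for a b
    using that unfolding P_def mem_Collect_eq by (intro exI[of _ a] exI[of _ b] conjI refl)
  have PE: "\<exists>a b. c = (\<lambda>p. l p * a p + b p) \<and> smooth2 a \<and> smooth2 b" if "c \<in> P" for c
    using that unfolding P_def mem_Collect_eq .
  have der: "((\<lambda>p. l p * a p + b p) has_derivative
      (\<lambda>v. l p * frechet_derivative a (at p) v + (l v * a p + frechet_derivative b (at p) v))) (at p)"
    if "smooth2 a" "smooth2 b" for a b p
    using has_derivative_add[OF has_derivative_mult[OF bounded_linear_imp_has_derivative[OF l]
      smooth2_has_derivative[OF that(1)]] smooth2_has_derivative[OF that(2)], of p]
    by (simp add: add.assoc)
  have "smooth2 (\<lambda>p. l p * \<phi> p + 0 * \<phi> p)"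
  proof (rule smooth2_coinduct[where P = P])
    show "(\<lambda>p. l p * \<phi> p + 0 * \<phi> p) \<in> P" by (intro PI smooth2_scale assms(1))
  next
    fix c p assume "c \<in> P"
    then obtain a b where c: "c = (\<lambda>p. l p * a p + b p)" and ab: "smooth2 a" "smooth2 b" using PE by metis
    show "c differentiable at p" unfolding c by (rule differentiableI[OF der[OF ab]])
  next
    fix c v assume "c \<in> P"
    then obtain a b where c: "c = (\<lambda>p. l p * a p + b p)" and ab: "smooth2 a" "smooth2 b" using PE by metis
    show "(\<lambda>p. frechet_derivative c (at p) v) \<in> P"
      unfolding c frechet_derivativeI[OF der[OF ab]]
      by (intro PI smooth2_add smooth2_scale smooth2_deriv ab)
  qed
  then show ?thesis by simp
qed

section \<open>Test functions and compact boxes in the half-plane\<close>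

definition K_box :: "real \<Rightarrow> (real \<times> real) set" where
  "K_box R = cbox (1 / R, - R) (R, R)"

lemma mem_K_box: "p \<in> K_box R \<longleftrightarrow> 1 / R \<le> fst p \<and> fst p \<le> R \<and> - R \<le> snd p \<and> snd p \<le> R"
  by (cases p) (auto simp: K_box_def)

lemma K_box_mono: "1 \<le> R \<Longrightarrow> R \<le> R' \<Longrightarrow> K_box R \<subseteq> K_box R'"
proof
  fix p assume R: "1 \<le> R" "R \<le> R'" "p \<in> K_box R"
  then have "1 / R' \<le> 1 / R" by (simp add: frac_le)
  then show "p \<in> K_box R'" using R by (auto simp: mem_K_box)
qed

lemma K_box_pos: "1 \<le> R \<Longrightarrow> p \<in> K_box R \<Longrightarrow> fst p > 0"
  unfolding mem_K_box by (meson less_le_trans zero_less_divide_1_iff zero_less_one)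

definition supp_in :: "(real \<times> real \<Rightarrow> real) \<Rightarrow> real \<Rightarrow> bool" where
  "supp_in \<phi> R \<longleftrightarrow> 1 \<le> R \<and> (\<forall>p. p \<notin> K_box R \<longrightarrow> \<phi> p = 0)"

lemma supp_inD: "supp_in \<phi> R \<Longrightarrow> \<phi> p \<noteq> 0 \<Longrightarrow> p \<in> K_box R"
  unfolding supp_in_def by blast

lemma supp_in_zero: "supp_in \<phi> R \<Longrightarrow> p \<notin> K_box R \<Longrightarrow> \<phi> p = 0"
  unfolding supp_in_def by blast

lemma compact_K_box: "compact (K_box R)"
  by (simp add: K_box_def)

lemma supp_in_mono: "supp_in \<phi> R \<Longrightarrow> R \<le> R' \<Longrightarrow> supp_in \<phi> R'"
  unfolding supp_in_def using K_box_mono by (meson order_trans subsetD)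

text \<open>On a compact support inside the half-plane the first coordinate attains a positive
  minimum, so a single radius bounds both coordinates and the inverse of the first.\<close>

lemma test_functions_iff: "\<phi> \<in> test_functions \<longleftrightarrow> smooth2 \<phi> \<and> (\<exists>R. supp_in \<phi> R)"
proof
  assume "\<phi> \<in> test_functions"
  then have s: "smooth2 \<phi>" and c: "compact (tsupp \<phi>)" and sub: "tsupp \<phi> \<subseteq> axb_group"
    by (auto simp: test_functions_def)
  have in_ts: "p \<in> tsupp \<phi>" if "\<phi> p \<noteq> 0" for p
    using that closure_subset unfolding tsupp_def by fastforce
  show "smooth2 \<phi> \<and> (\<exists>R. supp_in \<phi> R)"
  proof (cases "tsupp \<phi> = {}")
    case True
    then have "\<phi> p = 0" for p using in_ts by blast
    then have "supp_in \<phi> 1" by (simp add: supp_in_def)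
    then show ?thesis using s by blast
  next
    case False
    obtain q where q: "q \<in> tsupp \<phi>" "\<And>p. p \<in> tsupp \<phi> \<Longrightarrow> fst q \<le> fst p"
      using continuous_attains_inf[OF c False continuous_on_fst[OF continuous_on_id]] by auto
    obtain B where B: "\<And>p. p \<in> tsupp \<phi> \<Longrightarrow> norm p \<le> B"
      using compact_imp_bounded[OF c] bounded_iff by blast
    define R where "R = max 1 (max B (1 / fst q))"
    have q0: "fst q > 0" using q sub by (auto simp: axb_group_def)
    have "p \<in> K_box R" if "\<phi> p \<noteq> 0" for p
    proof -
      have p: "p \<in> tsupp \<phi>" using that by (rule in_ts)
      have "1 / R \<le> 1 / (1 / fst q)" using q0 by (intro divide_left_mono) (auto simp: R_def)
      then have "1 / R \<le> fst p" using q(2)[OF p] by simp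
      moreover have "\<bar>fst p\<bar> \<le> B" "\<bar>snd p\<bar> \<le> B"
        using B[OF p] norm_fst_le[of "fst p" "snd p"] norm_snd_le[of "snd p" "fst p"] by auto
      ultimately show ?thesis by (auto simp: mem_K_box R_def)
    qed
    then have "supp_in \<phi> R" by (auto simp: supp_in_def R_def)
    then show ?thesis using s by blast
  qed
next
  assume "smooth2 \<phi> \<and> (\<exists>R. supp_in \<phi> R)"
  then obtain R where s: "smooth2 \<phi>" and R: "supp_in \<phi> R" by blast
  have sub: "tsupp \<phi> \<subseteq> K_box R" unfolding tsupp_def
    using supp_inD[OF R] by (intro closure_minimal compact_imp_closed compact_K_box) blast
  then have "compact (tsupp \<phi>)"
    using compact_Int_closed[OF compact_K_box, of "tsupp \<phi>" R]
    by (simp add: tsupp_def inf.absorb2)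
  then show "\<phi> \<in> test_functions"
    using s R sub K_box_pos unfolding test_functions_def axb_group_def supp_in_def by blast
qed

lemma supp_in_deriv:
  assumes "supp_in \<phi> R"
  shows "p \<notin> K_box R \<Longrightarrow> frechet_derivative \<phi> (at p) v = 0"
proof -
  assume p: "p \<notin> K_box R"
  have "((\<lambda>p. 0) has_derivative (\<lambda>v. 0)) (at p)" by simp
  then have "(\<phi> has_derivative (\<lambda>v. 0)) (at p)"
    by (rule has_derivative_transform_within_open[where s = "- K_box R"])
       (use p supp_inD[OF assms] in \<open>auto intro!: open_Compl compact_imp_closed compact_K_box\<close>)
  then show ?thesis by (simp add: frechet_derivativeI)
qed

text \<open>Minus the Euler field: \<open>T1 T t\<close> moves the Garding vector of
  \<open>\<phi>\<close> to that of \<open>\<lambda>p. \<phi> (exp (- t) *\<^sub>R p)\<close>, and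
  this is the derivative at \<open>t = 0\<close>.\<close>

definition X1 :: "(real \<times> real \<Rightarrow> real) \<Rightarrow> real \<times> real \<Rightarrow> real" where
  "X1 \<phi> p = - frechet_derivative \<phi> (at p) p"

definition X2 :: "(real \<times> real \<Rightarrow> real) \<Rightarrow> real \<times> real \<Rightarrow> real" where
  "X2 \<phi> p = - frechet_derivative \<phi> (at p) (0, 1)"

lemma X1_test: assumes "\<phi> \<in> test_functions" shows "X1 \<phi> \<in> test_functions"
proof -
  obtain R where s: "smooth2 \<phi>" and R: "supp_in \<phi> R" using assms test_functions_iff by blast
  \<comment> \<open>In coordinates the coefficients of the field become the linear functions
    \<open>fst\<close> and \<open>snd\<close>, the form treated by
    \<open>smooth2_mult_linear\<close>.\<close>
  have "X1 \<phi> p = - 1 * (fst p * frechet_derivative \<phi> (at p) (1, 0) + snd p * frechet_derivative \<phi> (at p) (0, 1))" for p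
  proof -
    have l: "linear (frechet_derivative \<phi> (at p))"
      using linear_frechet_derivative smooth2_differentiable s by blast
    have "p = fst p *\<^sub>R (1, 0) + snd p *\<^sub>R (0, 1)" by (simp add: prod_eq_iff)
    then have "frechet_derivative \<phi> (at p) p = frechet_derivative \<phi> (at p) (fst p *\<^sub>R (1, 0) + snd p *\<^sub>R (0, 1))" by simp
    then show ?thesis unfolding X1_def linear_add[OF l] linear_scale[OF l] by simp
  qed
  then have "X1 \<phi> = (\<lambda>p. - 1 * (fst p * frechet_derivative \<phi> (at p) (1, 0) + snd p * frechet_derivative \<phi> (at p) (0, 1)))"
    by blast
  then have "smooth2 (X1 \<phi>)"
    by (simp only:) (intro smooth2_scale smooth2_add smooth2_mult_linear smooth2_deriv s
        bounded_linear_fst bounded_linear_snd)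
  moreover have "supp_in (X1 \<phi>) R" using R supp_in_deriv[OF R] by (auto simp: supp_in_def X1_def)
  ultimately show ?thesis using test_functions_iff by blast
qed

lemma X2_test: assumes "\<phi> \<in> test_functions" shows "X2 \<phi> \<in> test_functions"
proof -
  obtain R where s: "smooth2 \<phi>" and R: "supp_in \<phi> R" using assms test_functions_iff by blast
  have "X2 \<phi> = (\<lambda>p. - 1 * frechet_derivative \<phi> (at p) (0, 1))" by (simp add: X2_def fun_eq_iff)
  then have "smooth2 (X2 \<phi>)" by (simp only:) (intro smooth2_scale smooth2_deriv s)
  moreover have "supp_in (X2 \<phi>) R" using R supp_in_deriv[OF R] by (auto simp: supp_in_def X2_def)
  ultimately show ?thesis using test_functions_iff by blast
qed

section \<open>Garding vectors under translation and differentiation\<close>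

locale axb_rep =
  fixes T :: "real \<Rightarrow> real \<Rightarrow> 'a::{real_inner,complete_space} \<Rightarrow> 'a"
  assumes rep: "unitary_axb_rep T"
begin

lemma bounded_linear_T: "a > 0 \<Longrightarrow> bounded_linear (T a b)"
  and norm_T: "a > 0 \<Longrightarrow> norm (T a b f) = norm f"
  and T_one: "T 1 0 f = f"
  and T_mult: "a1 > 0 \<Longrightarrow> a2 > 0 \<Longrightarrow> T a1 b1 (T a2 b2 f) = T (a1 * a2) (a1 * b2 + b1) f"
  and T_cont: "continuous_on axb_group (\<lambda>p. T (fst p) (snd p) f)"
  using rep unfolding unitary_axb_rep_def by auto

definition integrand :: "(real \<times> real \<Rightarrow> real) \<Rightarrow> 'a \<Rightarrow> real \<times> real \<Rightarrow> 'a" where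
  "integrand \<phi> f p = (\<phi> p / (fst p)\<^sup>2) *\<^sub>R T (fst p) (snd p) f"

lemma garding_has_integral:
  assumes "continuous_on UNIV \<phi>" "supp_in \<phi> R"
  shows "(integrand \<phi> f has_integral garding_vec T \<phi> f) (K_box R)"
proof -
  have R: "1 \<le> R" using assms(2) by (simp add: supp_in_def)
  have "continuous_on (K_box R) (integrand \<phi> f)"
    unfolding integrand_def
  proof (intro continuous_intros)
    show "continuous_on (K_box R) \<phi>" using assms(1) continuous_on_subset by blast
    show "continuous_on (K_box R) (\<lambda>p. T (fst p) (snd p) f)"
      by (rule continuous_on_subset[OF T_cont]) (use K_box_pos[OF R] in \<open>auto simp: axb_group_def\<close>)
  qed (use K_box_pos[OF R] in force)
  then have i: "(integrand \<phi> f has_integral integral (K_box R) (integrand \<phi> f)) (K_box R)"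
    unfolding K_box_def by (rule has_integral_integral_continuous)
  let ?F = "\<lambda>p. (indicator axb_group p * \<phi> p / (fst p)\<^sup>2) *\<^sub>R T (fst p) (snd p) f"
  have "(?F has_integral integral (K_box R) (integrand \<phi> f)) (K_box R)"
    by (rule has_integral_eq[OF _ i]) (use K_box_pos[OF R] in \<open>simp add: integrand_def axb_group_def\<close>)
  then have "(?F has_integral integral (K_box R) (integrand \<phi> f)) UNIV"
    by (rule has_integral_superset_complete) (use supp_in_zero[OF assms(2)] in simp_all)
  then have "garding_vec T \<phi> f = integral (K_box R) (integrand \<phi> f)"
    unfolding garding_vec_def by (rule integral_unique)
  then show ?thesis using i by simp
qed

lemma garding_linear:
  assumes "continuous_on UNIV \<phi>" "supp_in \<phi> R" "continuous_on UNIV \<psi>" "supp_in \<psi> R"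
  shows "garding_vec T (\<lambda>p. c * \<phi> p + d * \<psi> p) f = c *\<^sub>R garding_vec T \<phi> f + d *\<^sub>R garding_vec T \<psi> f"
proof -
  have "(integrand (\<lambda>p. c * \<phi> p + d * \<psi> p) f has_integral garding_vec T (\<lambda>p. c * \<phi> p + d * \<psi> p) f) (K_box R)"
    using assms by (intro garding_has_integral continuous_intros) (auto simp: supp_in_def)
  moreover have "((\<lambda>p. c *\<^sub>R integrand \<phi> f p + d *\<^sub>R integrand \<psi> f p) has_integral
      c *\<^sub>R garding_vec T \<phi> f + d *\<^sub>R garding_vec T \<psi> f) (K_box R)"
    by (intro has_integral_add has_integral_cmul garding_has_integral assms)
  moreover have "integrand (\<lambda>p. c * \<phi> p + d * \<psi> p) f = (\<lambda>p. c *\<^sub>R integrand \<phi> f p + d *\<^sub>R integrand \<psi> f p)"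
    by (auto simp: integrand_def fun_eq_iff scaleR_add_left[symmetric] add_divide_distrib)
  ultimately show ?thesis by (metis has_integral_unique)
qed

text \<open>On the box the density \<open>a^(-2)\<close> is at most \<open>R^2\<close>. The bound
  sees \<open>\<phi>\<close> only through \<open>B\<close> and \<open>R\<close>, so a uniform O(t^2)
  error of functions becomes one of vectors.\<close>

lemma garding_bound:
  assumes "continuous_on UNIV \<phi>" "supp_in \<phi> R" "\<And>p. \<bar>\<phi> p\<bar> \<le> B"
  shows "norm (garding_vec T \<phi> f) \<le> B * (R\<^sup>2 * norm f * measure lborel (K_box R))"
proof -
  have R: "1 \<le> R" using assms(2) by (simp add: supp_in_def)
  have B: "0 \<le> B" using assms(3)[of 0] by linarith
  have "norm (garding_vec T \<phi> f) \<le> (B * R\<^sup>2 * norm f) * measure lborel (cbox (1 / R, - R) (R, R))"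
  proof (rule has_integral_bound)
    show "(integrand \<phi> f has_integral garding_vec T \<phi> f) (cbox (1 / R, - R) (R, R))"
      using garding_has_integral[OF assms(1,2)] by (simp add: K_box_def)
    fix p assume "p \<in> cbox (1 / R, - R) (R, R)"
    then have p: "p \<in> K_box R" by (simp add: K_box_def)
    then have p0: "fst p > 0" using K_box_pos R by blast
    have "1 / fst p \<le> R" using p p0 R by (simp add: mem_K_box field_simps)
    then have "(1 / fst p)\<^sup>2 \<le> R\<^sup>2" using p0 by (intro power_mono) auto
    then have "\<bar>\<phi> p\<bar> * (1 / fst p)\<^sup>2 \<le> B * R\<^sup>2" by (intro mult_mono assms(3) B) auto
    then have "\<bar>\<phi> p\<bar> / (fst p)\<^sup>2 * norm f \<le> B * R\<^sup>2 * norm f"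
      by (intro mult_right_mono) (auto simp: power_divide)
    then show "norm (integrand \<phi> f p) \<le> B * R\<^sup>2 * norm f"
      using p0 by (simp add: integrand_def norm_T)
  qed (use B in simp)
  then show ?thesis by (simp add: K_box_def mult_ac)
qed

text \<open>\<open>M\<close> bounds the dilation, its inverse and the shift, so one box serves a
  whole compact set of group elements; \<open>(R + 1) * (M + 1)\<close> exceeds both
  \<open>M * R + M\<close> and \<open>R * M\<close>.\<close>

lemma supp_in_translate:
  assumes "supp_in \<phi> R" "c > 0" "c \<le> M" "1 / c \<le> M" "\<bar>d\<bar> \<le> M"
  shows "supp_in (\<lambda>p. \<phi> ((1 / c) *\<^sub>R p + (0, - d / c))) ((R + 1) * (M + 1))"
  unfolding supp_in_def
proof (intro conjI allI impI)
  have R: "1 \<le> R" using assms(1) by (simp add: supp_in_def)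
  have M: "M > 0" using assms(2,3) by linarith
  show R': "1 \<le> (R + 1) * (M + 1)" using mult_mono[of 1 "R + 1" 1 "M + 1"] R M by simp
  fix p assume p: "p \<notin> K_box ((R + 1) * (M + 1))"
  show "\<phi> ((1 / c) *\<^sub>R p + (0, - d / c)) = 0"
  proof (rule ccontr)
    assume "\<phi> ((1 / c) *\<^sub>R p + (0, - d / c)) \<noteq> 0"
    then have q: "(1 / c) *\<^sub>R p + (0, - d / c) \<in> K_box R" by (rule supp_inD[OF assms(1)])
    then have a: "1 / R \<le> fst p / c" "fst p / c \<le> R" "- R \<le> (snd p - d) / c" "(snd p - d) / c \<le> R"
      by (auto simp: mem_K_box diff_divide_distrib)
    have cR: "c * R \<le> M * R" using assms R by simp
    have "M * R + M \<le> (R + 1) * (M + 1)" using R M by (simp add: algebra_simps)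
    moreover have "fst p \<le> M * R" "- (M * R) - M \<le> snd p" "snd p \<le> M * R + M"
      using a(2-4) cR assms(2,5) by (auto simp: field_simps)
    moreover have "1 / ((R + 1) * (M + 1)) \<le> fst p"
    proof -
      have R0: "0 < R" using R by linarith
      have c: "c \<le> R * fst p"
        using a(1) assms(2) R0 by (simp add: pos_divide_le_eq pos_le_divide_eq mult.commute)
      then have "0 < R * fst p" using assms(2) by linarith
      then have p0: "0 < fst p" using R0 by (rule zero_less_mult_pos)
      have "1 / fst p \<le> R / c"
        using c p0 assms(2) by (simp add: pos_divide_le_eq pos_le_divide_eq mult.commute)
      also have "\<dots> \<le> R * M" using mult_left_mono[OF assms(4), of R] R by simp
      also have "\<dots> \<le> (R + 1) * (M + 1)" using R M by (simp add: algebra_simps)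
      finally have "1 / fst p \<le> (R + 1) * (M + 1)" .
      moreover note p0
      ultimately show ?thesis using R' by (simp add: field_simps)
    qed
    ultimately have "p \<in> K_box ((R + 1) * (M + 1))" using M by (auto simp: mem_K_box)
    then show False using p by simp
  qed
qed

text \<open>Left invariance of \<open>a^(-2) da db\<close>: the argument of \<open>\<phi>\<close> is
  the product of the inverse of \<open>(c, d)\<close> with \<open>p\<close>. The substitution
  contributes \<open>c^2\<close>, the Jacobian of a dilation of the plane, and the density takes it
  back.\<close>

lemma garding_translate:
  assumes "continuous_on UNIV \<phi>" "supp_in \<phi> R" "c > 0"
  shows "T c d (garding_vec T \<phi> f) = garding_vec T (\<lambda>p. \<phi> ((1 / c) *\<^sub>R p + (0, - d / c))) f"
proof -
  have R: "1 \<le> R" using assms(2) by (simp add: supp_in_def)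
  let ?L = "\<lambda>p::real \<times> real. (1 / c) *\<^sub>R p + (0, - d / c)"
  let ?J = "(\<lambda>x. (1 / (1 / c)) *\<^sub>R x + - ((1 / (1 / c)) *\<^sub>R (0, - d / c))) ` cbox (1 / R, - R) (R, R)"
  let ?h = "\<lambda>p. T c d (integrand \<phi> f p)"
  let ?g = "\<lambda>p. (indicator axb_group p * \<phi> (?L p) / (fst p)\<^sup>2) *\<^sub>R T (fst p) (snd p) f"
  have h: "(?h has_integral T c d (garding_vec T \<phi> f)) (cbox (1 / R, - R) (R, R))"
    using has_integral_linear[OF garding_has_integral[OF assms(1,2)] bounded_linear_T[OF assms(3)]]
    by (simp add: o_def K_box_def)
  have "((\<lambda>p. ?h (?L p)) has_integral (1 / \<bar>1 / c\<bar> ^ DIM(real \<times> real)) *\<^sub>R T c d (garding_vec T \<phi> f)) ?J"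
    by (rule has_integral_affinity[OF h]) (use assms(3) in simp)
  then have "((\<lambda>p. ?h (?L p)) has_integral c\<^sup>2 *\<^sub>R T c d (garding_vec T \<phi> f)) ?J"
    using assms(3) by (simp add: power2_eq_square)
  then have "((\<lambda>p. (1 / c\<^sup>2) *\<^sub>R ?h (?L p)) has_integral (1 / c\<^sup>2) *\<^sub>R (c\<^sup>2 *\<^sub>R T c d (garding_vec T \<phi> f))) ?J"
    by (rule has_integral_cmul)
  then have i: "((\<lambda>p. (1 / c\<^sup>2) *\<^sub>R ?h (?L p)) has_integral T c d (garding_vec T \<phi> f)) ?J"
    using assms(3) by simp
  have eq: "?g p = (1 / c\<^sup>2) *\<^sub>R ?h (?L p)" for p
  proof (cases "?L p \<in> K_box R")
    case True
    then have "fst (?L p) > 0" using K_box_pos R by blast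
    then have p0: "fst p > 0" using assms(3) by (simp add: zero_less_divide_iff)
    interpret bounded_linear "T c d" by (rule bounded_linear_T[OF assms(3)])
    have "?h (?L p) = (\<phi> (?L p) / (fst p / c)\<^sup>2) *\<^sub>R T c d (T (fst p / c) ((snd p - d) / c) f)"
      by (simp add: integrand_def scaleR diff_divide_distrib)
    also have "T c d (T (fst p / c) ((snd p - d) / c) f) = T (fst p) (snd p) f"
      using assms(3) p0 by (simp add: T_mult)
    finally show ?thesis using assms(3) p0 by (simp add: power_divide axb_group_def)
  next
    case False
    then have "\<phi> (?L p) = 0" by (rule supp_in_zero[OF assms(2)])
    moreover have "T c d 0 = 0" using bounded_linear_T[OF assms(3)] bounded_linear.linear linear_0 by blast
    ultimately show ?thesis by (simp add: integrand_def)
  qed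
  have "(?g has_integral T c d (garding_vec T \<phi> f)) UNIV"
  proof (rule has_integral_superset_complete)
    show "(?g has_integral T c d (garding_vec T \<phi> f)) ?J" using i by (simp only: eq)
    fix p assume "p \<notin> ?J"
    have "p = (1 / (1 / c)) *\<^sub>R ?L p + - ((1 / (1 / c)) *\<^sub>R (0, - d / c))"
      using assms(3) by (simp add: prod_eq_iff field_simps)
    then have "?L p \<notin> K_box R" using \<open>p \<notin> ?J\<close> unfolding K_box_def by blast
    then have "\<phi> (?L p) = 0" by (rule supp_in_zero[OF assms(2)])
    then show "?g p = 0" by simp
  qed simp
  then show ?thesis unfolding garding_vec_def by (simp add: integral_unique)
qed


text \<open>\<open>L t\<close> is the action of a one-parameter subgroup on points and \<open>X\<close> its vector field; the
  difference quotient converges because its error is \<open>O(t)\<close> uniformly, with \<open>sup \<bar>X (X \<phi>)\<bar>\<close> as constant.\<close>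
lemma garding_derivative:
  fixes L :: "real \<Rightarrow> real \<times> real \<Rightarrow> real \<times> real" and X :: "(real \<times> real \<Rightarrow> real) \<Rightarrow> real \<times> real \<Rightarrow> real"
    and U :: "real \<Rightarrow> 'a \<Rightarrow> 'a"
  assumes supp: "\<And>\<phi> R. supp_in \<phi> R \<Longrightarrow> \<exists>R'\<ge>R. \<forall>t. \<bar>t\<bar> \<le> 1 \<longrightarrow> supp_in (\<lambda>p. \<phi> (L t p)) R'"
    and contL: "\<And>t. continuous_on UNIV (L t)" and L0: "\<And>p. L 0 p = p"
    and X: "\<And>\<phi>. \<phi> \<in> test_functions \<Longrightarrow> X \<phi> \<in> test_functions"
    and D: "\<And>\<phi> p t. \<phi> \<in> test_functions \<Longrightarrow> ((\<lambda>t. \<phi> (L t p)) has_real_derivative X \<phi> (L t p)) (at t)"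
    and U: "\<And>\<phi> f t. \<phi> \<in> test_functions \<Longrightarrow> U t (garding_vec T \<phi> f) = garding_vec T (\<lambda>p. \<phi> (L t p)) f"
    and \<phi>: "\<phi> \<in> test_functions"
  shows "((\<lambda>t. (1 / t) *\<^sub>R (U t (garding_vec T \<phi> f) - garding_vec T \<phi> f)) \<longlongrightarrow> garding_vec T (X \<phi>) f) (at 0)"
proof -
  have cont: "continuous_on UNIV \<psi>" if "\<psi> \<in> test_functions" for \<psi>
    using that smooth2_continuous test_functions_iff by blast
  obtain R1 where R1: "supp_in \<phi> R1" using \<phi> test_functions_iff by blast
  obtain R2 where R2: "supp_in (X \<phi>) R2" using X[OF \<phi>] test_functions_iff by blast
  obtain R3 where R3: "supp_in (X (X \<phi>)) R3" using X[OF X[OF \<phi>]] test_functions_iff by blast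
  obtain R where R: "max R1 R2 \<le> R" "\<And>t. \<bar>t\<bar> \<le> 1 \<Longrightarrow> supp_in (\<lambda>p. \<phi> (L t p)) R"
    using supp[OF supp_in_mono[OF R1, of "max R1 R2"]] by auto
  have suppR: "supp_in \<phi> R" "supp_in (X \<phi>) R"
    using R supp_in_mono[OF R1] supp_in_mono[OF R2] by auto
  have "bounded (X (X \<phi>) ` K_box R3)"
    using cont[OF X[OF X[OF \<phi>]]] compact_continuous_image compact_imp_bounded compact_K_box continuous_on_subset
    by (metis subset_UNIV)
  then obtain B0 where B0: "\<And>p. p \<in> K_box R3 \<Longrightarrow> \<bar>X (X \<phi>) p\<bar> \<le> B0"
    unfolding bounded_iff by auto
  define B where "B = max 0 B0"
  have B: "\<bar>X (X \<phi>) p\<bar> \<le> B" for p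
    using B0[of p] supp_in_zero[OF R3, of p] by (cases "p \<in> K_box R3") (auto simp: B_def)
  \<comment> \<open>First-order expansion along the orbit: the mean value inequality is used for
    \<open>X \<phi>\<close>, and then for \<open>\<phi>\<close> minus its linear part.\<close>
  have taylor: "\<bar>\<phi> (L t p) - \<phi> p - t * X \<phi> p\<bar> \<le> B * t\<^sup>2" for t p
  proof -
    have 1: "\<bar>X \<phi> (L \<tau> p) - X \<phi> (L 0 p)\<bar> \<le> B * \<bar>\<tau>\<bar>" for \<tau>
      using field_differentiable_bound[of UNIV "\<lambda>\<tau>. X \<phi> (L \<tau> p)" "\<lambda>\<tau>. X (X \<phi>) (L \<tau> p)" B \<tau> 0]
        D[OF X[OF \<phi>]] B by simp
    let ?h = "\<lambda>\<tau>. \<phi> (L \<tau> p) - \<tau> * X \<phi> p"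
    have "norm (?h t - ?h 0) \<le> (B * \<bar>t\<bar>) * norm (t - 0)"
    proof (rule field_differentiable_bound[where S = "cball 0 \<bar>t\<bar>" and f' = "\<lambda>\<tau>. X \<phi> (L \<tau> p) - X \<phi> p"])
      fix \<tau> :: real assume "\<tau> \<in> cball 0 \<bar>t\<bar>"
      then have \<tau>: "\<bar>\<tau>\<bar> \<le> \<bar>t\<bar>" by simp
      show "(?h has_field_derivative X \<phi> (L \<tau> p) - X \<phi> p) (at \<tau> within cball 0 \<bar>t\<bar>)"
        using DERIV_subset[OF D[OF \<phi>, of p \<tau>]] by (auto intro!: derivative_eq_intros)
      have "B * \<bar>\<tau>\<bar> \<le> B * \<bar>t\<bar>" by (rule mult_left_mono[OF \<tau>]) (simp add: B_def)
      then show "norm (X \<phi> (L \<tau> p) - X \<phi> p) \<le> B * \<bar>t\<bar>" using 1[of \<tau>] by (simp add: L0)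
    qed auto
    then show ?thesis by (simp add: L0 power2_eq_square algebra_simps)
  qed
  define C where "C = R\<^sup>2 * norm f * measure lborel (K_box R)"
  have est: "norm ((1 / t) *\<^sub>R (U t (garding_vec T \<phi> f) - garding_vec T \<phi> f) - garding_vec T (X \<phi>) f) \<le> \<bar>t\<bar> * (B * C)"
    if t: "\<bar>t\<bar> \<le> 1" "t \<noteq> 0" for t
  proof -
    \<comment> \<open>The factors \<open>1\<close> and \<open>- 1\<close> give the function the
      exact shape of two applications of \<open>garding_linear\<close>.\<close>
    let ?\<psi> = "\<lambda>p. 1 * (1 * \<phi> (L t p) + (- 1) * \<phi> p) + (- t) * X \<phi> p"
    have cL: "continuous_on UNIV (\<lambda>p. \<phi> (L t p))"
      using continuous_on_compose2[OF cont[OF \<phi>] contL] by auto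
    have c1: "continuous_on UNIV (\<lambda>p. 1 * \<phi> (L t p) + (- 1) * \<phi> p)"
      by (intro continuous_intros cL cont \<phi>)
    have s1: "supp_in (\<lambda>p. 1 * \<phi> (L t p) + (- 1) * \<phi> p) R"
      using R(2)[OF t(1)] suppR(1) by (simp add: supp_in_def)
    have c2: "continuous_on UNIV ?\<psi>" by (intro continuous_intros c1 cont X \<phi> cL)
    have s2: "supp_in ?\<psi> R" using s1 suppR(2) by (simp add: supp_in_def)
    have "garding_vec T ?\<psi> f = U t (garding_vec T \<phi> f) - garding_vec T \<phi> f - t *\<^sub>R garding_vec T (X \<phi>) f"
      unfolding garding_linear[OF c1 s1 cont[OF X[OF \<phi>]] suppR(2)]
        garding_linear[OF cL R(2)[OF t(1)] cont[OF \<phi>] suppR(1)] U[OF \<phi>] by simp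
    moreover have "norm (garding_vec T ?\<psi> f) \<le> (B * t\<^sup>2) * C"
      unfolding C_def by (rule garding_bound[OF c2 s2]) (use taylor in simp)
    ultimately have n: "norm (U t (garding_vec T \<phi> f) - garding_vec T \<phi> f - t *\<^sub>R garding_vec T (X \<phi>) f) \<le> (B * t\<^sup>2) * C" by simp
    have "(1 / t) *\<^sub>R (U t (garding_vec T \<phi> f) - garding_vec T \<phi> f) - garding_vec T (X \<phi>) f
        = (1 / t) *\<^sub>R (U t (garding_vec T \<phi> f) - garding_vec T \<phi> f - t *\<^sub>R garding_vec T (X \<phi>) f)"
      using t(2) by (simp add: scaleR_diff_right)
    then have "norm ((1 / t) *\<^sub>R (U t (garding_vec T \<phi> f) - garding_vec T \<phi> f) - garding_vec T (X \<phi>) f)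
        \<le> 1 / \<bar>t\<bar> * ((B * t\<^sup>2) * C)"
      using n t(2) by (simp add: divide_right_mono)
    also have "\<dots> = 1 / \<bar>t\<bar> * ((B * (\<bar>t\<bar> * \<bar>t\<bar>)) * C)"
      by (simp add: power2_eq_square)
    also have "\<dots> = \<bar>t\<bar> * (B * C)"
      using t(2) by (simp del: abs_mult_self_eq)
    finally show ?thesis .
  qed
  show ?thesis
  proof (rule LIM_zero_cancel, rule Lim_null_comparison)
    show "\<forall>\<^sub>F t in at 0. norm ((1 / t) *\<^sub>R (U t (garding_vec T \<phi> f) - garding_vec T \<phi> f) - garding_vec T (X \<phi>) f) \<le> \<bar>t\<bar> * (B * C)"
      unfolding eventually_at by (rule exI[of _ 1]) (use est in \<open>auto simp: dist_real_def\<close>)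
    show "((\<lambda>t::real. \<bar>t\<bar> * (B * C)) \<longlongrightarrow> 0) (at 0)"
      by (intro tendsto_mult_left_zero tendsto_rabs_zero tendsto_ident_at)
  qed
qed

lemma test_translate:
  assumes "\<phi> \<in> test_functions" "c > 0"
  shows "(\<lambda>p. \<phi> ((1 / c) *\<^sub>R p + (0, - d / c))) \<in> test_functions"
proof -
  obtain R where s: "smooth2 \<phi>" and R: "supp_in \<phi> R" using assms(1) test_functions_iff by blast
  have "smooth2 (\<lambda>p. \<phi> ((1 / c) *\<^sub>R p + (0, - d / c)))" using smooth2_affine[OF s, of 1] by simp
  moreover have "supp_in (\<lambda>p. \<phi> ((1 / c) *\<^sub>R p + (0, - d / c))) ((R + 1) * (max c (max (1 / c) \<bar>d\<bar>) + 1))"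
    by (rule supp_in_translate[OF R assms(2)]) auto
  ultimately show ?thesis using test_functions_iff by blast
qed

lemma T_garding_vec:
  assumes "\<phi> \<in> test_functions" "c > 0"
  shows "T c d (garding_vec T \<phi> f) = garding_vec T (\<lambda>p. \<phi> ((1 / c) *\<^sub>R p + (0, - d / c))) f"
proof -
  obtain R where s: "smooth2 \<phi>" and R: "supp_in \<phi> R" using assms(1) test_functions_iff by blast
  show ?thesis by (rule garding_translate[OF smooth2_continuous[OF s] R assms(2)])
qed

lemma deriv_along:
  assumes "smooth2 \<phi>" "(l has_vector_derivative v) (at t)"
  shows "((\<lambda>t. \<phi> (l t)) has_real_derivative frechet_derivative \<phi> (at (l t)) v) (at t)"
proof -
  have l: "linear (frechet_derivative \<phi> (at (l t)))"
    by (rule linear_frechet_derivative[OF smooth2_differentiable[OF assms(1)]])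
  have "((\<lambda>t. \<phi> (l t)) has_derivative (\<lambda>h. frechet_derivative \<phi> (at (l t)) (h *\<^sub>R v))) (at t)"
    using assms(2) unfolding has_vector_derivative_def
    by (rule has_derivative_compose[OF _ smooth2_has_derivative[OF assms(1)]])
  then show ?thesis unfolding has_field_derivative_def linear_scale[OF l] by (simp add: mult_commute_abs)
qed

lemma garding_T1:
  assumes "\<phi> \<in> test_functions"
  shows "((\<lambda>t. (1 / t) *\<^sub>R (T1 T t (garding_vec T \<phi> f) - garding_vec T \<phi> f)) \<longlongrightarrow> garding_vec T (X1 \<phi>) f) (at 0)"
\<comment> \<open>Left translation by the inverse of \<open>(exp t, 0)\<close>; the zero numerator
  keeps the shape shared by \<open>supp_in_translate\<close> and
  \<open>T_garding_vec\<close>.\<close>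
proof (rule garding_derivative[where L = "\<lambda>t p. (1 / exp t) *\<^sub>R p + (0, - 0 / exp t)"])
  fix \<phi> R assume "supp_in \<phi> R"
  then show "\<exists>R'\<ge>R. \<forall>t. \<bar>t\<bar> \<le> 1 \<longrightarrow> supp_in (\<lambda>p. \<phi> ((1 / exp t) *\<^sub>R p + (0, - 0 / exp t))) R'"
  proof (intro exI[of _ "(R + 1) * (exp 1 + 1)"] conjI allI impI)
    have "1 \<le> R" using \<open>supp_in \<phi> R\<close> by (simp add: supp_in_def)
    then show "R \<le> (R + 1) * (exp 1 + 1)" using mult_mono[of R "R + 1" 1 "exp 1 + 1"] by simp
    fix t :: real assume t: "\<bar>t\<bar> \<le> 1"
    show "supp_in (\<lambda>p. \<phi> ((1 / exp t) *\<^sub>R p + (0, - 0 / exp t))) ((R + 1) * (exp 1 + 1))"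
      using t by (intro supp_in_translate[OF \<open>supp_in \<phi> R\<close>]) (auto simp flip: exp_minus simp: divide_inverse)
  qed
next
  fix \<phi> and p :: "real \<times> real" and t assume \<phi>: "\<phi> \<in> test_functions"
  let ?l = "\<lambda>t::real. (1 / exp t) *\<^sub>R p + (0, - 0 / exp t)"
  have "(?l has_vector_derivative (- ?l t)) (at t)"
  proof -
    have "((\<lambda>t. exp (- t)) has_real_derivative - exp (- t)) (at t)" by (auto intro!: derivative_eq_intros)
    then have "((\<lambda>t. exp (- t) *\<^sub>R p) has_vector_derivative (- exp (- t)) *\<^sub>R p) (at t)"
      by (intro has_vector_derivative_scaleR[where g = "\<lambda>_. p" and g' = 0, simplified])
         (auto simp: has_real_derivative_iff_has_vector_derivative)
    then show ?thesis by (simp add: exp_minus divide_inverse zero_prod_def[symmetric])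
  qed
  from deriv_along[OF _ this, of \<phi>] \<phi>
  have "((\<lambda>t. \<phi> (?l t)) has_real_derivative frechet_derivative \<phi> (at (?l t)) (- ?l t)) (at t)"
    using test_functions_iff by blast
  moreover have "linear (frechet_derivative \<phi> (at (?l t)))"
    using linear_frechet_derivative smooth2_differentiable \<phi> test_functions_iff by blast
  ultimately show "((\<lambda>t. \<phi> (?l t)) has_real_derivative X1 \<phi> (?l t)) (at t)"
    unfolding X1_def by (simp only: linear_neg)
qed (use assms in \<open>auto simp: T1_def T_garding_vec X1_test zero_prod_def[symmetric] intro!: continuous_intros\<close>)

lemma garding_T2:
  assumes "\<phi> \<in> test_functions"
  shows "((\<lambda>t. (1 / t) *\<^sub>R (T2 T t (garding_vec T \<phi> f) - garding_vec T \<phi> f)) \<longlongrightarrow> garding_vec T (X2 \<phi>) f) (at 0)"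
proof (rule garding_derivative[where L = "\<lambda>t p. (1 / 1) *\<^sub>R p + (0, - t / 1)"])
  fix \<phi> R assume "supp_in \<phi> R"
  then show "\<exists>R'\<ge>R. \<forall>t. \<bar>t\<bar> \<le> 1 \<longrightarrow> supp_in (\<lambda>p. \<phi> ((1 / 1) *\<^sub>R p + (0, - t / 1))) R'"
  proof (intro exI[of _ "(R + 1) * (1 + 1)"] conjI allI impI)
    have "1 \<le> R" using \<open>supp_in \<phi> R\<close> by (simp add: supp_in_def)
    then show "R \<le> (R + 1) * (1 + 1)" by simp
    fix t :: real assume t: "\<bar>t\<bar> \<le> 1"
    show "supp_in (\<lambda>p. \<phi> ((1 / 1) *\<^sub>R p + (0, - t / 1))) ((R + 1) * (1 + 1))"
      using t by (intro supp_in_translate[OF \<open>supp_in \<phi> R\<close>]) auto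
  qed
next
  fix \<phi> and p :: "real \<times> real" and t assume \<phi>: "\<phi> \<in> test_functions"
  let ?l = "\<lambda>t::real. (1 / 1) *\<^sub>R p + (0, - t / 1)"
  have "(?l has_vector_derivative (- (0, 1))) (at t)"
  proof -
    have "((\<lambda>t. t *\<^sub>R (0, -1)) has_vector_derivative 1 *\<^sub>R (0, -1)) (at t)"
      by (auto intro!: derivative_eq_intros)
    then have "((\<lambda>t. p + t *\<^sub>R (0, -1)) has_vector_derivative 0 + 1 *\<^sub>R (0, -1)) (at t)"
      by (intro has_vector_derivative_add has_vector_derivative_const)
    then show ?thesis by simp
  qed
  from deriv_along[OF _ this, of \<phi>] \<phi>
  have "((\<lambda>t. \<phi> (?l t)) has_real_derivative frechet_derivative \<phi> (at (?l t)) (- (0, 1))) (at t)"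
    using test_functions_iff by blast
  moreover have "linear (frechet_derivative \<phi> (at (?l t)))"
    using linear_frechet_derivative smooth2_differentiable \<phi> test_functions_iff by blast
  ultimately show "((\<lambda>t. \<phi> (?l t)) has_real_derivative X2 \<phi> (?l t)) (at t)"
    unfolding X2_def by (simp only: linear_neg)
qed (use assms in \<open>auto simp: T2_def T_garding_vec[where c = 1, simplified] X2_test zero_prod_def[symmetric] intro!: continuous_intros\<close>)

abbreviation "G \<equiv> garding_space T"

lemma subspace_G: "subspace G"
  unfolding garding_space_def by (rule subspace_span)

lemma garding_vec_in_G: "\<phi> \<in> test_functions \<Longrightarrow> garding_vec T \<phi> f \<in> G"
  unfolding garding_space_def by (rule span_base) blast

lemma T_in_G:
  assumes "F \<in> G" "c > 0"
  shows "T c d F \<in> G"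
proof -
  interpret bounded_linear "T c d" by (rule bounded_linear_T[OF assms(2)])
  have "subspace {F. T c d F \<in> G}"
    using subspace_G by (auto simp: subspace_def zero add scaleR)
  moreover have "{garding_vec T \<phi> f |\<phi> f. \<phi> \<in> test_functions} \<subseteq> {F. T c d F \<in> G}"
    using garding_vec_in_G[OF test_translate[OF _ assms(2)]] T_garding_vec[OF _ assms(2)] by auto
  ultimately have "G \<subseteq> {F. T c d F \<in> G}"
    by (subst garding_space_def) (rule span_minimal)
  then show ?thesis using assms(1) by blast
qed

text \<open>\<open>generator\<close> is a \<open>Lim\<close> and carries information only where the
  limit exists. The vectors for which it exists and lies in \<open>G\<close> form a subspace, so the
  spanning vectors decide.\<close>

lemma generator_on_G:
  assumes U: "\<And>t. bounded_linear (U t)"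
    and X: "\<And>\<phi>. \<phi> \<in> test_functions \<Longrightarrow> X \<phi> \<in> test_functions"
    and D: "\<And>\<phi> f. \<phi> \<in> test_functions \<Longrightarrow>
      ((\<lambda>t. (1 / t) *\<^sub>R (U t (garding_vec T \<phi> f) - garding_vec T \<phi> f)) \<longlongrightarrow> garding_vec T (X \<phi>) f) (at 0)"
    and F: "F \<in> G"
  shows "generator U F \<in> G \<and> ((\<lambda>t. (1 / t) *\<^sub>R (U t F - F)) \<longlongrightarrow> generator U F) (at 0)"
proof -
  let ?D = "{F. \<exists>y\<in>G. ((\<lambda>t. (1 / t) *\<^sub>R (U t F - F)) \<longlongrightarrow> y) (at 0)}"
  have "subspace ?D"
    unfolding subspace_def mem_Collect_eq
  proof (intro conjI ballI allI)
    show "\<exists>y\<in>G. ((\<lambda>t. (1 / t) *\<^sub>R (U t 0 - 0)) \<longlongrightarrow> y) (at 0)"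
      using subspace_0[OF subspace_G] by (intro bexI[of _ 0]) (simp_all add: linear_0[OF bounded_linear.linear[OF U]])
  next
    fix x y assume "x \<in> ?D" "y \<in> ?D"
    then obtain a b where a: "a \<in> G" "((\<lambda>t. (1 / t) *\<^sub>R (U t x - x)) \<longlongrightarrow> a) (at 0)"
      and b: "b \<in> G" "((\<lambda>t. (1 / t) *\<^sub>R (U t y - y)) \<longlongrightarrow> b) (at 0)" by blast
    have "(1 / t) *\<^sub>R (U t (x + y) - (x + y)) = (1 / t) *\<^sub>R (U t x - x) + (1 / t) *\<^sub>R (U t y - y)" for t
      by (simp add: linear_add[OF bounded_linear.linear[OF U]] scaleR_add_right[symmetric])
    then show "\<exists>z\<in>G. ((\<lambda>t. (1 / t) *\<^sub>R (U t (x + y) - (x + y))) \<longlongrightarrow> z) (at 0)"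
      using tendsto_add[OF a(2) b(2)] subspace_add[OF subspace_G a(1) b(1)] by auto
  next
    fix c x assume "x \<in> ?D"
    then obtain a where a: "a \<in> G" "((\<lambda>t. (1 / t) *\<^sub>R (U t x - x)) \<longlongrightarrow> a) (at 0)" by blast
    have "(1 / t) *\<^sub>R (U t (c *\<^sub>R x) - c *\<^sub>R x) = c *\<^sub>R ((1 / t) *\<^sub>R (U t x - x))" for t
      by (simp add: linear_scale[OF bounded_linear.linear[OF U]] scaleR_diff_right mult.commute)
    then show "\<exists>z\<in>G. ((\<lambda>t. (1 / t) *\<^sub>R (U t (c *\<^sub>R x) - c *\<^sub>R x)) \<longlongrightarrow> z) (at 0)"
      using tendsto_scaleR[OF tendsto_const a(2), of c] subspace_scale[OF subspace_G a(1), of c] by auto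
  qed
  moreover have "{garding_vec T \<phi> f | \<phi> f. \<phi> \<in> test_functions} \<subseteq> ?D"
    using D X garding_vec_in_G by blast
  ultimately have "G \<subseteq> ?D"
    by (subst garding_space_def) (rule span_minimal)
  then obtain y where y: "y \<in> G" "((\<lambda>t. (1 / t) *\<^sub>R (U t F - F)) \<longlongrightarrow> y) (at 0)" using F by blast
  then have "generator U F = y" unfolding generator_def by (intro tendsto_Lim) auto
  then show ?thesis using y by simp
qed

end

section \<open>Averages over a one-parameter group\<close>

text \<open>\<open>T1\<close> and \<open>T2\<close> are both instances with the Garding space as
  \<open>G\<close>, so the calculus of averages and differences is developed once. Averages and
  differences act on the whole space, the generator on \<open>G\<close>.\<close>

locale unitary_group =
  fixes U :: "real \<Rightarrow> 'a::{real_inner,complete_space} \<Rightarrow> 'a" and G :: "'a set"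
  assumes lin: "bounded_linear (U t)" and norm_U [simp]: "norm (U t x) = norm x"
    and U_zero [simp]: "U 0 x = x" and U_add: "U s (U t x) = U (s + t) x"
    and cont: "continuous_on UNIV (\<lambda>t. U t x)"
    and subspace_G: "subspace G" and U_in_G: "F \<in> G \<Longrightarrow> U t F \<in> G"
    and gen_in_G: "F \<in> G \<Longrightarrow> generator U F \<in> G"
    and gen_lim: "F \<in> G \<Longrightarrow> ((\<lambda>t. (1 / t) *\<^sub>R (U t F - F)) \<longlongrightarrow> generator U F) (at 0)"
begin

abbreviation "A \<equiv> generator U"

lemma U_plus: "U t (x + y) = U t x + U t y"
  and U_minus: "U t (x - y) = U t x - U t y"
  and U_scale: "U t (c *\<^sub>R x) = c *\<^sub>R U t x"
  using lin[of t] by (simp_all add: linear_add linear_diff linear_scale bounded_linear.linear)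

lemma inner_U: "inner (U t x) (U t y) = inner x y"
proof -
  have p: "inner u v = ((norm (u + v))\<^sup>2 - (norm (u - v))\<^sup>2) / 4" for u v :: 'a
    by (simp add: power2_norm_eq_inner inner_simps inner_commute)
  show ?thesis unfolding p by (simp flip: U_plus U_minus)
qed

lemma inner_U_adjoint: "inner (U t x) y = inner x (U (- t) y)"
  using inner_U[of t x "U (- t) y"] by (simp add: U_add)

lemma gen_unique: "((\<lambda>t. (1 / t) *\<^sub>R (U t F - F)) \<longlongrightarrow> y) (at 0) \<Longrightarrow> A F = y"
  unfolding generator_def by (rule tendsto_Lim) auto

text \<open>The adjoint of \<open>U t\<close> is \<open>U (- t)\<close>, so a difference quotient
  passes to the other side with \<open>t\<close> replaced by \<open>- t\<close>.\<close>

lemma gen_skew: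
  assumes "F \<in> G" "Z \<in> G"
  shows "inner (A F) Z = - inner F (A Z)"
proof -
  have l: "((\<lambda>t. (1 / t) *\<^sub>R (U t Z - Z)) \<longlongrightarrow> A Z) (at 0)" by (rule gen_lim[OF assms(2)])
  have "filterlim (\<lambda>t::real. - t) (at 0) (at 0)"
    by (rule filterlim_atI) (auto intro!: tendsto_eq_intros simp: eventually_at_filter)
  then have "((\<lambda>t. (1 / (- t)) *\<^sub>R (U (- t) Z - Z)) \<longlongrightarrow> A Z) (at 0)"
    by (rule filterlim_compose[OF l])
  then have "((\<lambda>t. - inner F ((1 / (- t)) *\<^sub>R (U (- t) Z - Z))) \<longlongrightarrow> - inner F (A Z)) (at 0)"
    by (intro tendsto_intros)
  moreover have "(\<lambda>t. - inner F ((1 / (- t)) *\<^sub>R (U (- t) Z - Z))) = (\<lambda>t. inner ((1 / t) *\<^sub>R (U t F - F)) Z)"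
    by (simp add: fun_eq_iff inner_diff_left inner_diff_right) (simp add: inner_U_adjoint)
  ultimately have "((\<lambda>t. inner ((1 / t) *\<^sub>R (U t F - F)) Z) \<longlongrightarrow> - inner F (A Z)) (at 0)" by (simp only:)
  moreover have "((\<lambda>t. inner ((1 / t) *\<^sub>R (U t F - F)) Z) \<longlongrightarrow> inner (A F) Z) (at 0)"
    by (intro tendsto_intros gen_lim assms)
  ultimately show ?thesis by (intro tendsto_unique[OF _ ]) auto
qed

lemma gen_add: "F \<in> G \<Longrightarrow> Z \<in> G \<Longrightarrow> A (F + Z) = A F + A Z"
  using tendsto_add[OF gen_lim[of F] gen_lim[of Z]]
  by (intro gen_unique) (simp add: U_plus scaleR_add_right scaleR_diff_right algebra_simps)

lemma gen_scale: "F \<in> G \<Longrightarrow> A (c *\<^sub>R F) = c *\<^sub>R A F"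
  using tendsto_scaleR[OF tendsto_const gen_lim[of F], of c]
  by (intro gen_unique) (simp add: U_scale scaleR_diff_right mult.commute)

lemma gen_U: "F \<in> G \<Longrightarrow> A (U t F) = U t (A F)"
  using bounded_linear.tendsto[OF lin gen_lim, of F t]
  by (intro gen_unique) (simp add: U_scale U_minus U_add add.commute)

lemma U_derivative:
  assumes F: "F \<in> G"
  shows "((\<lambda>t. U t F) has_vector_derivative U t (A F)) (at t)"
proof -
  have "((\<lambda>h. (1 / h) *\<^sub>R (U h (U t F) - U t F)) \<longlongrightarrow> U t (A F)) (at 0)"
    using gen_lim[OF U_in_G[OF F]] gen_U[OF F] by simp
  then have l: "((\<lambda>h. norm ((1 / h) *\<^sub>R (U h (U t F) - U t F) - U t (A F))) \<longlongrightarrow> 0) (at 0)"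
    by (intro tendsto_norm_zero LIM_zero)
  have "\<forall>\<^sub>F h in at 0. norm ((1 / h) *\<^sub>R (U h (U t F) - U t F) - U t (A F))
      = norm (U (t + h) F - U t F - h *\<^sub>R U t (A F)) / norm h"
  proof (rule eventually_at_filter[THEN iffD2], rule always_eventually, intro allI impI)
    fix h :: real assume h: "h \<noteq> 0"
    have "(1 / h) *\<^sub>R (U h (U t F) - U t F) - U t (A F) = (1 / h) *\<^sub>R (U (t + h) F - U t F - h *\<^sub>R U t (A F))"
      using h by (simp add: scaleR_diff_right U_add add.commute)
    then show "norm ((1 / h) *\<^sub>R (U h (U t F) - U t F) - U t (A F))
      = norm (U (t + h) F - U t F - h *\<^sub>R U t (A F)) / norm h" by simp
  qed
  from Lim_transform_eventually[OF l this] show ?thesis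
    unfolding has_vector_derivative_def has_derivative_at by (simp add: bounded_linear_scaleR_left)
qed

section \<open>Exponentially weighted averages\<close>

lemma G_sum: "(\<And>i. i \<in> I \<Longrightarrow> F i \<in> G) \<Longrightarrow> (\<Sum>i\<in>I. F i) \<in> G"
  by (rule subspace_sum[OF subspace_G])

text \<open>Formally, \<open>A2 ^^ q\<close> applied to the plain average of \<open>T1\<close>
  multiplies the translate by \<open>t\<close> with \<open>exp (- (q * t))\<close>; this is the
  source of the weight, and \<open>q = 0\<close> is the plain average over \<open>[0, s]\<close>,
  rescaled to \<open>[0, 1]\<close>.\<close>

definition avg :: "real \<Rightarrow> real \<Rightarrow> 'a \<Rightarrow> 'a" where
  "avg q s g = integral {0..1} (\<lambda>u. exp (- (q * s * u)) *\<^sub>R U (s * u) g)"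

lemma avg_integrand_cont: "continuous_on S (\<lambda>u. exp (- (q * s * u)) *\<^sub>R U (s * u) g)"
proof -
  have "continuous_on S (\<lambda>u. U (s * u) g)"
    by (rule continuous_on_compose2[OF cont]) (auto intro!: continuous_intros)
  then show ?thesis by (intro continuous_intros)
qed

lemma avg_has_integral: "((\<lambda>u. exp (- (q * s * u)) *\<^sub>R U (s * u) g) has_integral avg q s g) {0..1}"
  using has_integral_integral_continuous[of 0 1, OF avg_integrand_cont] by (simp add: avg_def)

lemma avg_add: "avg q s (x + y) = avg q s x + avg q s y"
proof -
  have "((\<lambda>u. exp (- (q * s * u)) *\<^sub>R U (s * u) (x + y)) has_integral avg q s x + avg q s y) {0..1}"
    using has_integral_add[OF avg_has_integral[of q s x] avg_has_integral[of q s y]]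
    by (simp add: U_plus scaleR_add_right)
  then show ?thesis by (rule has_integral_unique[OF avg_has_integral])
qed

lemma avg_linear_map:
  assumes "bounded_linear L" "\<And>t x. L (U t x) = U t (L x)"
  shows "L (avg q s x) = avg q s (L x)"
proof -
  have "((\<lambda>u. exp (- (q * s * u)) *\<^sub>R U (s * u) (L x)) has_integral L (avg q s x)) {0..1}"
    using has_integral_linear[OF avg_has_integral[of q s x] assms(1)]
    by (simp add: o_def linear_scale[OF bounded_linear.linear[OF assms(1)]] assms(2))
  then show ?thesis by (rule has_integral_unique[symmetric, OF _ avg_has_integral, symmetric])
qed

lemma avg_U: "avg q s (U t x) = U t (avg q s x)"
  by (rule avg_linear_map[symmetric, OF lin]) (simp add: U_add add.commute)

lemma avg_bound:
  assumes "bounded_linear L" "0 \<le> q" "0 \<le> s" "\<And>u. 0 \<le> u \<Longrightarrow> u \<le> 1 \<Longrightarrow> norm (L (U (s * u) x)) \<le> c"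
  shows "norm (L (avg q s x)) \<le> c"
proof -
  have c: "0 \<le> c" using assms(4)[of 0] norm_ge_zero order_trans by (metis zero_le_one order_refl)
  have "norm (L (avg q s x)) \<le> c * measure lborel {0..1::real}"
  proof (rule has_integral_bound_real[OF c finite.emptyI])
    show "((\<lambda>u. exp (- (q * s * u)) *\<^sub>R L (U (s * u) x)) has_integral L (avg q s x)) {0..1}"
      using has_integral_linear[OF avg_has_integral[of q s x] assms(1)]
      by (simp add: o_def linear_scale[OF bounded_linear.linear[OF assms(1)]])
    fix u :: real assume u: "u \<in> {0..1} - {}"
    have "exp (- (q * s * u)) \<le> 1" using u assms(2,3) by simp
    then have "exp (- (q * s * u)) * norm (L (U (s * u) x)) \<le> 1 * c"
      by (intro mult_mono assms(4)) (use u in auto)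
    then show "norm (exp (- (q * s * u)) *\<^sub>R L (U (s * u) x)) \<le> c" by simp
  qed
  then show ?thesis by simp
qed

lemma norm_avg: "0 \<le> q \<Longrightarrow> 0 \<le> s \<Longrightarrow> norm (avg q s x) \<le> norm x"
  by (rule avg_bound[OF bounded_linear_ident]) auto

lemma avg_scale: "avg q s (c *\<^sub>R x) = c *\<^sub>R avg q s x"
  by (rule avg_linear_map[symmetric, OF bounded_linear_scaleR_right]) (simp add: U_scale)

lemma bounded_linear_avg: "0 \<le> q \<Longrightarrow> 0 \<le> s \<Longrightarrow> bounded_linear (avg q s)"
  by (rule bounded_linear_intro[where K = 1]) (simp_all add: avg_add avg_scale norm_avg)

lemma avg_diff: "avg q s (x - y) = avg q s x - avg q s y"
  using avg_add[of q s "x - y" y] by simp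

text \<open>Fundamental theorem of calculus for the weighted orbit of \<open>F\<close>:
  differentiating the group gives the left side, differentiating the weight the correction with
  factor \<open>q\<close>. One average thus absorbs one generator and leaves a bounded
  operator.\<close>

lemma avg_gen:
  assumes "F \<in> G" "s > 0"
  shows "avg q s (A F) = (1 / s) *\<^sub>R (exp (- (q * s)) *\<^sub>R U s F - F) + q *\<^sub>R avg q s F"
proof -
  let ?h = "\<lambda>u. exp (- (q * s * u)) *\<^sub>R U (s * u) F"
  let ?h' = "\<lambda>u. s *\<^sub>R (exp (- (q * s * u)) *\<^sub>R U (s * u) (A F)) - (q * s) *\<^sub>R (exp (- (q * s * u)) *\<^sub>R U (s * u) F)"
  have "(?h has_vector_derivative ?h' u) (at u within {0..1})" for u
  proof -
    have "((\<lambda>u. U (s * u) F) has_vector_derivative s *\<^sub>R U (s * u) (A F)) (at u within {0..1})"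
    proof -
      have "((\<lambda>u. s * u) has_vector_derivative s) (at u within {0..1})"
        by (auto intro!: derivative_eq_intros simp flip: has_real_derivative_iff_has_vector_derivative)
      from vector_diff_chain_within[OF this has_vector_derivative_at_within[OF U_derivative[OF assms(1)]]]
      show ?thesis by (simp add: o_def)
    qed
    moreover have "((\<lambda>u. exp (- (q * s * u))) has_real_derivative - (q * s) * exp (- (q * s * u))) (at u within {0..1})"
      by (auto intro!: derivative_eq_intros)
    ultimately show ?thesis
      using has_vector_derivative_scaleR by (fastforce simp: mult.commute)
  qed
  then have "(?h' has_integral (?h 1 - ?h 0)) {0..1}"
    by (intro ftc_complete) auto
  moreover have "(?h' has_integral (s *\<^sub>R avg q s (A F) - (q * s) *\<^sub>R avg q s F)) {0..1}"
    by (intro has_integral_diff has_integral_cmul avg_has_integral)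
  ultimately have "?h 1 - ?h 0 = s *\<^sub>R avg q s (A F) - (q * s) *\<^sub>R avg q s F" by (rule has_integral_unique)
  then have "(1 / s) *\<^sub>R (?h 1 - ?h 0) = (1 / s) *\<^sub>R (s *\<^sub>R avg q s (A F) - (q * s) *\<^sub>R avg q s F)" by simp
  then show ?thesis using assms(2) by (simp add: scaleR_diff_right algebra_simps)
qed

text \<open>Values of linear operators on \<open>G\<close> that intertwine with \<open>U\<close> up to an exponential weight can be
  averaged: a Riemann sum of translates stays in \<open>G\<close>.\<close>
lemma avg_jet:
  assumes I: "finite I" and qs: "\<And>i. i \<in> I \<Longrightarrow> 0 \<le> q i" "0 \<le> s"
    and L_add: "\<And>i F Z. i \<in> I \<Longrightarrow> F \<in> G \<Longrightarrow> Z \<in> G \<Longrightarrow> L i (F + Z) = L i F + L i Z"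
    and L_scale: "\<And>i F c. i \<in> I \<Longrightarrow> F \<in> G \<Longrightarrow> L i (c *\<^sub>R F) = c *\<^sub>R L i F"
    and L_U: "\<And>i F t. i \<in> I \<Longrightarrow> F \<in> G \<Longrightarrow> L i (U t F) = exp (- (q i * t)) *\<^sub>R U t (L i F)"
    and X: "\<And>m. X m \<in> G" "\<And>i. i \<in> I \<Longrightarrow> (\<lambda>m. L i (X m)) \<longlonglongrightarrow> x i"
  shows "\<exists>Y. (\<forall>m::nat. Y m \<in> G) \<and> (\<forall>i\<in>I. (\<lambda>m. L i (Y m)) \<longlonglongrightarrow> avg (q i) s (x i))"
proof -
  define R where "R F N = (1 / real N) *\<^sub>R (\<Sum>j<N. U (s * (real j / real N)) F)" for F N
  have R_G: "R F N \<in> G" if "F \<in> G" for F N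
    unfolding R_def by (intro subspace_scale[OF subspace_G] G_sum U_in_G that)
  have L_sum: "L i (\<Sum>j<k. F j) = (\<Sum>j<k. L i (F j))" if "i \<in> I" "\<And>j. F j \<in> G" for i F and k :: nat
  proof (induction k)
    case 0
    have "L i (0 *\<^sub>R 0) = 0 *\<^sub>R L i 0" by (rule L_scale[OF that(1) subspace_0[OF subspace_G]])
    then show ?case by simp
  next
    case (Suc k)
    then show ?case using L_add[OF that(1) G_sum that(2), of "{..<k}" F k] that by simp
  qed
  have L_R: "L i (R F N) = (1 / real N) *\<^sub>R (\<Sum>j<N. exp (- (q i * s * (real j / real N))) *\<^sub>R U (s * (real j / real N)) (L i F))"
    if "i \<in> I" "F \<in> G" for i F N
    unfolding R_def using that
    by (subst L_scale) (auto simp: L_sum L_U U_in_G mult.assoc intro!: G_sum)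
  have "\<exists>N. \<forall>i\<in>I. norm (L i (R F N) - avg (q i) s (L i F)) < e" if F: "F \<in> G" and e: "e > 0" for F e
  proof -
    have "\<forall>\<^sub>F N in sequentially. norm (L i (R F N) - avg (q i) s (L i F)) < e" if "i \<in> I" for i
    proof -
      have "(\<lambda>N. L i (R F N)) \<longlonglongrightarrow> avg (q i) s (L i F)"
        unfolding L_R[OF that F] avg_def by (rule riemann_sum_tendsto[OF avg_integrand_cont])
      then show ?thesis using e by (simp add: tendsto_iff dist_norm)
    qed
    \<comment> \<open>A single Riemann sum has to serve all indices at once; finiteness of
      \<open>I\<close> provides a common \<open>N\<close>.\<close>
    then have "\<forall>\<^sub>F N in sequentially. \<forall>i\<in>I. norm (L i (R F N) - avg (q i) s (L i F)) < e"
      using I by (simp add: eventually_ball_finite_distrib)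
    then show ?thesis by (auto simp: eventually_sequentially)
  qed
  \<comment> \<open>Diagonal choice: the \<open>m\<close>-th vector is averaged with accuracy
    \<open>1 / (m + 1)\<close>.\<close>
  then have "\<forall>m. \<exists>N. \<forall>i\<in>I. norm (L i (R (X m) N) - avg (q i) s (L i (X m))) < 1 / real (Suc m)"
    using X(1) by simp
  then obtain N where N: "\<And>m i. i \<in> I \<Longrightarrow> norm (L i (R (X m) (N m)) - avg (q i) s (L i (X m))) < 1 / real (Suc m)"
    by metis
  have "(\<lambda>m. L i (R (X m) (N m))) \<longlonglongrightarrow> avg (q i) s (x i)" if i: "i \<in> I" for i
  proof -
    have "(\<lambda>m. L i (R (X m) (N m)) - avg (q i) s (L i (X m))) \<longlonglongrightarrow> 0"
    proof (rule Lim_null_comparison)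
      show "\<forall>\<^sub>F m in sequentially. norm (L i (R (X m) (N m)) - avg (q i) s (L i (X m))) \<le> 1 / real (Suc m)"
        using N[OF i] by (intro always_eventually allI less_imp_le)
      show "(\<lambda>m. 1 / real (Suc m)) \<longlonglongrightarrow> 0" by (rule LIMSEQ_Suc[OF lim_1_over_n])
    qed
    moreover have "(\<lambda>m. avg (q i) s (L i (X m))) \<longlonglongrightarrow> avg (q i) s (x i)"
      by (rule bounded_linear.tendsto[OF bounded_linear_avg[OF qs(1)[OF i] qs(2)] X(2)[OF i]])
    ultimately have "(\<lambda>m. (L i (R (X m) (N m)) - avg (q i) s (L i (X m))) + avg (q i) s (L i (X m))) \<longlonglongrightarrow> 0 + avg (q i) s (x i)"
      by (rule tendsto_add)
    then show ?thesis by simp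
  qed
  then show ?thesis using R_G X(1) by (intro exI[of _ "\<lambda>m. R (X m) (N m)"]) auto
qed

text \<open>The sequence \<open>Y\<close> stands for the iterated average of \<open>F\<close>: its
  members lie in \<open>G\<close>, where the operators \<open>L i\<close> are controlled, and each
  \<open>L i (Y m)\<close> converges to the value that \<open>L i\<close> should take at the
  average. Averaging once more asks only for such a sequence, hence the induction.\<close>

lemma avg_jet_power:
  assumes I: "finite I" and qs: "\<And>i. i \<in> I \<Longrightarrow> 0 \<le> q i" "0 \<le> s"
    and L_add: "\<And>i F Z. i \<in> I \<Longrightarrow> F \<in> G \<Longrightarrow> Z \<in> G \<Longrightarrow> L i (F + Z) = L i F + L i Z"
    and L_scale: "\<And>i F c. i \<in> I \<Longrightarrow> F \<in> G \<Longrightarrow> L i (c *\<^sub>R F) = c *\<^sub>R L i F"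
    and L_U: "\<And>i F t. i \<in> I \<Longrightarrow> F \<in> G \<Longrightarrow> L i (U t F) = exp (- (q i * t)) *\<^sub>R U t (L i F)"
    and F: "F \<in> G"
  shows "\<exists>Y. (\<forall>m::nat. Y m \<in> G) \<and> (\<forall>i\<in>I. (\<lambda>m. L i (Y m)) \<longlonglongrightarrow> (avg (q i) s ^^ a) (L i F))"
proof (induction a)
  case 0
  then show ?case using F by (intro exI[of _ "\<lambda>_. F"]) simp
next
  case (Suc a)
  then obtain X where "\<And>m::nat. X m \<in> G" "\<And>i. i \<in> I \<Longrightarrow> (\<lambda>m. L i (X m)) \<longlonglongrightarrow> (avg (q i) s ^^ a) (L i F)" by blast
  from avg_jet[OF I qs L_add L_scale L_U this] show ?case by simp
qed

text \<open>The bounded operator into which \<open>avg_gen\<close> turns one average combined with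
  one generator.\<close>

definition V :: "real \<Rightarrow> real \<Rightarrow> 'a \<Rightarrow> 'a" where
  "V q s z = (1 / s) *\<^sub>R (exp (- (q * s)) *\<^sub>R U s z - z) + q *\<^sub>R avg q s z"

lemma avg_V: "avg q s (V q s z) = V q s (avg q s z)"
  by (simp add: V_def avg_add avg_diff avg_scale avg_U)

lemma avg_pow_V: "(avg q s ^^ a) (V q s z) = V q s ((avg q s ^^ a) z)"
  by (induction a) (simp_all add: avg_V)

lemma gen_pow_in_G: "F \<in> G \<Longrightarrow> (A ^^ p) F \<in> G"
  by (induction p) (simp_all add: gen_in_G)

text \<open>Every generator uses up one average, so \<open>a - p\<close> of them remain.\<close>

lemma avg_pow_gen_pow:
  assumes "F \<in> G" "s > 0" "p \<le> a"
  shows "(avg q s ^^ a) ((A ^^ p) F) = (avg q s ^^ (a - p)) ((V q s ^^ p) F)"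
  using assms(3)
proof (induction p arbitrary: a)
  case (Suc p)
  then obtain b where a: "a = Suc b" "p \<le> b" by (cases a) auto
  have "(avg q s ^^ a) ((A ^^ Suc p) F) = (avg q s ^^ b) (avg q s (A ((A ^^ p) F)))"
    by (simp add: a funpow_swap1)
  also have "avg q s (A ((A ^^ p) F)) = V q s ((A ^^ p) F)"
    unfolding V_def by (rule avg_gen[OF gen_pow_in_G[OF assms(1)] assms(2)])
  also have "(avg q s ^^ b) (V q s ((A ^^ p) F)) = V q s ((avg q s ^^ (b - p)) ((V q s ^^ p) F))"
    by (simp add: avg_pow_V Suc.IH[OF a(2)])
  also have "\<dots> = (avg q s ^^ (a - Suc p)) ((V q s ^^ Suc p) F)"
    by (simp add: avg_pow_V[symmetric] a)
  finally show ?case .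
qed simp

section \<open>Finite differences along the group\<close>

definition D :: "real \<Rightarrow> 'a \<Rightarrow> 'a" where
  "D t x = U t x - x"

lemma bounded_linear_D: "bounded_linear (D t)"
  unfolding D_def by (intro bounded_linear_sub lin bounded_linear_ident)

lemma D_U: "D t (U r x) = U r (D t x)"
  by (simp add: D_def U_minus U_add add.commute)

lemma norm_D: "norm (D t x) \<le> 2 * norm x"
  unfolding D_def using norm_triangle_ineq4[of "U t x" x] by simp

lemma bounded_linear_funpow: "bounded_linear (f :: 'a \<Rightarrow> 'a) \<Longrightarrow> bounded_linear (f ^^ n)"
  by (induction n) (simp_all add: id_def bounded_linear_ident bounded_linear_compose o_def)

lemma D_pow_U: "(D t ^^ j) (U r x) = U r ((D t ^^ j) x)"
  by (induction j) (simp_all add: D_U)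

lemma D_pow_avg: "(D t ^^ j) (avg q s x) = avg q s ((D t ^^ j) x)"
  by (rule avg_linear_map[OF bounded_linear_funpow[OF bounded_linear_D] D_pow_U])

lemma norm_avg_pow: "0 \<le> q \<Longrightarrow> 0 \<le> s \<Longrightarrow> norm ((avg q s ^^ a) x) \<le> norm x"
  by (induction a) (auto intro: order_trans[OF norm_avg])

text \<open>\<open>V q s\<close> is a difference divided by \<open>s\<close> up to two terms of size
  \<open>q\<close>. Hence one application of it raises the order of the difference by one, with
  factor at most 1, or keeps it, with factor \<open>2 * q\<close>; this is the base
  \<open>1 + 2 * q\<close>.\<close>

lemma norm_V_pow:
  assumes "0 \<le> q" "0 < s"
  shows "norm ((V q s ^^ p) z) \<le> (1 + 2 * q) ^ p * (\<Sum>j\<le>p. norm ((D s ^^ j) z) / s ^ j)"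
proof (induction p arbitrary: z)
  case (Suc p)
  \<comment> \<open>A multiple of \<open>D s z\<close> is split off so that the coefficient left at
    \<open>z\<close> is at most \<open>q\<close> in absolute value, free of
    \<open>1 / s\<close>.\<close>
  have V: "V q s z = (exp (- (q * s)) / s) *\<^sub>R D s z + (((exp (- (q * s)) - 1) / s) *\<^sub>R z + q *\<^sub>R avg q s z)"
    by (simp add: V_def D_def algebra_simps diff_divide_distrib)
  have e: "exp (- (q * s)) \<le> 1" "\<bar>(exp (- (q * s)) - 1) / s\<bar> \<le> q"
  proof -
    show "exp (- (q * s)) \<le> 1" using assms by simp
    moreover have "1 - exp (- (q * s)) \<le> q * s" using exp_ge_add_one_self[of "- (q * s)"] by simp
    ultimately show "\<bar>(exp (- (q * s)) - 1) / s\<bar> \<le> q" using assms(2) by (simp add: field_simps)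
  qed
  have j: "norm ((D s ^^ j) (V q s z)) / s ^ j \<le> norm ((D s ^^ Suc j) z) / s ^ Suc j + 2 * q * (norm ((D s ^^ j) z) / s ^ j)" for j
  proof -
    interpret bounded_linear "D s ^^ j" by (rule bounded_linear_funpow[OF bounded_linear_D])
    let ?y = "(D s ^^ j) z"
    have eq: "(D s ^^ j) (V q s z) = (exp (- (q * s)) / s) *\<^sub>R D s ?y + (((exp (- (q * s)) - 1) / s) *\<^sub>R ?y + q *\<^sub>R avg q s ?y)"
      unfolding V by (simp add: add scaleR D_pow_avg funpow_swap1)
    have "norm ((D s ^^ j) (V q s z)) \<le> norm (D s ?y) / s + (q * norm ?y + q * norm ?y)"
      unfolding eq
    proof (intro norm_triangle_mono)
      show "norm ((exp (- (q * s)) / s) *\<^sub>R D s ?y) \<le> norm (D s ?y) / s"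
        using mult_right_mono[OF e(1), of "norm (D s ?y)"] assms(2) by (simp add: divide_right_mono)
      show "norm (((exp (- (q * s)) - 1) / s) *\<^sub>R ?y) \<le> q * norm ?y"
        using mult_right_mono[OF e(2), of "norm ?y"] by simp
      show "norm (q *\<^sub>R avg q s ?y) \<le> q * norm ?y"
        using assms norm_avg[of q s ?y] by (simp add: mult_left_mono)
    qed
    then have "norm ((D s ^^ j) (V q s z)) / s ^ j \<le> (norm (D s ?y) / s + (q * norm ?y + q * norm ?y)) / s ^ j"
      by (rule divide_right_mono) (use assms(2) in simp)
    also have "\<dots> = norm (D s ?y) / s ^ Suc j + 2 * q * (norm ?y / s ^ j)"
      by (simp add: add_divide_distrib mult.assoc)
    finally show ?thesis by simp
  qed
  have "(\<Sum>j\<le>p. norm ((D s ^^ j) (V q s z)) / s ^ j)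
      \<le> (\<Sum>j\<le>p. norm ((D s ^^ Suc j) z) / s ^ Suc j) + 2 * q * (\<Sum>j\<le>p. norm ((D s ^^ j) z) / s ^ j)"
    unfolding sum_distrib_left sum.distrib[symmetric] by (rule sum_mono) (rule j)
  also have "\<dots> \<le> (\<Sum>j\<le>Suc p. norm ((D s ^^ j) z) / s ^ j) + 2 * q * (\<Sum>j\<le>Suc p. norm ((D s ^^ j) z) / s ^ j)"
  proof (intro add_mono mult_left_mono)
    show "(\<Sum>j\<le>p. norm ((D s ^^ Suc j) z) / s ^ Suc j) \<le> (\<Sum>j\<le>Suc p. norm ((D s ^^ j) z) / s ^ j)"
      unfolding sum.atMost_Suc_shift[where n = p] by simp
    show "(\<Sum>j\<le>p. norm ((D s ^^ j) z) / s ^ j) \<le> (\<Sum>j\<le>Suc p. norm ((D s ^^ j) z) / s ^ j)"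
      using assms(2) by simp
  qed (use assms in auto)
  finally have S: "(\<Sum>j\<le>p. norm ((D s ^^ j) (V q s z)) / s ^ j) \<le> (1 + 2 * q) * (\<Sum>j\<le>Suc p. norm ((D s ^^ j) z) / s ^ j)"
    by (simp add: distrib_right)
  have "norm ((V q s ^^ Suc p) z) = norm ((V q s ^^ p) (V q s z))" by (simp add: funpow_swap1)
  also have "\<dots> \<le> (1 + 2 * q) ^ p * (\<Sum>j\<le>p. norm ((D s ^^ j) (V q s z)) / s ^ j)" by (rule Suc.IH)
  also have "\<dots> \<le> (1 + 2 * q) ^ p * ((1 + 2 * q) * (\<Sum>j\<le>Suc p. norm ((D s ^^ j) z) / s ^ j))"
    using assms(1) by (intro mult_left_mono S) auto
  finally show ?case by (simp add: mult_ac)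
qed simp

lemma V_zero_pow: "(V 0 s ^^ p) z = (1 / s ^ p) *\<^sub>R (D s ^^ p) z"
proof (induction p)
  case (Suc p)
  interpret bounded_linear "D s" by (rule bounded_linear_D)
  have "V 0 s y = (1 / s) *\<^sub>R D s y" for y by (simp add: V_def D_def)
  then show ?case using Suc by (simp add: scaleR)
qed simp

fun diffs :: "real list \<Rightarrow> 'a \<Rightarrow> 'a" where
  "diffs [] x = x"
| "diffs (t # ts) x = D t (diffs ts x)"

lemma bounded_linear_diffs: "bounded_linear (diffs ts)"
  by (induction ts) (auto simp: bounded_linear_ident intro: bounded_linear_compose[OF bounded_linear_D])

lemma diffs_U: "diffs ts (U t x) = U t (diffs ts x)"
  by (induction ts) (simp_all add: D_U)

lemma diffs_sub_avg: "diffs ts (x - avg q s x) = diffs ts x - avg q s (diffs ts x)"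
  using avg_linear_map[OF bounded_linear_diffs diffs_U, of ts q s x]
  by (simp add: linear_diff[OF bounded_linear.linear[OF bounded_linear_diffs]])

text \<open>\<open>y - avg 0 s y\<close> is the average of \<open>- D (s * u) y\<close> over
  \<open>u\<close> in \<open>[0, 1]\<close>.\<close>

lemma norm_sub_avg:
  assumes "0 \<le> s" "\<And>t. 0 \<le> t \<Longrightarrow> t \<le> s \<Longrightarrow> norm (D t y) \<le> c"
  shows "norm (y - avg 0 s y) \<le> c"
proof -
  have c: "0 \<le> c" using assms(2)[of 0] assms(1) norm_ge_zero order_trans by blast
  have "((\<lambda>u. y - U (s * u) y) has_integral (y - avg 0 s y)) {0..1}"
    using has_integral_diff[OF has_integral_const_real[of y 0 1] avg_has_integral[of 0 s y]] by simp
  then have "norm (y - avg 0 s y) \<le> c * measure lborel {0..1::real}"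
  proof (rule has_integral_bound_real[OF c finite.emptyI])
    fix u :: real assume "u \<in> {0..1} - {}"
    then have "norm (D (s * u) y) \<le> c" using assms(1) by (intro assms(2)) (auto simp: mult_left_le)
    then show "norm (y - U (s * u) y) \<le> c" by (simp add: D_def norm_minus_commute)
  qed
  then show ?thesis by simp
qed

text \<open>Each factor averages over its own step, so the iterate is controlled by differences with
  independent steps, as they occur in the mixed modulus.\<close>

lemma norm_sub_avg_pow:
  assumes "0 \<le> s"
  shows "(\<And>ts. length ts = r \<Longrightarrow> set ts \<subseteq> {0..s} \<Longrightarrow> norm (diffs ts x) \<le> c)
    \<Longrightarrow> norm (((\<lambda>y. y - avg 0 s y) ^^ r) x) \<le> c"
proof (induction r arbitrary: x)
  case 0
  then show ?case using "0.prems"[of "[]"] by simp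
next
  case (Suc r)
  have "norm (diffs ts (x - avg 0 s x)) \<le> c" if "length ts = r" "set ts \<subseteq> {0..s}" for ts
    unfolding diffs_sub_avg
  proof (rule norm_sub_avg[OF assms])
    fix t assume "0 \<le> t" "t \<le> s"
    then show "norm (D t (diffs ts x)) \<le> c" using Suc.prems[of "t # ts"] that by simp
  qed
  then show ?case unfolding funpow_Suc_right o_apply by (rule Suc.IH)
qed

text \<open>The \<open>b\<close>-fold average runs over translates by sums of \<open>b\<close>
  parameters from \<open>[0, s]\<close>, so \<open>v\<close> goes up to \<open>b * s\<close>.
  \<open>L\<close> stays outside: it will be a difference of the other group, which does not commute
  with \<open>U\<close>.\<close>

lemma avg_pow_bound:
  assumes "bounded_linear L" "0 \<le> s"
  shows "(\<And>v. 0 \<le> v \<Longrightarrow> v \<le> real b * s \<Longrightarrow> norm (L (U v g)) \<le> c) \<Longrightarrow> norm (L ((avg 0 s ^^ b) g)) \<le> c"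
proof (induction b arbitrary: g)
  case 0
  then show ?case using "0.prems"[of 0] by simp
next
  case (Suc b)
  have pU: "(avg 0 s ^^ b) (U t x) = U t ((avg 0 s ^^ b) x)" for t x
    by (induction b) (simp_all add: avg_U)
  have "norm (L (avg 0 s ((avg 0 s ^^ b) g))) \<le> c"
  proof (rule avg_bound[OF assms(1) _ assms(2)])
    fix u :: real assume u: "0 \<le> u" "u \<le> 1"
    have "norm (L ((avg 0 s ^^ b) (U (s * u) g))) \<le> c"
    proof (rule Suc.IH)
      fix v assume v: "0 \<le> v" "v \<le> real b * s"
      have "0 \<le> s * u" "s * u \<le> s" using u assms(2) by (auto simp: mult_left_le)
      then show "norm (L (U v (U (s * u) g))) \<le> c"
        unfolding U_add using v by (intro Suc.prems) (auto simp: distrib_right)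
    qed
    then show "norm (L (U (s * u) ((avg 0 s ^^ b) g))) \<le> c" by (simp add: pU)
  qed simp
  then show ?case by simp
qed

lemma norm_D_multiple: "norm (D (real i * t) x) \<le> real i * norm (D t x)"
proof (induction i)
  case 0
  then show ?case by (simp add: D_def)
next
  case (Suc i)
  have "D (real (Suc i) * t) x = U (real i * t) (D t x) + D (real i * t) x"
    by (simp add: D_def U_minus U_add distrib_right add.commute)
  then have "norm (D (real (Suc i) * t) x) \<le> norm (D t x) + real i * norm (D t x)"
    using norm_triangle_mono[OF _ Suc, of "U (real i * t) (D t x)" "norm (D t x)"] by simp
  then show ?case by (simp add: distrib_right)
qed

text \<open>\<open>D (k * t) x\<close> equals \<open>k\<close> times \<open>D t x\<close> up to the
  terms \<open>D (i * t) (D t x)\<close> with \<open>i < k\<close>, whose norms add up to at most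
  \<open>k^2\<close> times that of the second difference. As \<open>D (k * t) x\<close> has norm at
  most \<open>2 * norm x\<close>, division by \<open>k\<close> gives the claim.\<close>

lemma norm_D_second:
  assumes "k > 0"
  shows "norm (D t x) \<le> 2 / real k * norm x + real k * norm (D t (D t x))"
proof -
  have "norm (D (real k * t) x - real k *\<^sub>R D t x) \<le> (real k)\<^sup>2 * norm (D t (D t x))"
  proof (induction k)
    case 0
    then show ?case by (simp add: D_def)
  next
    case (Suc k)
    have "D (real (Suc k) * t) x - real (Suc k) *\<^sub>R D t x
        = (D (real k * t) x - real k *\<^sub>R D t x) + D (real k * t) (D t x)"
      by (simp add: D_def U_minus U_add distrib_right add.commute scaleR_add_left algebra_simps)
    then have "norm (D (real (Suc k) * t) x - real (Suc k) *\<^sub>R D t x)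
        \<le> (real k)\<^sup>2 * norm (D t (D t x)) + real k * norm (D t (D t x))"
      using norm_triangle_mono[OF Suc norm_D_multiple] by simp
    also have "\<dots> \<le> (real (Suc k))\<^sup>2 * norm (D t (D t x))"
      unfolding distrib_right[symmetric] by (intro mult_right_mono) (auto simp: power2_eq_square algebra_simps)
    finally show ?case .
  qed
  moreover have "norm (D (real k * t) x) \<le> 2 * norm x" by (rule norm_D)
  moreover have "norm (real k *\<^sub>R D t x) \<le> norm (D (real k * t) x) + norm (D (real k * t) x - real k *\<^sub>R D t x)"
    using norm_triangle_sub[of "real k *\<^sub>R D t x" "D (real k * t) x"] by (simp add: norm_minus_commute)
  ultimately have "real k * norm (D t x) \<le> 2 * norm x + (real k)\<^sup>2 * norm (D t (D t x))" by simp
  then have "norm (D t x) \<le> (2 * norm x + (real k)\<^sup>2 * norm (D t (D t x))) / real k"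
    using assms by (simp add: pos_le_divide_eq mult.commute)
  then show ?thesis using assms by (simp add: add_divide_distrib power2_eq_square)
qed

end

text \<open>Every term in the expansion of (M + (I - M))^(2 r) contains M or I - M at least r times.
  M is a contraction, so terms rich in I - M are measured in the norm; terms rich in M are measured
  by the smaller \<open>p\<close>, for which the bound \<open>\<Lambda>\<close> is given.\<close>

lemma split_powers:
  fixes M :: "'a::real_normed_vector \<Rightarrow> 'a" and p :: "'a \<Rightarrow> real"
  assumes M: "linear M" "\<And>x. norm (M x) \<le> norm x"
    and p: "\<And>x y. p (x + y) \<le> p x + p y" "\<And>x y. p (x - y) \<le> p x + p y" "\<And>x. p x \<le> norm x"
    and \<Lambda>: "0 \<le> \<Lambda>" "\<And>a. r \<le> a \<Longrightarrow> a \<le> 2 * r \<Longrightarrow> p ((M ^^ a) f) \<le> \<Lambda>"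
  shows "p f \<le> 4 ^ r * (norm (((\<lambda>y. y - M y) ^^ r) f) + 2 ^ r * \<Lambda>)"
proof -
  let ?D = "\<lambda>y. y - M y"
  let ?\<delta> = "norm ((?D ^^ r) f)"
  have \<Lambda>0: "0 \<le> 2 ^ r * \<Lambda>" using \<Lambda>(1) by simp
  have lM: "linear (M ^^ i)" for i
  proof (induction i)
    case (Suc i)
    show ?case unfolding funpow.simps by (rule linear_compose[OF Suc M(1)])
  qed (simp add: id_def linear_ident)
  have step: "(M ^^ i) ((?D ^^ Suc j) f) = (M ^^ i) ((?D ^^ j) f) - (M ^^ Suc i) ((?D ^^ j) f)" for i j
    by (simp add: linear_diff[OF lM] funpow_swap1)
  have nM: "norm ((M ^^ i) x) \<le> norm x" for i x
    by (induction i) (auto intro: order_trans[OF M(2)])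
  \<comment> \<open>Expanding the factors I - M doubles the number of terms each time and keeps the
    powers of M between r and 2 r.\<close>
  have 1: "p ((M ^^ (r + i)) ((?D ^^ j) f)) \<le> 2 ^ j * \<Lambda>" if "i + j \<le> r" for i j
    using that
  proof (induction j arbitrary: i)
    case 0
    then show ?case using \<Lambda>(2)[of "r + i"] by simp
  next
    case (Suc j)
    have "p ((M ^^ (r + i)) ((?D ^^ j) f)) \<le> 2 ^ j * \<Lambda>" using Suc.prems by (intro Suc.IH) simp
    moreover have "p ((M ^^ (r + Suc i)) ((?D ^^ j) f)) \<le> 2 ^ j * \<Lambda>" using Suc.prems by (intro Suc.IH) simp
    ultimately show ?case
      using p(2)[of "(M ^^ (r + i)) ((?D ^^ j) f)" "(M ^^ Suc (r + i)) ((?D ^^ j) f)"]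
      unfolding step by simp
  qed
  \<comment> \<open>\<open>n\<close> and \<open>m\<close> count the factors M and I - M that are
    still missing from r; writing I = M + (I - M) lowers one of them, until one is zero. The start
    \<open>n = m = r\<close> is \<open>f\<close> itself and costs
    \<open>2 ^ (2 * r)\<close>.\<close>
  have 2: "p ((M ^^ (r - n)) ((?D ^^ (r - m)) f)) \<le> 2 ^ (n + m) * (?\<delta> + 2 ^ r * \<Lambda>)" if "n \<le> r" "m \<le> r" for n m
    using that
  proof (induction "n + m" arbitrary: n m)
    case 0
    then show ?case using p(3)[of "(M ^^ r) ((?D ^^ r) f)"] nM[of r "(?D ^^ r) f"] \<Lambda>0 by simp
  next
    case (Suc k)
    have ge: "1 * (?\<delta> + 2 ^ r * \<Lambda>) \<le> 2 ^ (n + m) * (?\<delta> + 2 ^ r * \<Lambda>)"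
      using \<Lambda>(1) by (intro mult_right_mono) auto
    show ?case
    proof (cases "m = 0 \<or> n = 0")
      case True
      then have "p ((M ^^ (r - n)) ((?D ^^ (r - m)) f)) \<le> ?\<delta> + 2 ^ r * \<Lambda>"
      proof (rule disjE)
        assume "m = 0"
        then show ?thesis using p(3)[of "(M ^^ (r - n)) ((?D ^^ r) f)"] nM[of "r - n" "(?D ^^ r) f"] \<Lambda>0 by simp
      next
        assume "n = 0"
        have "(2::real) ^ (r - m) * \<Lambda> \<le> 2 ^ r * \<Lambda>" using \<Lambda>(1) by (intro mult_right_mono power_increasing) auto
        moreover have "p ((M ^^ (r - n)) ((?D ^^ (r - m)) f)) \<le> 2 ^ (r - m) * \<Lambda>"
          using 1[of 0 "r - m"] \<open>n = 0\<close> by simp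
        ultimately show ?thesis using norm_ge_zero[of "(?D ^^ r) f"] by linarith
      qed
      also note ge[unfolded mult_1]
      finally show ?thesis .
    next
      case False
      then obtain n' m' where nm: "n = Suc n'" "m = Suc m'" by (metis not0_implies_Suc)
      have i: "r - n' = Suc (r - n)" "r - m' = Suc (r - m)" using Suc.prems nm by auto
      have "p ((M ^^ (r - n')) ((?D ^^ (r - m)) f)) \<le> 2 ^ (n' + m) * (?\<delta> + 2 ^ r * \<Lambda>)"
        using Suc.prems Suc.hyps(2) nm by (intro Suc.hyps(1)) auto
      moreover have "p ((M ^^ (r - n)) ((?D ^^ (r - m')) f)) \<le> 2 ^ (n + m') * (?\<delta> + 2 ^ r * \<Lambda>)"
        using Suc.prems Suc.hyps(2) nm by (intro Suc.hyps(1)) auto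
      moreover have "(M ^^ (r - n)) ((?D ^^ (r - m)) f)
          = (M ^^ (r - n')) ((?D ^^ (r - m)) f) + (M ^^ (r - n)) ((?D ^^ (r - m')) f)"
        unfolding i step by simp
      ultimately show ?thesis
        using p(1)[of "(M ^^ (r - n')) ((?D ^^ (r - m)) f)" "(M ^^ (r - n)) ((?D ^^ (r - m')) f)"]
        by (simp add: nm)
    qed
  qed
  have "(4::real) ^ r = 2 ^ (r + r)" by (simp add: power_add flip: power_mult_distrib)
  then show ?thesis using 2[of r r] by simp
qed

section \<open>The Laplacian on averaged vectors\<close>

context axb_rep
begin

lemma unitary_group_T1: "unitary_group (T1 T) G"
proof (rule unitary_group.intro)
  show "bounded_linear (T1 T t)" for t by (simp add: T1_def bounded_linear_T)
  show "norm (T1 T t x) = norm x" for t x by (simp add: T1_def norm_T)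
  show "T1 T 0 x = x" for x by (simp add: T1_def T_one)
  show "T1 T s (T1 T t x) = T1 T (s + t) x" for s t x by (simp add: T1_def T_mult exp_add)
  show "continuous_on UNIV (\<lambda>t. T1 T t x)" for x
  proof -
    have "continuous_on UNIV (\<lambda>t::real. (exp t, 0::real))" by (intro continuous_intros)
    from continuous_on_compose2[OF T_cont[of x] this] show ?thesis
      by (simp add: T1_def axb_group_def image_subset_iff)
  qed
  show "subspace G" by (rule subspace_G)
  show "F \<in> G \<Longrightarrow> T1 T t F \<in> G" for t F by (simp add: T1_def T_in_G)
  have lin: "bounded_linear (T1 T t)" for t by (simp add: T1_def bounded_linear_T)
  show "F \<in> G \<Longrightarrow> generator (T1 T) F \<in> G"
    "F \<in> G \<Longrightarrow> ((\<lambda>t. (1 / t) *\<^sub>R (T1 T t F - F)) \<longlongrightarrow> generator (T1 T) F) (at 0)" for F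
    using generator_on_G[where U = "T1 T" and X = X1, OF lin X1_test garding_T1] by blast+
qed

lemma unitary_group_T2: "unitary_group (T2 T) G"
proof (rule unitary_group.intro)
  show "bounded_linear (T2 T t)" for t by (simp add: T2_def bounded_linear_T)
  show "norm (T2 T t x) = norm x" for t x by (simp add: T2_def norm_T)
  show "T2 T 0 x = x" for x by (simp add: T2_def T_one)
  show "T2 T s (T2 T t x) = T2 T (s + t) x" for s t x by (simp add: T2_def T_mult add.commute)
  show "continuous_on UNIV (\<lambda>t. T2 T t x)" for x
  proof -
    have "continuous_on UNIV (\<lambda>t::real. (1::real, t))" by (intro continuous_intros)
    from continuous_on_compose2[OF T_cont[of x] this] show ?thesis
      by (simp add: T2_def axb_group_def image_subset_iff)
  qed
  show "subspace G" by (rule subspace_G)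
  show "F \<in> G \<Longrightarrow> T2 T t F \<in> G" for t F by (simp add: T2_def T_in_G)
  have lin: "bounded_linear (T2 T t)" for t by (simp add: T2_def bounded_linear_T)
  show "F \<in> G \<Longrightarrow> generator (T2 T) F \<in> G"
    "F \<in> G \<Longrightarrow> ((\<lambda>t. (1 / t) *\<^sub>R (T2 T t F - F)) \<longlongrightarrow> generator (T2 T) F) (at 0)" for F
    using generator_on_G[where U = "T2 T" and X = X2, OF lin X2_test garding_T2] by blast+
qed

end

sublocale axb_rep \<subseteq> g1: unitary_group "T1 T" "garding_space T"
  by (rule unitary_group_T1)

sublocale axb_rep \<subseteq> g2: unitary_group "T2 T" "garding_space T"
  by (rule unitary_group_T2)

context axb_rep
begin

section \<open>Commutation relations of the two groups and their generators\<close>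

abbreviation "A1 \<equiv> generator (T1 T)"
abbreviation "A2 \<equiv> generator (T2 T)"

text \<open>In the group, \<open>(1, v) (exp s, 0) = (exp s, 0) (1, exp (- s) * v)\<close>.\<close>

lemma T2_T1: "T2 T v (T1 T s x) = T1 T s (T2 T (exp (- s) * v) x)"
  by (simp add: T1_def T2_def T_mult flip: mult.assoc exp_add)

lemma T1_T2: "T1 T s (T2 T v x) = T2 T (exp s * v) (T1 T s x)"
  by (simp add: T2_T1 flip: mult.assoc exp_add)

text \<open>This is \<open>T2_T1\<close> differentiated in \<open>v\<close>; rescaling the increment
  to \<open>exp (- t) * h\<close> produces the factor.\<close>

lemma A2_T1:
  assumes "F \<in> G"
  shows "A2 (T1 T t F) = exp (- t) *\<^sub>R T1 T t (A2 F)"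
proof (rule g2.gen_unique)
  have "filterlim (\<lambda>h::real. exp (- t) * h) (at 0) (at 0)"
    by (rule filterlim_atI) (auto intro!: tendsto_eq_intros simp: eventually_at_filter)
  then have "((\<lambda>h. (1 / (exp (- t) * h)) *\<^sub>R (T2 T (exp (- t) * h) F - F)) \<longlongrightarrow> A2 F) (at 0)"
    by (rule filterlim_compose[OF g2.gen_lim[OF assms]])
  then have "((\<lambda>h. exp (- t) *\<^sub>R T1 T t ((1 / (exp (- t) * h)) *\<^sub>R (T2 T (exp (- t) * h) F - F)))
      \<longlongrightarrow> exp (- t) *\<^sub>R T1 T t (A2 F)) (at 0)"
    by (intro tendsto_intros bounded_linear.tendsto[OF g1.lin])
  moreover have "exp (- t) *\<^sub>R T1 T t ((1 / (exp (- t) * h)) *\<^sub>R (T2 T (exp (- t) * h) F - F))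
      = (1 / h) *\<^sub>R (T2 T h (T1 T t F) - T1 T t F)" for h
    by (simp add: g1.U_scale g1.U_minus T2_T1)
  ultimately show "((\<lambda>h. (1 / h) *\<^sub>R (T2 T h (T1 T t F) - T1 T t F)) \<longlongrightarrow> exp (- t) *\<^sub>R T1 T t (A2 F)) (at 0)"
    by simp
qed

text \<open>The bracket relation [A1, A2] = A2. \<open>A2\<close> is unbounded in general, so it
  cannot be applied to the limit of quotients that defines \<open>A1 F\<close>; skewness moves it to
  a test vector \<open>Z\<close> in \<open>G\<close>, and the limit is taken in the other
  factor.\<close>

lemma A2_A1:
  assumes F: "F \<in> G"
  shows "A2 (A1 F) = A1 (A2 F) - A2 F"
proof -
  let ?X = "A2 (A1 F)" and ?Y = "A1 (A2 F) - A2 F"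
  have inG: "A1 F \<in> G" "A2 F \<in> G" "A1 (A2 F) \<in> G" "A2 (A1 F) \<in> G"
    using F by (simp_all add: g1.gen_in_G g2.gen_in_G)
  have "inner ?X Z = inner ?Y Z" if Z: "Z \<in> G" for Z
  proof -
    let ?q = "\<lambda>t. (1 / t) *\<^sub>R (T1 T t F - F)"
    have qG: "?q t \<in> G" for t
      by (intro subspace_scale subspace_diff subspace_G g1.U_in_G F)
    have "((\<lambda>t. - inner (?q t) (A2 Z)) \<longlongrightarrow> - inner (A1 F) (A2 Z)) (at 0)"
      by (intro tendsto_intros g1.gen_lim F)
    moreover have "- inner (?q t) (A2 Z) = inner (((exp (- t) - 1) / t) *\<^sub>R T1 T t (A2 F) + (1 / t) *\<^sub>R (T1 T t (A2 F) - A2 F)) Z" for t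
    proof -
      have "A2 (T1 T t F - F) = A2 (T1 T t F) + A2 ((- 1) *\<^sub>R F)"
        using g2.gen_add[OF g1.U_in_G[OF F] subspace_scale[OF subspace_G F], of t "- 1"] by simp
      then have d: "A2 (T1 T t F - F) = exp (- t) *\<^sub>R T1 T t (A2 F) - A2 F"
        by (simp only: g2.gen_scale[OF F] A2_T1[OF F]) simp
      have "- inner (?q t) (A2 Z) = inner (A2 (?q t)) Z" using g2.gen_skew[OF qG Z] by simp
      also have "A2 (?q t) = (1 / t) *\<^sub>R (exp (- t) *\<^sub>R T1 T t (A2 F) - A2 F)"
        using g2.gen_scale[OF subspace_diff[OF subspace_G g1.U_in_G[OF F] F]] d by simp
      also have "\<dots> = ((exp (- t) - 1) / t) *\<^sub>R T1 T t (A2 F) + (1 / t) *\<^sub>R (T1 T t (A2 F) - A2 F)"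
        by (simp add: scaleR_diff_right scaleR_diff_left diff_divide_distrib)
      finally show ?thesis .
    qed
    ultimately have 1: "((\<lambda>t. inner (((exp (- t) - 1) / t) *\<^sub>R T1 T t (A2 F) + (1 / t) *\<^sub>R (T1 T t (A2 F) - A2 F)) Z)
        \<longlongrightarrow> - inner (A1 F) (A2 Z)) (at 0)" by (simp only:)
    have "((\<lambda>t::real. exp (- t)) has_real_derivative - 1) (at 0)"
      by (auto intro!: derivative_eq_intros)
    then have e: "((\<lambda>t::real. (exp (- t) - 1) / t) \<longlongrightarrow> - 1) (at 0)" by (simp add: DERIV_def)
    have c: "((\<lambda>t. T1 T t (A2 F)) \<longlongrightarrow> T1 T 0 (A2 F)) (at 0)"
      using g1.cont[of "A2 F"] unfolding continuous_on_def by blast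
    have "((\<lambda>t. inner (((exp (- t) - 1) / t) *\<^sub>R T1 T t (A2 F) + (1 / t) *\<^sub>R (T1 T t (A2 F) - A2 F)) Z)
        \<longlongrightarrow> inner ((- 1) *\<^sub>R T1 T 0 (A2 F) + A1 (A2 F)) Z) (at 0)"
      by (rule tendsto_inner[OF tendsto_add[OF tendsto_scaleR[OF e c] g1.gen_lim[OF inG(2)]] tendsto_const])
    with 1 have "- inner (A1 F) (A2 Z) = inner ((- 1) *\<^sub>R T1 T 0 (A2 F) + A1 (A2 F)) Z"
      using tendsto_unique[OF _ 1] by simp
    then show ?thesis using g2.gen_skew[OF inG(1) Z] by simp
  qed
  then have "inner (?X - ?Y) Z = 0" if "Z \<in> G" for Z
    using that by (simp add: inner_diff_left)
  \<comment> \<open>The difference of the two sides lies in \<open>G\<close> and serves as its own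
    test vector.\<close>
  moreover have "?X - ?Y \<in> G" by (intro subspace_diff subspace_G inG)
  ultimately have "inner (?X - ?Y) (?X - ?Y) = 0" by blast
  then show ?thesis by (simp only: inner_eq_zero_iff) simp
qed

definition lap :: "'a \<Rightarrow> 'a" where
  "lap F = - A1 (A1 F) - A2 (A2 F)"

lemma lap_in_G: "F \<in> G \<Longrightarrow> lap F \<in> G"
  unfolding lap_def by (intro subspace_diff subspace_neg subspace_G g1.gen_in_G g2.gen_in_G)

lemma graph_eq: "laplacian_graph T = closure {(F, lap F) | F. F \<in> G}"
  by (simp add: laplacian_graph_def lap_def)

lemma lap_graph: "F \<in> G \<Longrightarrow> (F, lap F) \<in> laplacian_graph T"
  unfolding graph_eq by (rule subsetD[OF closure_subset]) blast

text \<open>Skewness makes the form a sum of two squares on \<open>G\<close>; the inequality is a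
  closed condition and survives the closure of the graph.\<close>

lemma graph_nonneg: "(x, y) \<in> laplacian_graph T \<Longrightarrow> 0 \<le> inner x y"
proof -
  have "0 \<le> inner F (lap F)" if F: "F \<in> G" for F
  proof -
    have "inner F (lap F) = - inner F (A1 (A1 F)) - inner F (A2 (A2 F))"
      unfolding lap_def inner_diff_right inner_minus_right ..
    also have "\<dots> = inner (A1 F) (A1 F) + inner (A2 F) (A2 F)"
      unfolding g1.gen_skew[OF F g1.gen_in_G[OF F]] g2.gen_skew[OF F g2.gen_in_G[OF F]] by simp
    also have "\<dots> \<ge> 0" by (intro add_nonneg_nonneg inner_ge_zero)
    finally show ?thesis .
  qed
  then have "{(F, lap F) | F. F \<in> G} \<subseteq> {p. 0 \<le> inner (fst p) (snd p)}" by auto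
  moreover have "closed {p :: 'a \<times> 'a. 0 \<le> inner (fst p) (snd p)}"
    by (intro closed_Collect_le continuous_intros)
  ultimately have "laplacian_graph T \<subseteq> {p. 0 \<le> inner (fst p) (snd p)}"
    unfolding graph_eq by (rule closure_minimal)
  moreover assume "(x, y) \<in> laplacian_graph T"
  ultimately show ?thesis by auto
qed

lemma graph_domain: "(x, y) \<in> laplacian_graph T \<Longrightarrow> x \<in> closure G"
proof -
  have "{(F, lap F) | F. F \<in> G} \<subseteq> closure G \<times> UNIV" using closure_subset by auto
  then have "laplacian_graph T \<subseteq> closure G \<times> UNIV"
    unfolding graph_eq by (rule closure_minimal) (intro closed_Times closed_closure closed_UNIV)
  moreover assume "(x, y) \<in> laplacian_graph T"
  ultimately show ?thesis by auto
qed

section \<open>Ordered words in the two generators\<close>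

inductive diff_op :: "nat \<Rightarrow> ('a \<Rightarrow> 'a) \<Rightarrow> bool" where
  base: "p + q \<le> m \<Longrightarrow> diff_op m (\<lambda>F. (A1 ^^ p) ((A2 ^^ q) F))"
| add: "diff_op m L \<Longrightarrow> diff_op m L' \<Longrightarrow> diff_op m (\<lambda>F. L F + L' F)"
| scale: "diff_op m L \<Longrightarrow> diff_op m (\<lambda>F. c *\<^sub>R L F)"

lemma diff_op_in_G: "diff_op m L \<Longrightarrow> F \<in> G \<Longrightarrow> L F \<in> G"
  by (induction rule: diff_op.induct)
     (auto intro: g1.gen_pow_in_G g2.gen_pow_in_G subspace_add[OF subspace_G] subspace_scale[OF subspace_G])

lemma diff_op_mono: "diff_op m L \<Longrightarrow> m \<le> m' \<Longrightarrow> diff_op m' L"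
  by (induction rule: diff_op.induct) (auto intro: diff_op.intros)

text \<open>Linearity of the generators and the bracket relation are available on \<open>G\<close>.
  The composed operator is therefore matched with a \<open>diff_op\<close> on \<open>G\<close>
  instead of being equated with one.\<close>

lemma diff_op_A1: "diff_op m L \<Longrightarrow> \<exists>L'. diff_op (Suc m) L' \<and> (\<forall>F\<in>G. A1 (L F) = L' F)"
proof (induction rule: diff_op.induct)
  case (base p q m)
  then have "diff_op (Suc m) (\<lambda>F. (A1 ^^ Suc p) ((A2 ^^ q) F))" by (intro diff_op.base) simp
  then show ?case by (intro exI conjI) auto
next
  case (add m L K)
  then obtain L' K' where "diff_op (Suc m) L'" "\<forall>F\<in>G. A1 (L F) = L' F"
    "diff_op (Suc m) K'" "\<forall>F\<in>G. A1 (K F) = K' F" by blast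
  then show ?case using diff_op_in_G[OF add(1)] diff_op_in_G[OF add(2)]
    by (intro exI[of _ "\<lambda>F. L' F + K' F"]) (auto simp: g1.gen_add intro: diff_op.add)
next
  case (scale m L c)
  then obtain L' where "diff_op (Suc m) L'" "\<forall>F\<in>G. A1 (L F) = L' F" by blast
  then show ?case using diff_op_in_G[OF scale(1)]
    by (intro exI[of _ "\<lambda>F. c *\<^sub>R L' F"]) (auto simp: g1.gen_scale intro: diff_op.scale)
qed

text \<open>Moving \<open>A2\<close> past one \<open>A1\<close> gives, by \<open>A2_A1\<close>, the
  ordered product minus a term of lower order, which \<open>diff_op_mono\<close> admits.\<close>

lemma diff_op_A2_base: "\<exists>L'. diff_op (Suc (p + q)) L' \<and> (\<forall>F\<in>G. A2 ((A1 ^^ p) ((A2 ^^ q) F)) = L' F)"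
proof (induction p)
  case 0
  have "diff_op (Suc (0 + q)) (\<lambda>F. (A1 ^^ 0) ((A2 ^^ Suc q) F))" by (rule diff_op.base) simp
  then show ?case by (intro exI conjI) auto
next
  case (Suc p)
  then obtain L where L: "diff_op (Suc (p + q)) L" "\<forall>F\<in>G. A2 ((A1 ^^ p) ((A2 ^^ q) F)) = L F" by blast
  obtain K where K: "diff_op (Suc (Suc (p + q))) K" "\<forall>F\<in>G. A1 (L F) = K F" using diff_op_A1[OF L(1)] by blast
  have "diff_op (Suc (Suc p + q)) (\<lambda>F. K F + (- 1) *\<^sub>R L F)"
    using K(1) diff_op_mono[OF L(1)] by (intro diff_op.add diff_op.scale) auto
  moreover have "A2 ((A1 ^^ Suc p) ((A2 ^^ q) F)) = K F + (- 1) *\<^sub>R L F" if "F \<in> G" for F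
    using A2_A1[OF g1.gen_pow_in_G[OF g2.gen_pow_in_G[OF that]], of p q] L(2) K(2) that by simp
  ultimately show ?case by blast
qed

lemma diff_op_A2: "diff_op m L \<Longrightarrow> \<exists>L'. diff_op (Suc m) L' \<and> (\<forall>F\<in>G. A2 (L F) = L' F)"
proof (induction rule: diff_op.induct)
  case (base p q m)
  then show ?case using diff_op_A2_base[of p q] diff_op_mono by (meson Suc_le_mono)
next
  case (add m L K)
  then obtain L' K' where "diff_op (Suc m) L'" "\<forall>F\<in>G. A2 (L F) = L' F"
    "diff_op (Suc m) K'" "\<forall>F\<in>G. A2 (K F) = K' F" by blast
  then show ?case using diff_op_in_G[OF add(1)] diff_op_in_G[OF add(2)]
    by (intro exI[of _ "\<lambda>F. L' F + K' F"]) (auto simp: g2.gen_add intro: diff_op.add)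
next
  case (scale m L c)
  then obtain L' where "diff_op (Suc m) L'" "\<forall>F\<in>G. A2 (L F) = L' F" by blast
  then show ?case using diff_op_in_G[OF scale(1)]
    by (intro exI[of _ "\<lambda>F. c *\<^sub>R L' F"]) (auto simp: g2.gen_scale intro: diff_op.scale)
qed

lemma diff_op_lap_pow: "\<exists>L. diff_op (2 * k) L \<and> (\<forall>F\<in>G. (lap ^^ k) F = L F)"
proof (induction k)
  case 0
  have "diff_op (2 * 0) (\<lambda>F. (A1 ^^ 0) ((A2 ^^ 0) F))" by (rule diff_op.base) simp
  then show ?case by (intro exI conjI) auto
next
  case (Suc k)
  then obtain L where L: "diff_op (2 * k) L" "\<forall>F\<in>G. (lap ^^ k) F = L F" by blast
  obtain K1 K2 where K: "diff_op (Suc (2 * k)) K1" "\<forall>F\<in>G. A1 (L F) = K1 F"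
    "diff_op (Suc (2 * k)) K2" "\<forall>F\<in>G. A2 (L F) = K2 F" using diff_op_A1[OF L(1)] diff_op_A2[OF L(1)] by blast
  obtain M1 M2 where M: "diff_op (Suc (Suc (2 * k))) M1" "\<forall>F\<in>G. A1 (K1 F) = M1 F"
    "diff_op (Suc (Suc (2 * k))) M2" "\<forall>F\<in>G. A2 (K2 F) = M2 F" using diff_op_A1[OF K(1)] diff_op_A2[OF K(3)] by blast
  have "diff_op (2 * Suc k) (\<lambda>F. (- 1) *\<^sub>R M1 F + (- 1) *\<^sub>R M2 F)"
    using M by (intro diff_op.add diff_op.scale) simp_all
  moreover have "(lap ^^ Suc k) F = (- 1) *\<^sub>R M1 F + (- 1) *\<^sub>R M2 F" if "F \<in> G" for F
    using that L K M by (simp add: lap_def)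
  ultimately show ?case by blast
qed

definition multi_indices :: "nat \<Rightarrow> (nat \<times> nat) set" where
  "multi_indices m = {i. fst i + snd i \<le> m}"

lemma finite_multi_indices: "finite (multi_indices m)"
  by (rule finite_subset[of _ "{..m} \<times> {..m}"]) (auto simp: multi_indices_def)

definition deriv_op :: "nat \<times> nat \<Rightarrow> 'a \<Rightarrow> 'a" where
  "deriv_op i F = (A1 ^^ fst i) ((A2 ^^ snd i) F)"

lemma diff_op_bound:
  "diff_op m L \<Longrightarrow> \<exists>C\<ge>0. \<forall>F\<in>G. norm (L F) \<le> C * (\<Sum>i\<in>multi_indices m. norm (deriv_op i F))"
proof (induction rule: diff_op.induct)
  case (base p q m)
  have "norm (deriv_op (p, q) F) \<le> (\<Sum>i\<in>multi_indices m. norm (deriv_op i F))" for F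
    by (rule member_le_sum) (use base finite_multi_indices in \<open>auto simp: multi_indices_def\<close>)
  then show ?case by (intro exI[of _ 1]) (auto simp: deriv_op_def)
next
  case (add m L K)
  then obtain C C' where C: "0 \<le> C" "\<forall>F\<in>G. norm (L F) \<le> C * (\<Sum>i\<in>multi_indices m. norm (deriv_op i F))"
    "0 \<le> C'" "\<forall>F\<in>G. norm (K F) \<le> C' * (\<Sum>i\<in>multi_indices m. norm (deriv_op i F))" by blast
  have "norm (L F + K F) \<le> (C + C') * (\<Sum>i\<in>multi_indices m. norm (deriv_op i F))" if "F \<in> G" for F
    unfolding distrib_right using C that by (intro norm_triangle_mono) auto
  then show ?case using C by (intro exI[of _ "C + C'"]) auto
next
  case (scale m L c)
  then obtain C where C: "0 \<le> C" "\<forall>F\<in>G. norm (L F) \<le> C * (\<Sum>i\<in>multi_indices m. norm (deriv_op i F))" by blast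
  have "norm (c *\<^sub>R L F) \<le> (\<bar>c\<bar> * C) * (\<Sum>i\<in>multi_indices m. norm (deriv_op i F))" if "F \<in> G" for F
    using C that by (simp add: mult.assoc mult_left_mono)
  then show ?case using C by (intro exI[of _ "\<bar>c\<bar> * C"]) auto
qed

lemma lap_pow_bound:
  "\<exists>C\<ge>0. \<forall>F\<in>G. norm ((lap ^^ k) F) \<le> C * (\<Sum>i\<in>multi_indices (2 * k). norm (deriv_op i F))"
proof -
  obtain L where L: "diff_op (2 * k) L" "\<forall>F\<in>G. (lap ^^ k) F = L F" using diff_op_lap_pow by blast
  show ?thesis using diff_op_bound[OF L(1)] L(2) by simp
qed

text \<open>Only the letters \<open>A2\<close> feel the dilation, each with a factor
  \<open>exp (- t)\<close>; the letters \<open>A1\<close> commute with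
  \<open>T1 T t\<close>.\<close>

lemma deriv_op_T1:
  assumes "F \<in> G"
  shows "deriv_op i (T1 T t F) = exp (- (real (snd i) * t)) *\<^sub>R T1 T t (deriv_op i F)"
proof -
  have 2: "(A2 ^^ q) (T1 T t F) = exp (- (real q * t)) *\<^sub>R T1 T t ((A2 ^^ q) F)" for q
  proof (induction q)
    case (Suc q)
    have "exp (- t - q * t) = exp (- (real q * t)) * exp (- t)" by (simp flip: exp_add)
    then show ?case using Suc g2.gen_pow_in_G[OF assms, of q]
      by (simp add: g2.gen_scale g1.U_in_G A2_T1 distrib_right)
  qed simp
  have 1: "(A1 ^^ p) (c *\<^sub>R T1 T t F') = c *\<^sub>R T1 T t ((A1 ^^ p) F')" if "F' \<in> G" for p c F'
    using that by (induction p) (simp_all add: g1.gen_scale g1.U_in_G g1.gen_U g1.gen_pow_in_G)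
  show ?thesis unfolding deriv_op_def 2 by (rule 1[OF g2.gen_pow_in_G[OF assms]])
qed

lemma gen_pow_linear:
  assumes "F \<in> G" "Z \<in> G"
  shows "(A1 ^^ p) (F + Z) = (A1 ^^ p) F + (A1 ^^ p) Z" "(A1 ^^ p) (c *\<^sub>R F) = c *\<^sub>R (A1 ^^ p) F"
    "(A2 ^^ p) (F + Z) = (A2 ^^ p) F + (A2 ^^ p) Z" "(A2 ^^ p) (c *\<^sub>R F) = c *\<^sub>R (A2 ^^ p) F"
  using assms
  by (induction p)
     (simp_all add: g1.gen_add g1.gen_scale g2.gen_add g2.gen_scale g1.gen_pow_in_G g2.gen_pow_in_G)

lemma deriv_op_linear:
  assumes "F \<in> G" "Z \<in> G"
  shows "deriv_op i (F + Z) = deriv_op i F + deriv_op i Z" "deriv_op i (c *\<^sub>R F) = c *\<^sub>R deriv_op i F"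
  unfolding deriv_op_def using assms
  by (simp_all add: gen_pow_linear g2.gen_pow_in_G)

end

section \<open>Spectral windows of averaged vectors\<close>

locale axb_laplace = axb_rep T + spectral_resolution E "laplacian_graph T"
  for T :: "real \<Rightarrow> real \<Rightarrow> 'a::{real_inner,complete_space} \<Rightarrow> 'a" and E
begin

lemma closure_G: "closure G = UNIV"
  by (rule domain_dense) (rule graph_domain)

lemma E_neg: "E {..<0} x = 0"
  by (rule E_negative) (rule graph_nonneg)

text \<open>On the window above \<open>(1 / s)\<^sup>2\<close> every application of the Laplacian
  multiplies the norm by at least this number; the projection is discarded after the last
  one.\<close>

lemma lap_pow_lower:
  assumes "F \<in> G" "0 < s"
  shows "norm (E {(1 / s)\<^sup>2<..real N} F) \<le> s ^ (2 * k) * norm ((lap ^^ k) F)"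
proof -
  let ?S = "{(1 / s)\<^sup>2<..real N}"
  have S: "?S \<in> sets borel" by simp
  have G: "(lap ^^ k) F \<in> G" for k by (induction k) (simp_all add: assms lap_in_G)
  have "norm (E ?S F) \<le> s ^ (2 * k) * norm (E ?S ((lap ^^ k) F))"
  proof (induction k)
    case (Suc k)
    have "(1 / s)\<^sup>2 * norm (E ?S ((lap ^^ k) F)) \<le> norm (E ?S (lap ((lap ^^ k) F)))"
      by (rule graph_lower_bound[OF lap_graph[OF G] _ S]) auto
    then have "norm (E ?S ((lap ^^ k) F)) \<le> s\<^sup>2 * norm (E ?S ((lap ^^ Suc k) F))"
      using assms(2) by (simp add: power_divide field_simps)
    then have "s ^ (2 * k) * norm (E ?S ((lap ^^ k) F)) \<le> s ^ (2 * k) * (s\<^sup>2 * norm (E ?S ((lap ^^ Suc k) F)))"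
      using assms(2) by (intro mult_left_mono) auto
    then show ?case using Suc by (simp add: power2_eq_square mult_ac)
  qed simp
  also have "\<dots> \<le> s ^ (2 * k) * norm ((lap ^^ k) F)"
    using assms(2) by (intro mult_left_mono norm_E_le S) auto
  finally show ?thesis .
qed

text \<open>The lower bound for powers of the Laplacian holds for approximants of the average inside
  \<open>G\<close> and passes to the limit. The words turn into weighted averages of derivatives of
  \<open>F\<close>, where the averages absorb the letters \<open>A1\<close>. The letters
  \<open>A2\<close> stay on \<open>F\<close> until the second averaging.\<close>

lemma averaged_T1_bound:
  "\<exists>C\<ge>0. \<forall>s N F a. 0 < s \<longrightarrow> F \<in> G \<longrightarrow> 2 * k \<le> a \<longrightarrow>
     norm (E {(1 / s)\<^sup>2<..real N} ((g1.avg 0 s ^^ a) F))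
      \<le> C * s ^ (2 * k) * (\<Sum>i\<in>multi_indices (2 * k). \<Sum>j\<le>fst i. norm ((g1.D s ^^ j) ((A2 ^^ snd i) F)) / s ^ j)"
proof -
  let ?n = "2 * k"
  let ?I = "multi_indices ?n"
  obtain C where C: "0 \<le> C" "\<And>F. F \<in> G \<Longrightarrow> norm ((lap ^^ k) F) \<le> C * (\<Sum>i\<in>?I. norm (deriv_op i F))"
    using lap_pow_bound by blast
  \<comment> \<open>Uniform in the words: the weight \<open>snd i\<close> and the exponent
    \<open>fst i\<close> are both at most \<open>?n\<close>.\<close>
  define K where "K = (1 + 2 * real ?n) ^ ?n"
  have "norm (E {(1 / s)\<^sup>2<..real N} ((g1.avg 0 s ^^ a) F))
      \<le> (C * K) * s ^ ?n * (\<Sum>i\<in>?I. \<Sum>j\<le>fst i. norm ((g1.D s ^^ j) ((A2 ^^ snd i) F)) / s ^ j)"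
    if s: "0 < s" and F: "F \<in> G" and a: "?n \<le> a" for s N F a
  proof -
    let ?S = "{(1 / s)\<^sup>2<..real N}"
    let ?x = "\<lambda>i. (g1.avg (real (snd i)) s ^^ a) (deriv_op i F)"
    have "\<exists>Y. (\<forall>m::nat. Y m \<in> G) \<and> (\<forall>i\<in>?I. (\<lambda>m. deriv_op i (Y m)) \<longlonglongrightarrow> ?x i)"
      using s by (intro g1.avg_jet_power finite_multi_indices deriv_op_linear deriv_op_T1 F) auto
    then obtain Y where Y: "\<And>m::nat. Y m \<in> G" "\<And>i. i \<in> ?I \<Longrightarrow> (\<lambda>m. deriv_op i (Y m)) \<longlonglongrightarrow> ?x i" by blast
    \<comment> \<open>The empty word has weight \<open>0\<close> and yields the limit of
      \<open>Y\<close> itself.\<close>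
    have Y0: "Y \<longlonglongrightarrow> (g1.avg 0 s ^^ a) F"
      using Y(2)[of "(0, 0)"] by (simp add: multi_indices_def deriv_op_def)
    have "(\<lambda>m. norm (E ?S (Y m))) \<longlonglongrightarrow> norm (E ?S ((g1.avg 0 s ^^ a) F))"
      by (intro tendsto_norm bounded_linear.tendsto[OF bounded_linear_E Y0]) simp
    moreover have "(\<lambda>m. s ^ ?n * (C * (\<Sum>i\<in>?I. norm (deriv_op i (Y m))))) \<longlonglongrightarrow> s ^ ?n * (C * (\<Sum>i\<in>?I. norm (?x i)))"
      by (intro tendsto_intros Y(2))
    moreover have "norm (E ?S (Y m)) \<le> s ^ ?n * (C * (\<Sum>i\<in>?I. norm (deriv_op i (Y m))))" for m
      by (rule order_trans[OF lap_pow_lower[OF Y(1) s] mult_left_mono[OF C(2)[OF Y(1)]]]) (use s in simp)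
    ultimately have 1: "norm (E ?S ((g1.avg 0 s ^^ a) F)) \<le> s ^ ?n * (C * (\<Sum>i\<in>?I. norm (?x i)))"
      by (intro LIMSEQ_le) auto
    have "norm (?x i) \<le> K * (\<Sum>j\<le>fst i. norm ((g1.D s ^^ j) ((A2 ^^ snd i) F)) / s ^ j)" if i: "i \<in> ?I" for i
    proof -
      let ?p = "fst i" and ?q = "snd i"
      let ?z = "(A2 ^^ ?q) F"
      have pq: "?p \<le> ?n" "?q \<le> ?n" using i by (auto simp: multi_indices_def)
      have "?x i = (g1.avg (real ?q) s ^^ (a - ?p)) ((g1.V (real ?q) s ^^ ?p) ?z)"
        unfolding deriv_op_def using pq(1) a by (intro g1.avg_pow_gen_pow g2.gen_pow_in_G F s) auto
      then have "norm (?x i) \<le> norm ((g1.V (real ?q) s ^^ ?p) ?z)"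
        using g1.norm_avg_pow[of "real ?q" s "a - ?p"] s by simp
      also have "\<dots> \<le> (1 + 2 * real ?q) ^ ?p * (\<Sum>j\<le>?p. norm ((g1.D s ^^ j) ?z) / s ^ j)"
        using s by (intro g1.norm_V_pow) auto
      also have "\<dots> \<le> K * (\<Sum>j\<le>?p. norm ((g1.D s ^^ j) ?z) / s ^ j)"
      proof (rule mult_right_mono)
        have "(1 + 2 * real ?q) ^ ?p \<le> (1 + 2 * real ?n) ^ ?p" using pq by (intro power_mono) auto
        also have "\<dots> \<le> K" unfolding K_def using pq by (intro power_increasing) auto
        finally show "(1 + 2 * real ?q) ^ ?p \<le> K" .
      qed (use s in \<open>simp add: sum_nonneg\<close>)
      finally show ?thesis .
    qed
    then have "(\<Sum>i\<in>?I. norm (?x i)) \<le> K * (\<Sum>i\<in>?I. \<Sum>j\<le>fst i. norm ((g1.D s ^^ j) ((A2 ^^ snd i) F)) / s ^ j)"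
      unfolding sum_distrib_left[of K _ ?I] by (rule sum_mono)
    then have "s ^ ?n * (C * (\<Sum>i\<in>?I. norm (?x i)))
      \<le> s ^ ?n * (C * (K * (\<Sum>i\<in>?I. \<Sum>j\<le>fst i. norm ((g1.D s ^^ j) ((A2 ^^ snd i) F)) / s ^ j)))"
      using C(1) s by (intro mult_left_mono) auto
    with 1 show ?thesis by (simp add: mult_ac)
  qed
  moreover have "0 \<le> C * K" using C(1) by (simp add: K_def)
  ultimately show ?thesis by blast
qed

text \<open>The estimate for \<open>T1\<close> is applied to approximants of the \<open>T2\<close>
  average. Powers of \<open>A2\<close> commute with \<open>T2\<close>, so the weight is
  \<open>0\<close> and each generator becomes an exact difference divided by
  \<open>s\<close>.\<close>

lemma averaged_bound:
  "\<exists>C\<ge>0. \<forall>s N f a b. 0 < s \<longrightarrow> f \<in> G \<longrightarrow> 2 * k \<le> a \<longrightarrow> 2 * k \<le> b \<longrightarrow>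
     norm (E {(1 / s)\<^sup>2<..real N} ((g1.avg 0 s ^^ a) ((g2.avg 0 s ^^ b) f)))
      \<le> C * s ^ (2 * k) * (\<Sum>i\<in>multi_indices (2 * k). \<Sum>j\<le>fst i.
          norm ((g1.D s ^^ j) ((g2.avg 0 s ^^ (b - snd i)) ((g2.D s ^^ snd i) f))) / s ^ (j + snd i))"
proof -
  let ?n = "2 * k"
  let ?I = "multi_indices ?n"
  obtain C where C: "0 \<le> C" "\<And>s N F a. 0 < s \<Longrightarrow> F \<in> G \<Longrightarrow> ?n \<le> a \<Longrightarrow>
     norm (E {(1 / s)\<^sup>2<..real N} ((g1.avg 0 s ^^ a) F))
      \<le> C * s ^ ?n * (\<Sum>i\<in>?I. \<Sum>j\<le>fst i. norm ((g1.D s ^^ j) ((A2 ^^ snd i) F)) / s ^ j)"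
    using averaged_T1_bound[of k] by blast
  have "norm (E {(1 / s)\<^sup>2<..real N} ((g1.avg 0 s ^^ a) ((g2.avg 0 s ^^ b) f)))
      \<le> C * s ^ ?n * (\<Sum>i\<in>?I. \<Sum>j\<le>fst i.
          norm ((g1.D s ^^ j) ((g2.avg 0 s ^^ (b - snd i)) ((g2.D s ^^ snd i) f))) / s ^ (j + snd i))"
    if s: "0 < s" and f: "f \<in> G" and ab: "?n \<le> a" "?n \<le> b" for s N f a b
  proof -
    let ?S = "{(1 / s)\<^sup>2<..real N}"
    let ?y = "\<lambda>q. (g2.avg 0 s ^^ b) ((A2 ^^ q) f)"
    have "\<exists>Y. (\<forall>m::nat. Y m \<in> G) \<and> (\<forall>q\<in>{..?n}. (\<lambda>m. (A2 ^^ q) (Y m)) \<longlonglongrightarrow> ?y q)"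
    proof (rule g2.avg_jet_power[where q = "\<lambda>_. 0" and L = "\<lambda>q. A2 ^^ q" and I = "{..?n}"])
      fix q F t assume "F \<in> G"
      then have "(A2 ^^ q) (T2 T t F) = T2 T t ((A2 ^^ q) F)"
        by (induction q) (simp_all add: g2.gen_U g2.gen_pow_in_G)
      then show "(A2 ^^ q) (T2 T t F) = exp (- (0 * t)) *\<^sub>R T2 T t ((A2 ^^ q) F)" by simp
    qed (use s f in \<open>simp_all add: gen_pow_linear\<close>)
    then obtain Y where Y: "\<And>m::nat. Y m \<in> G" "\<And>q. q \<le> ?n \<Longrightarrow> (\<lambda>m. (A2 ^^ q) (Y m)) \<longlonglongrightarrow> ?y q" by auto
    have Y0: "Y \<longlonglongrightarrow> (g2.avg 0 s ^^ b) f" using Y(2)[of 0] by simp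
    have 1: "(\<lambda>m. norm (E ?S ((g1.avg 0 s ^^ a) (Y m)))) \<longlonglongrightarrow> norm (E ?S ((g1.avg 0 s ^^ a) ((g2.avg 0 s ^^ b) f)))"
      using s by (intro tendsto_norm bounded_linear.tendsto[OF bounded_linear_E]
          bounded_linear.tendsto[OF g1.bounded_linear_funpow[OF g1.bounded_linear_avg]] Y0) auto
    have 2: "(\<lambda>m. C * s ^ ?n * (\<Sum>i\<in>?I. \<Sum>j\<le>fst i. norm ((g1.D s ^^ j) ((A2 ^^ snd i) (Y m))) / s ^ j))
      \<longlonglongrightarrow> C * s ^ ?n * (\<Sum>i\<in>?I. \<Sum>j\<le>fst i. norm ((g1.D s ^^ j) (?y (snd i))) / s ^ j)"
      using s by (intro tendsto_mult tendsto_const tendsto_sum tendsto_divide tendsto_norm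
          bounded_linear.tendsto[OF g1.bounded_linear_funpow[OF g1.bounded_linear_D]] Y(2))
        (auto simp: multi_indices_def)
    have 3: "norm (E ?S ((g1.avg 0 s ^^ a) ((g2.avg 0 s ^^ b) f)))
        \<le> C * s ^ ?n * (\<Sum>i\<in>?I. \<Sum>j\<le>fst i. norm ((g1.D s ^^ j) (?y (snd i))) / s ^ j)"
      by (rule LIMSEQ_le[OF 1 2]) (use C(2)[OF s Y(1) ab(1)] in blast)
    have eq: "norm ((g1.D s ^^ j) (?y (snd i))) / s ^ j
      = norm ((g1.D s ^^ j) ((g2.avg 0 s ^^ (b - snd i)) ((g2.D s ^^ snd i) f))) / s ^ (j + snd i)" if "i \<in> ?I" for i j
    proof -
      let ?q = "snd i"
      have q: "?q \<le> b" using that ab by (auto simp: multi_indices_def)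
      have "?y ?q = (g2.avg 0 s ^^ (b - ?q)) ((1 / s ^ ?q) *\<^sub>R (g2.D s ^^ ?q) f)"
        unfolding g2.avg_pow_gen_pow[OF f s q] g2.V_zero_pow ..
      also have "\<dots> = (1 / s ^ ?q) *\<^sub>R (g2.avg 0 s ^^ (b - ?q)) ((g2.D s ^^ ?q) f)"
        using s by (intro linear_scale bounded_linear.linear g2.bounded_linear_funpow g2.bounded_linear_avg) auto
      finally have "(g1.D s ^^ j) (?y ?q) = (1 / s ^ ?q) *\<^sub>R (g1.D s ^^ j) ((g2.avg 0 s ^^ (b - ?q)) ((g2.D s ^^ ?q) f))"
        by (simp only: linear_scale[OF bounded_linear.linear[OF g1.bounded_linear_funpow[OF g1.bounded_linear_D]]])
      then show ?thesis using s by (simp add: power_add mult.commute)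
    qed
    have "(\<Sum>i\<in>?I. \<Sum>j\<le>fst i. norm ((g1.D s ^^ j) (?y (snd i))) / s ^ j) = (\<Sum>i\<in>?I. \<Sum>j\<le>fst i.
        norm ((g1.D s ^^ j) ((g2.avg 0 s ^^ (b - snd i)) ((g2.D s ^^ snd i) f))) / s ^ (j + snd i))"
      by (intro sum.cong refl eq)
    with 3 show ?thesis by (simp only:)
  qed
  with C(1) show ?thesis by (intro exI[of _ C] conjI allI impI)
qed

end

section \<open>Mixed moduli and the Jackson inequality\<close>

text \<open>Absorption of Landau-Kolmogorov type: \<open>b m\<close> is estimated by
  \<open>b 0\<close> and \<open>b (Suc m)\<close>, and enters the bound of \<open>b (Suc m)\<close>
  with the factor \<open>2 / K\<close>; a large \<open>K\<close> leaves at most half of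
  \<open>b (Suc m)\<close> on the right. \<open>C\<close> precedes the sequence \<open>b\<close>
  since the constant has to be uniform in \<open>s\<close> and \<open>f\<close>.\<close>

lemma interpolation_chain:
  fixes W :: "nat \<Rightarrow> real"
  assumes W: "\<And>m. 0 \<le> W m"
  shows "\<exists>C\<ge>0. \<forall>b::nat \<Rightarrow> real. (\<forall>m. 0 \<le> b m) \<longrightarrow> (\<forall>K m. 1 \<le> K \<longrightarrow> b (Suc m) \<le> W m * (2 / K * b m + 2 * K * b (Suc (Suc m))))
    \<longrightarrow> b m \<le> C * (b 0 + b (Suc m))"
proof (induction m)
  case 0
  show ?case by (intro exI[of _ 1]) auto
next
  case (Suc m)
  then obtain C where C: "0 \<le> C" "\<And>b :: nat \<Rightarrow> real. \<forall>m. 0 \<le> b m \<Longrightarrow>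
      \<forall>K m. 1 \<le> K \<longrightarrow> b (Suc m) \<le> W m * (2 / K * b m + 2 * K * b (Suc (Suc m))) \<Longrightarrow> b m \<le> C * (b 0 + b (Suc m))"
    by blast
  \<comment> \<open>Large enough for \<open>W m * (2 / K) * C \<le> 1 / 2\<close>; the summand
    \<open>1\<close> ensures \<open>1 \<le> K\<close>.\<close>
  define K where "K = 4 * W m * C + 1"
  have K: "1 \<le> K" using W[of m] C(1) by (simp add: K_def)
  have WK: "W m * (2 / K) * C \<le> 1 / 2"
  proof -
    have "W m * 2 * C * 2 \<le> K" by (simp add: K_def)
    then show ?thesis using K by (simp add: field_simps)
  qed
  have "b (Suc m) \<le> (1 + 4 * W m * K) * (b 0 + b (Suc (Suc m)))"
    if b: "\<forall>m. 0 \<le> b m" "\<forall>K m. 1 \<le> K \<longrightarrow> b (Suc m) \<le> W m * (2 / K * b m + 2 * K * b (Suc (Suc m)))"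
    for b :: "nat \<Rightarrow> real"
  proof -
    have "b (Suc m) \<le> W m * (2 / K * b m + 2 * K * b (Suc (Suc m)))" using b(2) K by blast
    also have "\<dots> = W m * (2 / K) * b m + 2 * W m * K * b (Suc (Suc m))" by (simp add: distrib_left)
    finally have 1: "b (Suc m) \<le> W m * (2 / K) * b m + 2 * W m * K * b (Suc (Suc m))" .
    have "W m * (2 / K) * b m \<le> W m * (2 / K) * (C * (b 0 + b (Suc m)))"
      using C(2)[OF b] W[of m] K by (intro mult_left_mono) auto
    also have "\<dots> = (W m * (2 / K) * C) * (b 0 + b (Suc m))" by simp
    also have "\<dots> \<le> 1 / 2 * (b 0 + b (Suc m))" using b(1) by (intro mult_right_mono WK add_nonneg_nonneg) auto
    finally have "b (Suc m) \<le> b 0 + 4 * W m * K * b (Suc (Suc m))" using 1 by simp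
    moreover have "0 \<le> 4 * W m * K * b 0" "0 \<le> b (Suc (Suc m))" using W[of m] K b(1) by auto
    ultimately show ?thesis by (simp add: algebra_simps)
  qed
  moreover have "0 \<le> 1 + 4 * W m * K" using W[of m] K by simp
  ultimately show ?case by blast
qed

lemma interpolation:
  fixes W :: "nat \<Rightarrow> real"
  assumes W: "\<And>m. 0 \<le> W m"
  shows "\<exists>C\<ge>0. \<forall>b::nat \<Rightarrow> real. (\<forall>m. 0 \<le> b m) \<longrightarrow> (\<forall>K m. 1 \<le> K \<longrightarrow> b (Suc m) \<le> W m * (2 / K * b m + 2 * K * b (Suc (Suc m))))
    \<longrightarrow> b m \<le> C * (b 0 + b (m + d))"
proof (induction d)
  case 0
  show ?case by (intro exI[of _ 1]) auto
next
  case (Suc d)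
  then obtain C where C: "0 \<le> C" "\<And>b :: nat \<Rightarrow> real. \<forall>m. 0 \<le> b m \<Longrightarrow>
      \<forall>K m. 1 \<le> K \<longrightarrow> b (Suc m) \<le> W m * (2 / K * b m + 2 * K * b (Suc (Suc m))) \<Longrightarrow> b m \<le> C * (b 0 + b (m + d))"
    by blast
  obtain C' where C': "0 \<le> C'" "\<And>b :: nat \<Rightarrow> real. \<forall>m. 0 \<le> b m \<Longrightarrow>
      \<forall>K m. 1 \<le> K \<longrightarrow> b (Suc m) \<le> W m * (2 / K * b m + 2 * K * b (Suc (Suc m))) \<Longrightarrow> b (m + d) \<le> C' * (b 0 + b (Suc (m + d)))"
    using interpolation_chain[of W "m + d", OF W] by blast
  have "b m \<le> (C + C * C') * (b 0 + b (m + Suc d))"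
    if b: "\<forall>m. 0 \<le> b m" "\<forall>K m. 1 \<le> K \<longrightarrow> b (Suc m) \<le> W m * (2 / K * b m + 2 * K * b (Suc (Suc m)))"
    for b :: "nat \<Rightarrow> real"
  proof -
    have "b m \<le> C * (b 0 + b (m + d))" by (rule C(2)[OF b])
    also have "\<dots> \<le> C * (b 0 + C' * (b 0 + b (Suc (m + d))))"
      using C'(2)[OF b] C(1) by (intro mult_left_mono) auto
    also have "\<dots> \<le> (C + C * C') * (b 0 + b (m + Suc d))"
      using C(1) b(1) by (simp add: algebra_simps)
    finally show ?thesis .
  qed
  moreover have "0 \<le> C + C * C'" using C(1) C'(1) by simp
  ultimately show ?case by blast
qed

context axb_rep
begin

section \<open>Mixed differences and mixed moduli\<close>

definition diff_by :: "nat \<Rightarrow> real \<Rightarrow> 'a \<Rightarrow> 'a" where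
  "diff_by j t g = (if j = 1 then g1.D t g else g2.D t g)"

lemma mixed_diff_Cons: "mixed_diff T (j # js) (t # ts) f = diff_by j t (mixed_diff T js ts f)"
  by (simp add: Let_def diff_by_def g1.D_def g2.D_def)

declare mixed_diff.simps(1) [simp del] and mixed_diff_Cons [simp]

lemma norm_diff_by: "norm (diff_by j t g) \<le> 2 * norm g"
  by (simp add: diff_by_def g1.norm_D g2.norm_D)

lemma bounded_linear_diff_by: "bounded_linear (diff_by j t)"
  unfolding diff_by_def by (cases "j = 1") (simp_all add: g1.bounded_linear_D g2.bounded_linear_D)

lemma norm_diff_by_second:
  "k > 0 \<Longrightarrow> norm (diff_by j t g) \<le> 2 / real k * norm g + real k * norm (diff_by j t (diff_by j t g))"
  unfolding diff_by_def using g1.norm_D_second g2.norm_D_second by simp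

lemma mixed_diff_append:
  "length js = length ts \<Longrightarrow> mixed_diff T (js @ js') (ts @ ts') f = mixed_diff T js ts (mixed_diff T js' ts' f)"
  by (induction js ts rule: list_induct2) simp_all

lemma norm_mixed_diff: "length js = length ts \<Longrightarrow> norm (mixed_diff T js ts f) \<le> 2 ^ length js * norm f"
proof (induction js ts rule: list_induct2)
  case (Cons j js t ts)
  then show ?case using norm_diff_by[of j t "mixed_diff T js ts f"] by simp
qed simp

lemma mixed_diff_diff:
  "length js = length ts \<Longrightarrow> mixed_diff T js ts (f - g) = mixed_diff T js ts f - mixed_diff T js ts g"
  by (induction js ts rule: list_induct2)
     (simp_all add: linear_diff[OF bounded_linear.linear[OF bounded_linear_diff_by]])

lemma mixed_diff_T2: "mixed_diff T (replicate q 2) (replicate q s) f = (g2.D s ^^ q) f"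
  by (induction q) (simp_all add: diff_by_def)

lemma mixed_diff_diffs:
  "mixed_diff T (replicate (length ts) 1) ts f = g1.diffs ts f"
  "mixed_diff T (replicate (length ts) 2) ts f = g2.diffs ts f"
  by (induction ts) (simp_all add: diff_by_def)

definition words :: "nat \<Rightarrow> nat list set" where
  "words r = {js. length js = r \<and> set js \<subseteq> {1, 2}}"

definition steps :: "nat \<Rightarrow> real \<Rightarrow> real list set" where
  "steps r s = {ts. length ts = r \<and> (\<forall>t\<in>set ts. 0 \<le> t \<and> t \<le> s)}"

lemma finite_words: "finite (words r)" and card_words: "card (words r) = 2 ^ r"
proof -
  have "words r = {js. set js \<subseteq> {1, 2} \<and> length js = r}" by (auto simp: words_def)
  moreover have "card {1, 2 :: nat} = 2" by (simp del: One_nat_def)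
  ultimately show "finite (words r)" "card (words r) = 2 ^ r"
    by (simp_all only: finite_lists_length_eq card_lists_length_eq finite.intros)
qed

lemma steps_nonempty: "0 \<le> s \<Longrightarrow> steps r s \<noteq> {}"
  by (auto simp: steps_def intro!: exI[of _ "replicate r 0"])

lemma mixed_modulus_eq:
  "mixed_modulus T r s f = (\<Sum>js\<in>words r. SUP ts\<in>steps r s. norm (mixed_diff T js ts f))"
  by (simp add: mixed_modulus_def words_def steps_def)

lemma bdd_mixed_diff:
  assumes "js \<in> words r"
  shows "bdd_above ((\<lambda>ts. norm (mixed_diff T js ts f)) ` steps r s)"
proof (rule bdd_aboveI2)
  show "norm (mixed_diff T js ts f) \<le> 2 ^ length js * norm f" if "ts \<in> steps r s" for ts
    using assms that by (intro norm_mixed_diff) (simp add: words_def steps_def)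
qed

lemma norm_le_sup: "js \<in> words r \<Longrightarrow> ts \<in> steps r s \<Longrightarrow>
    norm (mixed_diff T js ts f) \<le> (SUP ts\<in>steps r s. norm (mixed_diff T js ts f))"
  by (rule cSUP_upper[OF _ bdd_mixed_diff])

lemma sup_nonneg:
  assumes "js \<in> words r" "0 \<le> s"
  shows "0 \<le> (SUP ts\<in>steps r s. norm (mixed_diff T js ts f))"
proof -
  obtain ts where "ts \<in> steps r s" using steps_nonempty[OF assms(2)] by blast
  from norm_le_sup[OF assms(1) this] show ?thesis using norm_ge_zero order_trans by blast
qed

lemma mixed_modulus_nonneg: "0 \<le> s \<Longrightarrow> 0 \<le> mixed_modulus T r s f"
  unfolding mixed_modulus_eq by (intro sum_nonneg sup_nonneg)

lemma mixed_diff_le_modulus: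
  assumes "js \<in> words r" "ts \<in> steps r s" "0 \<le> s"
  shows "norm (mixed_diff T js ts f) \<le> mixed_modulus T r s f"
proof -
  have "(SUP ts\<in>steps r s. norm (mixed_diff T js ts f)) \<le> mixed_modulus T r s f"
    unfolding mixed_modulus_eq using assms finite_words sup_nonneg by (intro member_le_sum) auto
  then show ?thesis using norm_le_sup[OF assms(1,2)] order_trans by blast
qed

lemma mixed_modulus_le:
  assumes "0 \<le> s" "\<And>js ts. js \<in> words r \<Longrightarrow> ts \<in> steps r s \<Longrightarrow> norm (mixed_diff T js ts f) \<le> c"
  shows "mixed_modulus T r s f \<le> 2 ^ r * c"
proof -
  have "mixed_modulus T r s f \<le> of_nat (card (words r)) * c"
    unfolding mixed_modulus_eq using assms by (intro sum_bounded_above cSUP_least steps_nonempty) auto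
  then show ?thesis by (simp add: card_words)
qed

lemma mixed_modulus_0: "0 \<le> s \<Longrightarrow> mixed_modulus T 0 s f = norm f"
proof -
  have "words 0 = {[]}" "steps 0 s = {[]}" by (auto simp: words_def steps_def)
  then show ?thesis by (simp add: mixed_modulus_eq)
qed

lemma words_Suc: "js \<in> words (Suc r) \<longleftrightarrow> (\<exists>j js'. js = j # js' \<and> j \<in> {1, 2} \<and> js' \<in> words r)"
  by (cases js) (auto simp: words_def)

lemma steps_Suc: "ts \<in> steps (Suc r) s \<longleftrightarrow> (\<exists>t ts'. ts = t # ts' \<and> 0 \<le> t \<and> t \<le> s \<and> ts' \<in> steps r s)"
  by (cases ts) (auto simp: steps_def)

lemma mixed_modulus_Suc:
  assumes "0 \<le> s"
  shows "mixed_modulus T (Suc r) s f \<le> 2 ^ Suc r * (2 * mixed_modulus T r s f)"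
proof (rule mixed_modulus_le[OF assms])
  fix js ts assume "js \<in> words (Suc r)" "ts \<in> steps (Suc r) s"
  then obtain j js' t ts' where "js = j # js'" "ts = t # ts'" "js' \<in> words r" "ts' \<in> steps r s"
    unfolding words_Suc steps_Suc by blast
  then show "norm (mixed_diff T js ts f) \<le> 2 * mixed_modulus T r s f"
    using norm_diff_by[of j t "mixed_diff T js' ts' f"] mixed_diff_le_modulus[of js' r ts' s f] assms by simp
qed

lemma mixed_modulus_add: "\<exists>C\<ge>0. \<forall>s f. 0 \<le> s \<longrightarrow> mixed_modulus T (r + d) s f \<le> C * mixed_modulus T r s f"
proof (induction d)
  case 0
  show ?case by (intro exI[of _ 1]) auto
next
  case (Suc d)
  then obtain C where C: "0 \<le> C" "\<And>s f. 0 \<le> s \<Longrightarrow> mixed_modulus T (r + d) s f \<le> C * mixed_modulus T r s f" by blast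
  have "mixed_modulus T (r + Suc d) s f \<le> (2 ^ Suc (r + d) * (2 * C)) * mixed_modulus T r s f" if "0 \<le> s" for s f
  proof -
    have "mixed_modulus T (r + Suc d) s f \<le> 2 ^ Suc (r + d) * (2 * mixed_modulus T (r + d) s f)"
      using mixed_modulus_Suc[OF that] by simp
    also have "\<dots> \<le> 2 ^ Suc (r + d) * (2 * (C * mixed_modulus T r s f))"
      by (intro mult_left_mono C(2) that) auto
    finally show ?thesis by (simp add: mult_ac)
  qed
  moreover have "0 \<le> 2 ^ Suc (r + d) * (2 * C)" using C(1) by simp
  ultimately show ?case by blast
qed

text \<open>Repeating the outermost letter with the same step gives a second difference, and this is
  itself one of the differences in the modulus of order \<open>m + 2\<close>.\<close>

lemma mixed_modulus_interp:
  assumes "0 \<le> s" "0 < k"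
  shows "mixed_modulus T (Suc m) s f \<le> 2 ^ Suc m * (2 / real k * mixed_modulus T m s f + real k * mixed_modulus T (Suc (Suc m)) s f)"
proof (rule mixed_modulus_le[OF assms(1)])
  fix js ts assume "js \<in> words (Suc m)" "ts \<in> steps (Suc m) s"
  then obtain j js' t ts' where w: "js = j # js'" "j \<in> {1, 2}" "js' \<in> words m"
    and t: "ts = t # ts'" "0 \<le> t" "t \<le> s" "ts' \<in> steps m s"
    unfolding words_Suc steps_Suc by blast
  let ?g = "mixed_diff T js' ts' f"
  have "j # j # js' \<in> words (Suc (Suc m))" "t # t # ts' \<in> steps (Suc (Suc m)) s"
    using w t unfolding words_Suc steps_Suc by blast+
  then have "norm (diff_by j t (diff_by j t ?g)) \<le> mixed_modulus T (Suc (Suc m)) s f"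
    using mixed_diff_le_modulus[of "j # j # js'" "Suc (Suc m)" "t # t # ts'" s f] assms(1) by simp
  then have "real k * norm (diff_by j t (diff_by j t ?g)) \<le> real k * mixed_modulus T (Suc (Suc m)) s f"
    by (rule mult_left_mono) simp
  moreover have "2 / real k * norm ?g \<le> 2 / real k * mixed_modulus T m s f"
    using mixed_diff_le_modulus[OF w(3) t(4) assms(1)] by (intro mult_left_mono) auto
  ultimately show "norm (mixed_diff T js ts f) \<le> 2 / real k * mixed_modulus T m s f + real k * mixed_modulus T (Suc (Suc m)) s f"
    using norm_diff_by_second[OF assms(2), of j t ?g] w(1) t(1) by simp
qed

text \<open>Dividing by \<open>s ^ m\<close> brings \<open>mixed_modulus_interp\<close> to the form
  that \<open>interpolation\<close> expects, with \<open>norm f\<close> as the term of index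
  0.\<close>

lemma marchaud:
  assumes "m \<le> n"
  shows "\<exists>C\<ge>0. \<forall>s f. 0 < s \<longrightarrow> s \<le> 1 \<longrightarrow>
    mixed_modulus T m s f / s ^ m \<le> C * (norm f + mixed_modulus T n s f / s ^ n)"
proof -
  define W :: "nat \<Rightarrow> real" where "W m = 2 ^ Suc m" for m
  obtain C where C: "0 \<le> C" "\<And>b :: nat \<Rightarrow> real. \<forall>m. 0 \<le> b m \<Longrightarrow>
      \<forall>K m. 1 \<le> K \<longrightarrow> b (Suc m) \<le> W m * (2 / K * b m + 2 * K * b (Suc (Suc m))) \<Longrightarrow> b m \<le> C * (b 0 + b (m + (n - m)))"
    using interpolation[of W m "n - m"] unfolding W_def by auto
  have "mixed_modulus T m s f / s ^ m \<le> C * (norm f + mixed_modulus T n s f / s ^ n)" if s: "0 < s" "s \<le> 1" for s f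
  proof -
    define b where "b m = mixed_modulus T m s f / s ^ m" for m
    have \<omega>: "0 \<le> mixed_modulus T m s f" for m using s by (intro mixed_modulus_nonneg) simp
    have "b m \<le> C * (b 0 + b (m + (n - m)))"
    proof (rule C(2), intro allI, unfold b_def)
      show "0 \<le> mixed_modulus T m s f / s ^ m" for m using \<omega> s by simp
    next
      show "\<forall>K m. 1 \<le> K \<longrightarrow> mixed_modulus T (Suc m) s f / s ^ Suc m \<le> W m * (2 / K * (mixed_modulus T m s f / s ^ m)
          + 2 * K * (mixed_modulus T (Suc (Suc m)) s f / s ^ Suc (Suc m)))"
      proof (intro allI impI)
        fix K :: real and m assume K: "1 \<le> K"
        let ?x = "mixed_modulus T m s f" and ?y = "mixed_modulus T (Suc (Suc m)) s f"
        \<comment> \<open>The free integer is about \<open>K / s\<close>. Since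
          \<open>s \<le> 1 \<le> K\<close>, this quotient is at least 1 and rounding up at most
          doubles it, whence the factor \<open>2 * K\<close>.\<close>
        define k where "k = nat \<lceil>K / s\<rceil>"
        have Ks: "1 \<le> K / s" using K s by (simp add: pos_le_divide_eq)
        have k: "K / s \<le> real k" "real k \<le> 2 * K / s"
          using Ks unfolding k_def by (auto simp: le_nat_iff) linarith+
        have k0: "0 < k" using k(1) Ks by (intro gr0I) auto
        have "2 / real k \<le> 2 * s / K"
        proof -
          have "K \<le> real k * s" using k(1) s(1) by (simp add: pos_divide_le_eq)
          then show ?thesis using k0 K by (simp add: field_simps)
        qed
        then have "2 / real k * ?x + real k * ?y \<le> 2 * s / K * ?x + 2 * K / s * ?y"
          using k(2) \<omega> by (intro add_mono mult_right_mono)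
        then have "2 ^ Suc m * (2 / real k * ?x + real k * ?y) \<le> W m * (2 * s / K * ?x + 2 * K / s * ?y)"
          unfolding W_def by (rule mult_left_mono) simp
        with mixed_modulus_interp[OF less_imp_le[OF s(1)] k0, of m f]
        have "mixed_modulus T (Suc m) s f \<le> W m * (2 * s / K * ?x + 2 * K / s * ?y)" by (rule order_trans)
        then have "mixed_modulus T (Suc m) s f / s ^ Suc m \<le> W m * (2 * s / K * ?x + 2 * K / s * ?y) / s ^ Suc m"
          by (rule divide_right_mono) (use s in simp)
        also have "\<dots> = W m * (2 / K * (?x / s ^ m) + 2 * K * (?y / s ^ Suc (Suc m)))"
          using s K by (simp add: field_simps)
        finally show "mixed_modulus T (Suc m) s f / s ^ Suc m \<le> W m * (2 / K * (?x / s ^ m) + 2 * K * (?y / s ^ Suc (Suc m)))" .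
      qed
    qed
    then show ?thesis using assms s by (simp add: b_def mixed_modulus_0)
  qed
  then show ?thesis using C(1) by blast
qed

text \<open>Behind \<open>T2 T v\<close>, a difference of \<open>T1\<close> becomes one behind
  \<open>T2 T (exp s * v)\<close> plus a difference of \<open>T2\<close> with step
  \<open>v * (exp s - 1)\<close>. The second premise keeps these steps in \<open>[0, s]\<close>
  although \<open>v\<close> may grow by \<open>exp s\<close> at each of the \<open>j\<close> stages;
  two summands per stage give \<open>2 ^ j\<close>.\<close>

lemma T1_D_T2:
  assumes "0 \<le> s"
  shows "\<lbrakk>0 \<le> v; exp s ^ j * (v * (exp s - 1)) \<le> s;
      \<And>js ts. js \<in> words j \<Longrightarrow> ts \<in> steps j s \<Longrightarrow> norm (mixed_diff T js ts g) \<le> c\<rbrakk>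
    \<Longrightarrow> norm ((g1.D s ^^ j) (T2 T v g)) \<le> 2 ^ j * c"
proof (induction j arbitrary: v g)
  case 0
  then show ?case using "0.prems"(3)[of "[]" "[]"] by (simp add: words_def steps_def)
next
  case (Suc j)
  define t where "t = v * (exp s - 1)"
  have es: "1 \<le> exp s" using assms by simp
  have t0: "0 \<le> t" using Suc.prems(1) es by (simp add: t_def)
  have "1 * t \<le> exp s ^ Suc j * t" using es t0 by (intro mult_right_mono one_le_power) auto
  then have ts: "t \<le> s" using Suc.prems(2) by (simp add: t_def)
  have shift: "norm (mixed_diff T js ts (diff_by i u g)) \<le> c"
    if "js \<in> words j" "ts \<in> steps j s" "i \<in> {1, 2}" "0 \<le> u" "u \<le> s" for js ts i u
  proof -
    have "js @ [i] \<in> words (Suc j)" "ts @ [u] \<in> steps (Suc j) s"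
      using that by (auto simp: words_def steps_def)
    moreover have "mixed_diff T (js @ [i]) (ts @ [u]) g = mixed_diff T js ts (diff_by i u g)"
      using that by (subst mixed_diff_append) (auto simp: words_def steps_def)
    ultimately show ?thesis using Suc.prems(3) by metis
  qed
  have "g1.D s (T2 T v g) = T2 T (exp s * v) (g1.D s g) + T2 T v (g2.D t g)"
    by (simp add: g1.D_def g2.D_def T1_T2 g2.U_minus g2.U_add t_def algebra_simps)
  then have eq: "(g1.D s ^^ Suc j) (T2 T v g) = (g1.D s ^^ j) (T2 T (exp s * v) (g1.D s g)) + (g1.D s ^^ j) (T2 T v (g2.D t g))"
    unfolding funpow_Suc_right o_apply
    by (simp only: linear_add[OF bounded_linear.linear[OF g1.bounded_linear_funpow[OF g1.bounded_linear_D]]])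
  have "norm ((g1.D s ^^ j) (T2 T (exp s * v) (g1.D s g))) \<le> 2 ^ j * c"
  proof (rule Suc.IH)
    show "exp s ^ j * (exp s * v * (exp s - 1)) \<le> s" using Suc.prems(2) by (simp add: mult_ac)
    show "norm (mixed_diff T js ts (g1.D s g)) \<le> c" if "js \<in> words j" "ts \<in> steps j s" for js ts
      using shift[OF that, of 1 s] assms by (simp add: diff_by_def)
  qed (use Suc.prems(1) in simp)
  moreover have "norm ((g1.D s ^^ j) (T2 T v (g2.D t g))) \<le> 2 ^ j * c"
  proof (rule Suc.IH)
    have "exp s ^ j * t \<le> exp s ^ Suc j * t" using es t0 by (intro mult_right_mono power_increasing) auto
    from order_trans[OF this Suc.prems(2)[folded t_def]]
    show "exp s ^ j * (v * (exp s - 1)) \<le> s" by (simp only: t_def)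
    show "norm (mixed_diff T js ts (g2.D t g)) \<le> c" if "js \<in> words j" "ts \<in> steps j s" for js ts
      using shift[OF that, of 2 t] t0 ts by (simp add: diff_by_def)
  qed (use Suc.prems(1) in simp)
  ultimately have "norm ((g1.D s ^^ Suc j) (T2 T v g)) \<le> 2 ^ j * c + 2 ^ j * c"
    unfolding eq by (rule norm_triangle_mono)
  then show ?case by (simp only: power_Suc mult_2 distrib_right)
qed

text \<open>The remaining \<open>T2\<close> averages are translates by at most
  \<open>2 * (n + 1) * s\<close>. With \<open>exp s - 1 \<le> 2 * s\<close> and
  \<open>exp (j * s) \<le> exp n\<close>, the premise of \<open>T1_D_T2\<close> follows from
  \<open>4 * (n + 1) * exp n * s^2 \<le> s\<close>, which is the condition on
  \<open>s\<close>.\<close>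

lemma mixed_term_bound:
  assumes s: "0 < s" "s \<le> 1 / (4 * (real n + 1) * exp (real n))" and jq: "j + q \<le> n" and b: "b \<le> 2 * n"
  shows "norm ((g1.D s ^^ j) ((g2.avg 0 s ^^ b) ((g2.D s ^^ q) f))) \<le> 2 ^ n * mixed_modulus T (j + q) s f"
proof -
  let ?g = "(g2.D s ^^ q) f"
  have "1 * 1 \<le> (4 * (real n + 1)) * exp (real n)" by (intro mult_mono) auto
  then have "1 / (4 * (real n + 1) * exp (real n)) \<le> 1" by (simp add: divide_le_eq_1)
  then have s1: "s \<le> 1" using s(2) by linarith
  have "exp s \<le> 1 + s + s\<^sup>2" using exp_bound[of s] s s1 by simp
  moreover have "s\<^sup>2 \<le> s" using s s1 by (simp add: power2_eq_square mult_left_le)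
  ultimately have es: "exp s - 1 \<le> 2 * s" by simp
  have "norm ((g1.D s ^^ j) ((g2.avg 0 s ^^ b) ?g)) \<le> 2 ^ j * mixed_modulus T (j + q) s f"
  proof (rule g2.avg_pow_bound)
    show "bounded_linear (g1.D s ^^ j)" by (rule g1.bounded_linear_funpow[OF g1.bounded_linear_D])
    fix v assume v: "0 \<le> v" "v \<le> real b * s"
    show "norm ((g1.D s ^^ j) (T2 T v ?g)) \<le> 2 ^ j * mixed_modulus T (j + q) s f"
    proof (rule T1_D_T2[OF _ v(1)])
      have "exp s ^ j = exp (real j * s)" by (rule exp_of_nat_mult[symmetric])
      also have "\<dots> \<le> exp (real n)"
      proof -
        have "real j * s \<le> real n * 1" using jq s s1 by (intro mult_mono) auto
        then show ?thesis by simp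
      qed
      finally have ej: "exp s ^ j \<le> exp (real n)" .
      have "real b * s \<le> (2 * (real n + 1)) * s" using b s by (intro mult_right_mono) auto
      then have "v * (exp s - 1) \<le> ((2 * (real n + 1)) * s) * (2 * s)"
        using order_trans[OF v(2)] v(1) es s by (intro mult_mono) auto
      then have "exp s ^ j * (v * (exp s - 1)) \<le> exp (real n) * (((2 * (real n + 1)) * s) * (2 * s))"
        using s v by (intro mult_mono[OF ej]) auto
      also have "\<dots> = s * (s * (4 * (real n + 1) * exp (real n)))" by simp
      also have "\<dots> \<le> s * 1"
      proof (rule mult_left_mono)
        have "0 < 4 * (real n + 1) * exp (real n)" by (intro mult_pos_pos) auto
        then show "s * (4 * (real n + 1) * exp (real n)) \<le> 1" using s(2) by (simp only: pos_le_divide_eq)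
      qed (use s in simp)
      finally show "exp s ^ j * (v * (exp s - 1)) \<le> s" by simp
      show "norm (mixed_diff T js ts ?g) \<le> mixed_modulus T (j + q) s f" if js: "js \<in> words j" and ts: "ts \<in> steps j s" for js ts
      proof -
        have "mixed_diff T (js @ replicate q 2) (ts @ replicate q s) f = mixed_diff T js ts ?g"
          using js ts by (subst mixed_diff_append) (auto simp: words_def steps_def mixed_diff_T2)
        moreover have "js @ replicate q 2 \<in> words (j + q)" "ts @ replicate q s \<in> steps (j + q) s"
          using js ts s by (auto simp: words_def steps_def)
        ultimately show ?thesis using mixed_diff_le_modulus s by (metis less_imp_le)
      qed
    qed (use s in simp)
  qed (use s in simp)
  also have "\<dots> \<le> 2 ^ n * mixed_modulus T (j + q) s f"
    using jq s by (intro mult_right_mono power_increasing mixed_modulus_nonneg) auto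
  finally show ?thesis .
qed

lemma sub_avg_bound:
  assumes "0 \<le> s"
  shows "norm (((\<lambda>y. y - g1.avg 0 s y) ^^ n) f) \<le> mixed_modulus T n s f"
    and "norm (((\<lambda>y. y - g2.avg 0 s y) ^^ n) f) \<le> mixed_modulus T n s f"
proof -
  have "norm (g1.diffs ts f) \<le> mixed_modulus T n s f" "norm (g2.diffs ts f) \<le> mixed_modulus T n s f"
    if ts: "length ts = n" "set ts \<subseteq> {0..s}" for ts
  proof -
    have "ts \<in> steps n s" using ts by (auto simp: steps_def)
    moreover have "replicate n 1 \<in> words n" "replicate n 2 \<in> words n" by (auto simp: words_def)
    ultimately show "norm (g1.diffs ts f) \<le> mixed_modulus T n s f" "norm (g2.diffs ts f) \<le> mixed_modulus T n s f"
      using mixed_diff_le_modulus[OF _ _ assms] mixed_diff_diffs[of ts f] ts(1) by metis+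
  qed
  then show "norm (((\<lambda>y. y - g1.avg 0 s y) ^^ n) f) \<le> mixed_modulus T n s f"
    "norm (((\<lambda>y. y - g2.avg 0 s y) ^^ n) f) \<le> mixed_modulus T n s f"
    using g1.norm_sub_avg_pow[OF assms] g2.norm_sub_avg_pow[OF assms] by blast+
qed

end

section \<open>High frequencies and best approximation\<close>

context axb_laplace
begin

text \<open>Each term is a modulus of some order \<open>m \<le> n\<close> divided by
  \<open>s ^ m\<close>. \<open>marchaud\<close> lifts it to order \<open>n\<close>, and the factor
  \<open>s ^ n\<close> then leaves the modulus of order \<open>n\<close> and
  \<open>s ^ n * norm f\<close>.\<close>

lemma averaged_modulus_bound:
  fixes k :: nat
  defines "n \<equiv> 2 * k"
  shows "\<exists>C\<ge>0. \<forall>s N f a b. 0 < s \<longrightarrow> s \<le> 1 / (4 * (real n + 1) * exp (real n)) \<longrightarrow> f \<in> G \<longrightarrow>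
     n \<le> a \<longrightarrow> n \<le> b \<longrightarrow> b \<le> 2 * n \<longrightarrow>
     norm (E {(1 / s)\<^sup>2<..real N} ((g1.avg 0 s ^^ a) ((g2.avg 0 s ^^ b) f))) \<le> C * (mixed_modulus T n s f + s ^ n * norm f)"
proof -
  let ?I = "multi_indices n"
  obtain C where C: "0 \<le> C" "\<And>s N f a b. 0 < s \<Longrightarrow> f \<in> G \<Longrightarrow> n \<le> a \<Longrightarrow> n \<le> b \<Longrightarrow>
     norm (E {(1 / s)\<^sup>2<..real N} ((g1.avg 0 s ^^ a) ((g2.avg 0 s ^^ b) f)))
      \<le> C * s ^ n * (\<Sum>i\<in>?I. \<Sum>j\<le>fst i.
          norm ((g1.D s ^^ j) ((g2.avg 0 s ^^ (b - snd i)) ((g2.D s ^^ snd i) f))) / s ^ (j + snd i))"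
    using averaged_bound[of k] unfolding n_def by blast
  have "\<forall>m. \<exists>K. m \<le> n \<longrightarrow> 0 \<le> K \<and> (\<forall>s f. 0 < s \<longrightarrow> s \<le> 1 \<longrightarrow>
      mixed_modulus T m s f / s ^ m \<le> K * (norm f + mixed_modulus T n s f / s ^ n))"
    using marchaud by blast
  then obtain K where K: "\<And>m. m \<le> n \<Longrightarrow> 0 \<le> K m" "\<And>m s f. m \<le> n \<Longrightarrow> 0 < s \<Longrightarrow> s \<le> 1 \<Longrightarrow>
      mixed_modulus T m s f / s ^ m \<le> K m * (norm f + mixed_modulus T n s f / s ^ n)"
    by metis
  define Q where "Q = (\<Sum>i\<in>?I. \<Sum>j\<le>fst i. 2 ^ n * K (j + snd i))"
  have idx: "j + snd i \<le> n" if "i \<in> ?I" "j \<le> fst i" for i j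
    using that by (simp add: multi_indices_def)
  have Q: "0 \<le> Q" unfolding Q_def using K(1) idx by (intro sum_nonneg) auto
  have "norm (E {(1 / s)\<^sup>2<..real N} ((g1.avg 0 s ^^ a) ((g2.avg 0 s ^^ b) f))) \<le> (C * Q) * (mixed_modulus T n s f + s ^ n * norm f)"
    if s: "0 < s" "s \<le> 1 / (4 * (real n + 1) * exp (real n))" and f: "f \<in> G" and ab: "n \<le> a" "n \<le> b" "b \<le> 2 * n" for s N f a b
  proof -
    have "1 * 1 \<le> (4 * (real n + 1)) * exp (real n)" by (intro mult_mono) auto
    then have "1 / (4 * (real n + 1) * exp (real n)) \<le> 1" by (simp add: divide_le_eq_1)
    then have s1: "s \<le> 1" using s(2) by linarith
    let ?R = "norm f + mixed_modulus T n s f / s ^ n"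
    have "norm ((g1.D s ^^ j) ((g2.avg 0 s ^^ (b - snd i)) ((g2.D s ^^ snd i) f))) / s ^ (j + snd i)
        \<le> 2 ^ n * K (j + snd i) * ?R" if "i \<in> ?I" "j \<le> fst i" for i j
    proof -
      have "norm ((g1.D s ^^ j) ((g2.avg 0 s ^^ (b - snd i)) ((g2.D s ^^ snd i) f))) / s ^ (j + snd i)
          \<le> (2 ^ n * mixed_modulus T (j + snd i) s f) / s ^ (j + snd i)"
        using s ab idx[OF that] by (intro divide_right_mono mixed_term_bound[where n = n]) auto
      also have "\<dots> = 2 ^ n * (mixed_modulus T (j + snd i) s f / s ^ (j + snd i))" by simp
      also have "\<dots> \<le> 2 ^ n * (K (j + snd i) * ?R)"
        by (intro mult_left_mono K(2) idx that s(1) s1) simp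
      finally show ?thesis by (simp add: mult.assoc)
    qed
    then have "(\<Sum>i\<in>?I. \<Sum>j\<le>fst i.
          norm ((g1.D s ^^ j) ((g2.avg 0 s ^^ (b - snd i)) ((g2.D s ^^ snd i) f))) / s ^ (j + snd i))
        \<le> Q * ?R"
      unfolding Q_def sum_distrib_right by (intro sum_mono) auto
    then have "norm (E {(1 / s)\<^sup>2<..real N} ((g1.avg 0 s ^^ a) ((g2.avg 0 s ^^ b) f))) \<le> C * s ^ n * (Q * ?R)"
      using s C(1) by (intro order_trans[OF C(2)[OF s(1) f ab(1,2)]] mult_left_mono) auto
    also have "\<dots> = (C * Q) * (s ^ n * ?R)" by simp
    also have "s ^ n * ?R = mixed_modulus T n s f + s ^ n * norm f" using s by (simp add: distrib_left)
    finally show ?thesis .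
  qed
  moreover have "0 \<le> C * Q" using C(1) Q by simp
  ultimately show ?thesis by blast
qed

text \<open>\<open>split_powers\<close> is used twice, from the inside: for fixed \<open>a\<close>
  with the average of \<open>T2\<close> and the seminorm of \<open>E ?S\<close> after
  \<open>a\<close> averages of \<open>T1\<close>, then with the average of \<open>T1\<close> and the
  seminorm of \<open>E ?S\<close> alone. Both exponents then lie between \<open>n\<close> and
  \<open>2 * n\<close>.\<close>

lemma high_frequency_bound_G:
  fixes k :: nat
  defines "n \<equiv> 2 * k"
  shows "\<exists>C\<ge>0. \<forall>s N f. 0 < s \<longrightarrow> s \<le> 1 / (4 * (real n + 1) * exp (real n)) \<longrightarrow> f \<in> G \<longrightarrow>
     norm (E {(1 / s)\<^sup>2<..real N} f) \<le> C * (mixed_modulus T n s f + s ^ n * norm f)"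
proof -
  obtain C where C: "0 \<le> C" "\<And>s N f a b. 0 < s \<Longrightarrow> s \<le> 1 / (4 * (real n + 1) * exp (real n)) \<Longrightarrow> f \<in> G \<Longrightarrow>
     n \<le> a \<Longrightarrow> n \<le> b \<Longrightarrow> b \<le> 2 * n \<Longrightarrow>
     norm (E {(1 / s)\<^sup>2<..real N} ((g1.avg 0 s ^^ a) ((g2.avg 0 s ^^ b) f))) \<le> C * (mixed_modulus T n s f + s ^ n * norm f)"
    using averaged_modulus_bound[of k] unfolding n_def by blast
  \<comment> \<open>The constants of two nested splittings, the inner bound taking the place of
    \<open>\<Lambda>\<close> in the outer one.\<close>
  define K :: real where "K = 4 ^ n * (1 + 2 ^ n * (4 ^ n * (1 + 2 ^ n * C)))"
  have "norm (E {(1 / s)\<^sup>2<..real N} f) \<le> K * (mixed_modulus T n s f + s ^ n * norm f)"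
    if s: "0 < s" "s \<le> 1 / (4 * (real n + 1) * exp (real n))" and f: "f \<in> G" for s N f
  proof -
    let ?S = "{(1 / s)\<^sup>2<..real N}"
    let ?R = "mixed_modulus T n s f + s ^ n * norm f"
    have s0: "0 \<le> s" using s by simp
    have R0: "0 \<le> ?R" using s mixed_modulus_nonneg[OF s0] by simp
    have \<omega>: "mixed_modulus T n s f \<le> ?R" using s by simp
    have lE: "bounded_linear (E ?S)" by (rule bounded_linear_E) simp
    have nE: "norm (E ?S x) \<le> norm x" for x by (rule norm_E_le) simp
    have lM: "linear (g1.avg 0 s)" "linear (g2.avg 0 s)"
      using g1.bounded_linear_avg[of 0 s] g2.bounded_linear_avg[of 0 s] s0 by (auto intro: bounded_linear.linear)
    have nM: "norm (g1.avg 0 s x) \<le> norm x" "norm (g2.avg 0 s x) \<le> norm x" for x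
      using g1.norm_avg[of 0 s x] g2.norm_avg[of 0 s x] s0 by auto
    have inner_split: "norm (E ?S ((g1.avg 0 s ^^ a) f)) \<le> 4 ^ n * (?R + 2 ^ n * (C * ?R))" if a: "n \<le> a" for a
    proof -
      define p where "p x = norm (E ?S ((g1.avg 0 s ^^ a) x))" for x
      have lp: "bounded_linear (\<lambda>x. E ?S ((g1.avg 0 s ^^ a) x))"
        using s0 by (intro bounded_linear_compose[OF lE] g1.bounded_linear_funpow g1.bounded_linear_avg) auto
      have "p f \<le> 4 ^ n * (norm (((\<lambda>y. y - g2.avg 0 s y) ^^ n) f) + 2 ^ n * (C * ?R))"
      proof (rule split_powers[OF lM(2) nM(2)])
        show "p (x + y) \<le> p x + p y" for x y
          unfolding p_def linear_add[OF bounded_linear.linear[OF lp]] by (rule norm_triangle_ineq)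
        show "p (x - y) \<le> p x + p y" for x y
          unfolding p_def linear_diff[OF bounded_linear.linear[OF lp]] by (rule norm_triangle_ineq4)
        show "p x \<le> norm x" for x
          unfolding p_def using order_trans[OF nE g1.norm_avg_pow] s0 by simp
        show "p ((g2.avg 0 s ^^ b) f) \<le> C * ?R" if "n \<le> b" "b \<le> 2 * n" for b
          unfolding p_def by (rule C(2)[OF s f a that])
      qed (use C(1) R0 in simp)
      also have "\<dots> \<le> 4 ^ n * (?R + 2 ^ n * (C * ?R))"
        using order_trans[OF sub_avg_bound(2)[OF s0] \<omega>] by (intro mult_left_mono add_right_mono) auto
      finally show ?thesis by (simp add: p_def)
    qed
    have "norm (E ?S f) \<le> 4 ^ n * (norm (((\<lambda>y. y - g1.avg 0 s y) ^^ n) f) + 2 ^ n * (4 ^ n * (?R + 2 ^ n * (C * ?R))))"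
    proof (rule split_powers[OF lM(1) nM(1)])
      show "norm (E ?S (x + y)) \<le> norm (E ?S x) + norm (E ?S y)" for x y
        unfolding linear_add[OF bounded_linear.linear[OF lE]] by (rule norm_triangle_ineq)
      show "norm (E ?S (x - y)) \<le> norm (E ?S x) + norm (E ?S y)" for x y
        unfolding linear_diff[OF bounded_linear.linear[OF lE]] by (rule norm_triangle_ineq4)
      show "0 \<le> 4 ^ n * (?R + 2 ^ n * (C * ?R))" using C(1) R0 by simp
    qed (use nE inner_split in auto)
    also have "\<dots> \<le> 4 ^ n * (?R + 2 ^ n * (4 ^ n * (?R + 2 ^ n * (C * ?R))))"
      using order_trans[OF sub_avg_bound(1)[OF s0] \<omega>] by (intro mult_left_mono add_right_mono) auto
    also have "\<dots> = K * ?R" by (simp add: K_def algebra_simps)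
    finally show ?thesis .
  qed
  moreover have "0 \<le> K" using C(1) by (simp add: K_def)
  ultimately show ?thesis by blast
qed

text \<open>Approximation of \<open>f\<close> from \<open>G\<close>: replacing \<open>f\<close> by
  \<open>X m\<close> changes each mixed difference by at most \<open>2 ^ n * norm (X m - f)\<close>.
  The other factor \<open>2 ^ n\<close> is the number of words, lost in passing from single
  differences to their sum.\<close>

lemma high_frequency_bound:
  fixes k :: nat
  defines "n \<equiv> 2 * k"
  shows "\<exists>C\<ge>0. \<forall>s N f. 0 < s \<longrightarrow> s \<le> 1 / (4 * (real n + 1) * exp (real n)) \<longrightarrow>
     norm (E {(1 / s)\<^sup>2<..real N} f) \<le> C * (mixed_modulus T n s f + s ^ n * norm f)"
proof -
  obtain C where C: "0 \<le> C" "\<And>s N f. 0 < s \<Longrightarrow> s \<le> 1 / (4 * (real n + 1) * exp (real n)) \<Longrightarrow> f \<in> G \<Longrightarrow>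
     norm (E {(1 / s)\<^sup>2<..real N} f) \<le> C * (mixed_modulus T n s f + s ^ n * norm f)"
    using high_frequency_bound_G[of k] unfolding n_def by blast
  have "norm (E {(1 / s)\<^sup>2<..real N} f) \<le> (C * 2 ^ n + C) * (mixed_modulus T n s f + s ^ n * norm f)"
    if s: "0 < s" "s \<le> 1 / (4 * (real n + 1) * exp (real n))" for s N f
  proof -
    let ?S = "{(1 / s)\<^sup>2<..real N}"
    let ?\<omega> = "mixed_modulus T n s f"
    have s0: "0 \<le> s" using s by simp
    have "f \<in> closure G" by (simp add: closure_G)
    then obtain X where X: "\<And>m. X m \<in> G" "X \<longlonglongrightarrow> f" unfolding closure_sequential by blast
    have "mixed_modulus T n s (X m) \<le> 2 ^ n * (?\<omega> + 2 ^ n * norm (X m - f))" for m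
    proof (rule mixed_modulus_le[OF s0])
      fix js ts assume w: "js \<in> words n" "ts \<in> steps n s"
      then have l: "length js = length ts" "length js = n" by (auto simp: words_def steps_def)
      have "mixed_diff T js ts (X m) = mixed_diff T js ts f + mixed_diff T js ts (X m - f)"
        by (simp add: mixed_diff_diff[OF l(1)])
      then show "norm (mixed_diff T js ts (X m)) \<le> ?\<omega> + 2 ^ n * norm (X m - f)"
        using norm_triangle_mono[OF mixed_diff_le_modulus[OF w s0] norm_mixed_diff[OF l(1), of "X m - f"]] l(2) by simp
    qed
    then have "norm (E ?S (X m)) \<le> C * (2 ^ n * (?\<omega> + 2 ^ n * norm (X m - f)) + s ^ n * norm (X m))" for m
      using C(1) by (intro order_trans[OF C(2)[OF s X(1)]] mult_left_mono add_right_mono) auto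
    moreover have "(\<lambda>m. norm (E ?S (X m))) \<longlonglongrightarrow> norm (E ?S f)"
      by (intro tendsto_norm bounded_linear.tendsto[OF bounded_linear_E X(2)]) simp
    moreover have "(\<lambda>m. C * (2 ^ n * (?\<omega> + 2 ^ n * norm (X m - f)) + s ^ n * norm (X m)))
        \<longlonglongrightarrow> C * (2 ^ n * (?\<omega> + 2 ^ n * norm (f - f)) + s ^ n * norm f)"
      by (intro tendsto_mult tendsto_add tendsto_const tendsto_norm tendsto_diff X(2))
    ultimately have "norm (E ?S f) \<le> C * (2 ^ n * (?\<omega> + 2 ^ n * norm (f - f)) + s ^ n * norm f)"
      by (intro LIMSEQ_le) auto
    also have "\<dots> = C * 2 ^ n * ?\<omega> + C * (s ^ n * norm f)" by (simp add: distrib_left mult.assoc)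
    also have "\<dots> \<le> (C * 2 ^ n + C) * (?\<omega> + s ^ n * norm f)"
      using C(1) s0 mixed_modulus_nonneg[OF s0, of n f]
      by (simp add: distrib_left distrib_right)
    finally show ?thesis .
  qed
  moreover have "0 \<le> C * 2 ^ n + C" using C(1) by simp
  ultimately show ?thesis by blast
qed

lemma jackson:
  "\<exists>C>0. \<forall>f \<sigma>. \<sigma> > 0 \<longrightarrow>
     best_approx E \<sigma> f \<le> C * (mixed_modulus T r (1 / \<sigma>) f + min (1 / \<sigma> ^ r) 1 * norm f)"
proof -
  \<comment> \<open>Even, and at least \<open>r\<close>, so that \<open>mixed_modulus_add\<close>
    returns to order \<open>r\<close>.\<close>
  define n where "n = 2 * r"
  define s0 where "s0 = 1 / (4 * (real n + 1) * exp (real n))"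
  have "1 * 1 \<le> (4 * (real n + 1)) * exp (real n)" by (intro mult_mono) auto
  then have s0: "0 < s0" "s0 \<le> 1" unfolding s0_def by (auto simp: divide_le_eq_1)
  obtain C where C: "0 \<le> C" "\<And>s N f. 0 < s \<Longrightarrow> s \<le> s0 \<Longrightarrow>
     norm (E {(1 / s)\<^sup>2<..real N} f) \<le> C * (mixed_modulus T n s f + s ^ n * norm f)"
    using high_frequency_bound[of r] unfolding n_def s0_def by blast
  obtain B where B: "0 \<le> B" "\<And>s f. 0 \<le> s \<Longrightarrow> mixed_modulus T n s f \<le> B * mixed_modulus T r s f"
    using mixed_modulus_add[of r r] unfolding n_def mult_2 by blast
  \<comment> \<open>\<open>C * B\<close> and \<open>C\<close> serve the case
    \<open>s \<le> s0\<close>; for larger \<open>s\<close> the norm of \<open>f\<close> is at most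
    \<open>1 / s0 ^ r\<close> times \<open>min (s ^ r) 1 * norm f\<close>.\<close>
  define K where "K = C * B + C + 1 / s0 ^ r"
  have K: "K > 0" unfolding K_def using C(1) B(1) s0 by (intro add_nonneg_pos) auto
  have "best_approx E \<sigma> f \<le> K * (mixed_modulus T r (1 / \<sigma>) f + min (1 / \<sigma> ^ r) 1 * norm f)" if \<sigma>: "\<sigma> > 0" for \<sigma> f
  proof (rule best_approx_le[OF E_neg \<sigma>])
    fix N :: nat
    define s where "s = 1 / \<sigma>"
    have s: "0 < s" "\<sigma> = 1 / s" "1 / \<sigma> ^ r = s ^ r" using \<sigma> by (auto simp: s_def power_divide)
    have \<omega>: "0 \<le> mixed_modulus T r s f" using s by (intro mixed_modulus_nonneg) simp
    let ?m = "min (s ^ r) 1 * norm f"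
    have m: "0 \<le> ?m" using s by simp
    have "norm (E {(1 / s)\<^sup>2<..real N} f) \<le> K * (mixed_modulus T r s f + ?m)"
    proof (cases "s \<le> s0")
      case True
      then have s1: "s \<le> 1" using s0 by linarith
      have "s ^ n \<le> s ^ r" unfolding n_def using s s1 by (intro power_decreasing) auto
      moreover have "s ^ r \<le> 1" using s s1 by (simp add: power_le_one)
      ultimately have "s ^ n * norm f \<le> ?m" by (simp add: mult_right_mono)
      then have "norm (E {(1 / s)\<^sup>2<..real N} f) \<le> C * (B * mixed_modulus T r s f + ?m)"
        using s C(1) by (intro order_trans[OF C(2)[OF s(1) True]] mult_left_mono add_mono B(2)) auto
      also have "\<dots> = C * B * mixed_modulus T r s f + C * ?m" by (simp add: distrib_left)
      also have "\<dots> \<le> K * mixed_modulus T r s f + K * ?m"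
        unfolding K_def using C(1) B(1) s0 \<omega> m by (intro add_mono mult_right_mono) auto
      finally show ?thesis by (simp add: distrib_left)
    next
      case False
      then have "s0 ^ r \<le> s ^ r" "s0 ^ r \<le> 1" using s0 by (auto intro: power_mono power_le_one)
      then have "s0 ^ r * norm f \<le> ?m" by (intro mult_right_mono) auto
      then have "norm f \<le> 1 / s0 ^ r * ?m" using s0 by (simp add: field_simps)
      also have "\<dots> \<le> K * ?m" unfolding K_def using C(1) B(1) m by (intro mult_right_mono) auto
      also have "\<dots> \<le> K * (mixed_modulus T r s f + ?m)" using K \<omega> by (intro mult_left_mono) auto
      finally show ?thesis using norm_E_le[of "{(1 / s)\<^sup>2<..real N}" f] by simp
    qed
    then show "norm (E {\<sigma>\<^sup>2<..real N} f) \<le> K * (mixed_modulus T r (1 / \<sigma>) f + min (1 / \<sigma> ^ r) 1 * norm f)"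
      unfolding s(3) s_def[symmetric] unfolding s(2) .
  qed
  then show ?thesis using K by blast
qed

end

theorem mainTheorem11:
  fixes T :: "real \<Rightarrow> real \<Rightarrow> 'a::{real_inner,complete_space} \<Rightarrow> 'a"
    and E :: "real set \<Rightarrow> 'a \<Rightarrow> 'a"
    and r :: nat
  assumes "unitary_axb_rep T"
    and "spectral_resolution_of E (laplacian_graph T)"
  shows "\<exists>C > 0. \<forall>f \<sigma>. \<sigma> > 0 \<longrightarrow>
           best_approx E \<sigma> f
             \<le> C * (mixed_modulus T r (1 / \<sigma>) f + min (1 / \<sigma> ^ r) 1 * norm f)"
proof -
  interpret axb_laplace T E
    using assms by unfold_locales
  show ?thesis by (rule jackson)
qed

end
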